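(* Let $\mathcal{A}$ be an Exploration algorithm that explores every finite graph in $\mathrm{SC}$, i.e., on every graph $G\in\mathrm{SC}$ (with any port numbering) and from every starting vertex it visits all vertices and halts. Then for every computable function $f:\mathbb{N}\to\mathbb{N}$ there exists a graph $G\in\mathrm{SC}$ (with a port numbering and a starting vertex) such that, when executed on $G$, $\mathcal{A}$ executes strictly more than $f(|V(G)|)$ steps.
   Context: All graphs are simple, connected, undirected. A port numbering assigns to each vertex $v$ an injective map $\delta_v$ from the neighbours of $v$ to $\mathbb{N}$. Binoculars labelling: each vertex $v$ carries the label $\nu(v)$, the subgraph induced by the closed neighbourhood of $v$ with the port numbers of its edges (up to isomorphism preserving ports and the central vertex). A mobile agent is a deterministic Turing machine with unbounded memory moving in the graph from an unmarked starting vertex; at each step, at vertex $v$, it has access only to $\nu(v)$ and to the port number through which it entered $v$, updates its memory, and either halts or moves along the edge at $v$ with a chosen port number (a step). An algorithm is an Exploration algorithm if for every finite graph with binoculars labelling, every port numbering and every starting vertex, either the agent visits every vertex at least once and halts, or it never halts. The clique complex $\mathcal{X}(G)$ has the cliques of $G$ as simplices. Elementary homotopies of paths in a complex: insert/delete a subpath $(u,v,u)$; replace a subpath $q$ by $q'$ with same endpoints where $q^{-1}q'$ is a triangle ($q$ or $q'$ may be empty). A complex is simply connected if every cycle can be reduced to a single vertex by a finite sequence of elementary homotopies. $\mathrm{SC}$ is the class of finite graphs $G$ whose clique complex $\mathcal{X}(G)$ is simply connected. *)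

theory Defs
  imports "Graph_Theory.Digraph_Component"
begin

section \<open>Graphs and port numberings\<close>

text \<open>Undirected simple graphs are loop-free symmetric digraphs whose arcs are pairs of vertices;
  \<^const>\<open>pair_graph\<close> includes finiteness.\<close>

definition finite_graph :: "'a pair_pre_digraph \<Rightarrow> bool" where
  "finite_graph G \<longleftrightarrow> pair_graph G \<and> Digraph_Component.connected (with_proj G)"

definition nbrs :: "'a pair_pre_digraph \<Rightarrow> 'a \<Rightarrow> 'a set" where
  "nbrs G v = {u. (v, u) \<in> parcs G}"

definition port_numbering :: "'a pair_pre_digraph \<Rightarrow> ('a \<Rightarrow> 'a \<Rightarrow> nat) \<Rightarrow> bool" where
  "port_numbering G \<delta> \<longleftrightarrow> (\<forall>v\<in>pverts G. inj_on (\<delta> v) (nbrs G v))"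

section \<open>Binoculars labelling\<close>

definition closed_nbhd :: "'a pair_pre_digraph \<Rightarrow> 'a \<Rightarrow> 'a set" where
  "closed_nbhd G v = insert v (nbrs G v)"

text \<open>The label of a vertex is the isomorphism class, in the following sense, of the subgraph
  induced by its closed neighbourhood.\<close>

definition binoculars_iso ::
  "'a pair_pre_digraph \<Rightarrow> ('a \<Rightarrow> 'a \<Rightarrow> nat) \<Rightarrow> 'a \<Rightarrow>
   'b pair_pre_digraph \<Rightarrow> ('b \<Rightarrow> 'b \<Rightarrow> nat) \<Rightarrow> 'b \<Rightarrow> bool" where
  "binoculars_iso G \<delta> v H \<epsilon> w \<longleftrightarrow>
     (\<exists>\<phi>. bij_betw \<phi> (closed_nbhd G v) (closed_nbhd H w) \<and> \<phi> v = w \<and>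
       (\<forall>x\<in>closed_nbhd G v. \<forall>y\<in>closed_nbhd G v.
          ((x, y) \<in> parcs G \<longleftrightarrow> (\<phi> x, \<phi> y) \<in> parcs H) \<and>
          ((x, y) \<in> parcs G \<longrightarrow> \<delta> x y = \<epsilon> (\<phi> x) (\<phi> y))))"

definition nbr_at :: "'a pair_pre_digraph \<Rightarrow> ('a \<Rightarrow> 'a \<Rightarrow> nat) \<Rightarrow> 'a \<Rightarrow> nat \<Rightarrow> 'a" where
  "nbr_at G \<delta> v p = (THE u. u \<in> nbrs G v \<and> \<delta> v u = p)"

text \<open>Since the ports at the centre identify its neighbours, the isomorphism class has a canonical
  presentation as a list of numbers: the degree, the ports at the centre in increasing order, the
  ports leading back to the centre, and the matrix of ports between neighbours (\<open>0\<close> for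
  non-adjacent ones, otherwise port number plus one). Lemma \<open>binoculars_eq_iff\<close> below
  shows that two vertices have the same presentation iff their labels are isomorphic.\<close>

definition binoculars :: "'a pair_pre_digraph \<Rightarrow> ('a \<Rightarrow> 'a \<Rightarrow> nat) \<Rightarrow> 'a \<Rightarrow> nat list" where
  "binoculars G \<delta> v =
     (let ps = sorted_list_of_set (\<delta> v ` nbrs G v); n = nbr_at G \<delta> v in
        length ps # ps @ map (\<lambda>p. \<delta> (n p) v) ps @
        map (\<lambda>(p, q). if (n p, n q) \<in> parcs G then Suc (\<delta> (n p) (n q)) else 0)
          (List.product ps ps))"

lemma nbr_at_port:
  assumes "port_numbering G \<delta>" "v \<in> pverts G" "u \<in> nbrs G v"
  shows "nbr_at G \<delta> v (\<delta> v u) = u"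
  using assms unfolding nbr_at_def port_numbering_def by (auto simp: inj_on_def)

lemma finite_nbrs: "pair_graph G \<Longrightarrow> finite (nbrs G v)"
proof -
  assume "pair_graph G"
  then have "finite (parcs G)"
    by (simp add: pair_graph_def pair_digraph_def pair_fin_digraph.pair_finite_arcs)
  moreover have "nbrs G v \<subseteq> snd ` parcs G" by (force simp: nbrs_def)
  ultimately show ?thesis using finite_surj by blast
qed

lemma pair_graph_sym: "pair_graph G \<Longrightarrow> (x, y) \<in> parcs G \<longleftrightarrow> (y, x) \<in> parcs G"
proof -
  assume "pair_graph G"
  then have "symmetric (with_proj G)"
    by (simp add: pair_graph_def pair_pseudo_graph_def pair_sym_digraph.pair_sym_arcs)
  then have "sym (parcs G)" by (simp add: symmetric_def)
  then show ?thesis by (auto dest: symD)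
qed

lemma pair_graph_irrefl: "pair_graph G \<Longrightarrow> (x, x) \<notin> parcs G"
  by (auto simp: pair_graph_def pair_digraph_def dest: pair_loopfree_digraph.pair_no_loops)

lemma binoculars_eq_iff:
  assumes G: "pair_graph G" "port_numbering G \<delta>" "v \<in> pverts G"
    and H: "pair_graph H" "port_numbering H \<epsilon>" "w \<in> pverts H"
  shows "binoculars G \<delta> v = binoculars H \<epsilon> w \<longleftrightarrow> binoculars_iso G \<delta> v H \<epsilon> w"
proof
  let ?P = "\<delta> v ` nbrs G v" and ?Q = "\<epsilon> w ` nbrs H w"
  define BG where "BG p = \<delta> (nbr_at G \<delta> v p) v" for p
  define BH where "BH p = \<epsilon> (nbr_at H \<epsilon> w p) w" for p
  define MG where "MG p q = (if (nbr_at G \<delta> v p, nbr_at G \<delta> v q) \<in> parcs G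
      then Suc (\<delta> (nbr_at G \<delta> v p) (nbr_at G \<delta> v q)) else 0)" for p q
  define MH where "MH p q = (if (nbr_at H \<epsilon> w p, nbr_at H \<epsilon> w q) \<in> parcs H
      then Suc (\<epsilon> (nbr_at H \<epsilon> w p) (nbr_at H \<epsilon> w q)) else 0)" for p q
  have codeG: "binoculars G \<delta> v = length (sorted_list_of_set ?P) # sorted_list_of_set ?P @
      map BG (sorted_list_of_set ?P) @
      map (\<lambda>(p, q). MG p q) (List.product (sorted_list_of_set ?P) (sorted_list_of_set ?P))"
    unfolding binoculars_def Let_def BG_def MG_def ..
  have codeH: "binoculars H \<epsilon> w = length (sorted_list_of_set ?Q) # sorted_list_of_set ?Q @
      map BH (sorted_list_of_set ?Q) @
      map (\<lambda>(p, q). MH p q) (List.product (sorted_list_of_set ?Q) (sorted_list_of_set ?Q))"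
    unfolding binoculars_def Let_def BH_def MH_def ..
  have fin: "finite ?P" "finite ?Q"
    using finite_nbrs[OF G(1)] finite_nbrs[OF H(1)] by simp_all
  have atG: "nbr_at G \<delta> v (\<delta> v u) = u" if "u \<in> nbrs G v" for u
    using that G nbr_at_port by metis
  have atH: "nbr_at H \<epsilon> w (\<epsilon> w u) = u" if "u \<in> nbrs H w" for u
    using that H nbr_at_port by metis
  have symG: "(u, v) \<in> parcs G" "(v, u) \<in> parcs G" if "u \<in> nbrs G v" for u
    using that pair_graph_sym[OF G(1)] unfolding nbrs_def by blast+
  have symH: "(u, w) \<in> parcs H" "(w, u) \<in> parcs H" if "u \<in> nbrs H w" for u
    using that pair_graph_sym[OF H(1)] unfolding nbrs_def by blast+
  have vG: "v \<notin> nbrs G v" and wH: "w \<notin> nbrs H w"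
    using pair_graph_irrefl[OF G(1)] pair_graph_irrefl[OF H(1)] by (simp_all add: nbrs_def)
  { assume eq: "binoculars G \<delta> v = binoculars H \<epsilon> w"
    have split: "xs = xs' \<and> ys = ys' \<and> zs = zs'"
      if "length xs # xs @ map b xs @ zs = length xs' # xs' @ map b' xs' @ zs'"
        "ys = map b xs" "ys' = map b' xs'"
      for xs xs' ys ys' zs zs' :: "nat list" and b b'
      using that by (auto simp: append_eq_append_conv)
    note eq' = split[OF eq[unfolded codeG codeH] refl refl]
    have "set (sorted_list_of_set ?P) = set (sorted_list_of_set ?Q)"
      by (rule arg_cong[OF conjunct1[OF eq']])
    then have PQ: "?P = ?Q" unfolding set_sorted_list_of_set[OF fin(1)] set_sorted_list_of_set[OF fin(2)] .
    note bks = eq'[THEN conjunct2, THEN conjunct1] and mts = eq'[THEN conjunct2, THEN conjunct2]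
    have ret: "BG p = BH p" if "p \<in> ?P" for p
      using bks that fin unfolding PQ map_eq_conv by auto
    have mat: "MG p q = MH p q" if "p \<in> ?P" "q \<in> ?P" for p q
      using mts that fin unfolding PQ map_eq_conv by auto
    define \<phi> where "\<phi> x = (if x = v then w else nbr_at H \<epsilon> w (\<delta> v x))" for x
    define \<psi> where "\<psi> y = (if y = w then v else nbr_at G \<delta> v (\<epsilon> w y))" for y
    have phi: "\<phi> u \<in> nbrs H w" "\<epsilon> w (\<phi> u) = \<delta> v u" if u: "u \<in> nbrs G v" for u
    proof -
      have "\<delta> v u \<in> ?Q" using u PQ by blast
      then obtain y where "y \<in> nbrs H w" "\<epsilon> w y = \<delta> v u" by (metis imageE)
      moreover from this have "nbr_at H \<epsilon> w (\<delta> v u) = y" using atH[of y] by simp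
      moreover have "u \<noteq> v" using u vG by blast
      ultimately have "\<phi> u = y" "y \<in> nbrs H w" "\<epsilon> w y = \<delta> v u" unfolding \<phi>_def by argo+
      then show "\<phi> u \<in> nbrs H w" "\<epsilon> w (\<phi> u) = \<delta> v u" by blast+
    qed
    have psi: "\<psi> y \<in> nbrs G v" "\<delta> v (\<psi> y) = \<epsilon> w y" if y: "y \<in> nbrs H w" for y
    proof -
      have "\<epsilon> w y \<in> ?P" using y PQ by blast
      then obtain u where "u \<in> nbrs G v" "\<delta> v u = \<epsilon> w y" by (metis imageE)
      moreover from this have "nbr_at G \<delta> v (\<epsilon> w y) = u" using atG[of u] by simp
      moreover have "y \<noteq> w" using y wH by blast
      ultimately have "\<psi> y = u" "u \<in> nbrs G v" "\<delta> v u = \<epsilon> w y" unfolding \<psi>_def by argo+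
      then show "\<psi> y \<in> nbrs G v" "\<delta> v (\<psi> y) = \<epsilon> w y" by blast+
    qed
    have phv: "\<phi> v = w" and psw: "\<psi> w = v" by (simp_all add: \<phi>_def \<psi>_def)
    have ps_ph: "\<psi> (\<phi> u) = u" if "u \<in> nbrs G v" for u
      using phi[OF that] atG[OF that] wH unfolding \<psi>_def by metis
    have ph_ps: "\<phi> (\<psi> y) = y" if "y \<in> nbrs H w" for y
      using psi[OF that] atH[OF that] vG unfolding \<phi>_def by metis
    have "bij_betw \<phi> (closed_nbhd G v) (closed_nbhd H w)"
      by (rule bij_betw_byWitness[where f' = \<psi>])
        (auto simp: closed_nbhd_def phv psw ps_ph ph_ps phi psi)
    moreover have "((x, y) \<in> parcs G \<longleftrightarrow> (\<phi> x, \<phi> y) \<in> parcs H) \<and>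
          ((x, y) \<in> parcs G \<longrightarrow> \<delta> x y = \<epsilon> (\<phi> x) (\<phi> y))"
      if xy: "x \<in> closed_nbhd G v" "y \<in> closed_nbhd G v" for x y
    proof -
      have atph: "nbr_at H \<epsilon> w (\<delta> v u) = \<phi> u" if "u \<in> nbrs G v" for u
        using that vG by (auto simp: \<phi>_def)
      consider "x = v" "y = v" | "x = v" "y \<in> nbrs G v" | "x \<in> nbrs G v" "y = v"
        | "x \<in> nbrs G v" "y \<in> nbrs G v"
        using xy by (auto simp: closed_nbhd_def)
      then show ?thesis
      proof cases
        case 1 then show ?thesis using pair_graph_irrefl[OF G(1)] pair_graph_irrefl[OF H(1)] by auto
      next
        case 2 then show ?thesis using symG[OF 2(2)] symH[OF phi(1)[OF 2(2)]] phi[OF 2(2)] phv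
          by simp
      next
        case 3
        then have "\<delta> x v = \<epsilon> (\<phi> x) w" using ret[of "\<delta> v x"] atG[OF 3(1)] atph[OF 3(1)]
          unfolding BG_def BH_def by simp
        with 3 show ?thesis using symG[OF 3(1)] symH[OF phi(1)[OF 3(1)]] phv by simp
      next
        case 4
        then have "(if (x, y) \<in> parcs G then Suc (\<delta> x y) else 0) =
            (if (\<phi> x, \<phi> y) \<in> parcs H then Suc (\<epsilon> (\<phi> x) (\<phi> y)) else 0)"
          using mat[of "\<delta> v x" "\<delta> v y"] unfolding MG_def MH_def atG[OF 4(1)] atG[OF 4(2)]
            atph[OF 4(1)] atph[OF 4(2)] by simp
        then show ?thesis by (auto split: if_splits)
      qed
    qed
    ultimately show "binoculars_iso G \<delta> v H \<epsilon> w"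
      unfolding binoculars_iso_def using phv by blast }
  { assume "binoculars_iso G \<delta> v H \<epsilon> w"
    then obtain \<phi> where bij: "bij_betw \<phi> (closed_nbhd G v) (closed_nbhd H w)" and phv: "\<phi> v = w"
      and arc: "\<And>x y. x \<in> closed_nbhd G v \<Longrightarrow> y \<in> closed_nbhd G v \<Longrightarrow>
          (x, y) \<in> parcs G \<longleftrightarrow> (\<phi> x, \<phi> y) \<in> parcs H"
      and port: "\<And>x y. x \<in> closed_nbhd G v \<Longrightarrow> y \<in> closed_nbhd G v \<Longrightarrow>
          (x, y) \<in> parcs G \<Longrightarrow> \<delta> x y = \<epsilon> (\<phi> x) (\<phi> y)"
      unfolding binoculars_iso_def by blast
    have cn: "v \<in> closed_nbhd G v" "\<And>u. u \<in> nbrs G v \<Longrightarrow> u \<in> closed_nbhd G v"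
      by (auto simp: closed_nbhd_def)
    have img: "\<phi> ` nbrs G v = nbrs H w"
    proof -
      have "nbrs G v = closed_nbhd G v - {v}" "nbrs H w = closed_nbhd H w - {w}"
        using vG wH by (auto simp: closed_nbhd_def)
      moreover have "inj_on \<phi> (closed_nbhd G v)" "\<phi> ` closed_nbhd G v = closed_nbhd H w"
        using bij by (auto simp: bij_betw_def)
      ultimately show ?thesis
        using cn(1) phv inj_on_image_set_diff[of \<phi> "closed_nbhd G v" "closed_nbhd G v" "{v}"]
        by auto
    qed
    have pt: "\<delta> v u = \<epsilon> w (\<phi> u)" if "u \<in> nbrs G v" for u
      using port[OF cn(1) cn(2)[OF that] symG(2)[OF that]] phv by simp
    have PQ: "?P = ?Q" unfolding img[symmetric] image_image using pt by (rule image_cong[OF refl])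
    have at: "nbr_at H \<epsilon> w (\<delta> v u) = \<phi> u" if "u \<in> nbrs G v" for u
      using atH[of "\<phi> u"] pt[OF that] img that by auto
    have bk: "BG p = BH p" if "p \<in> ?P" for p
    proof -
      obtain u where u: "u \<in> nbrs G v" "p = \<delta> v u" using \<open>p \<in> ?P\<close> by blast
      show ?thesis unfolding BG_def BH_def u(2) atG[OF u(1)] at[OF u(1)]
        using port[OF cn(2)[OF u(1)] cn(1) symG(1)[OF u(1)]] phv by simp
    qed
    have mt: "MG p q = MH p q" if "p \<in> ?P" "q \<in> ?P" for p q
    proof -
      obtain x where x: "x \<in> nbrs G v" "p = \<delta> v x" using \<open>p \<in> ?P\<close> by blast
      obtain y where y: "y \<in> nbrs G v" "q = \<delta> v y" using \<open>q \<in> ?P\<close> by blast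
      show ?thesis unfolding MG_def MH_def x(2) y(2) atG[OF x(1)] at[OF x(1)] atG[OF y(1)] at[OF y(1)]
        using arc[OF cn(2)[OF x(1)] cn(2)[OF y(1)]] port[OF cn(2)[OF x(1)] cn(2)[OF y(1)]]
        by simp
    qed
    have "map BG (sorted_list_of_set ?P) = map BH (sorted_list_of_set ?P)"
      using bk fin by simp
    moreover have "map (\<lambda>(p, q). MG p q) (List.product (sorted_list_of_set ?P) (sorted_list_of_set ?P))
        = map (\<lambda>(p, q). MH p q) (List.product (sorted_list_of_set ?P) (sorted_list_of_set ?P))"
      unfolding map_eq_conv using mt fin by auto
    ultimately show "binoculars G \<delta> v = binoculars H \<epsilon> w"
      unfolding codeG codeH PQ by (simp only:) }
qed

section \<open>Mobile agents\<close>

text \<open>An agent is a deterministic Turing machine with a finite control, a two-way infinite work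
  tape, which persists during the whole execution, and a read-only observation tape, whose contents
  are replaced on each arrival at a vertex.\<close>

datatype dir = Go_Left | Stay | Go_Right

datatype obs_symbol = Stroke | Separator

text \<open>\<open>Move q\<close>: leave the current vertex and continue in state \<open>q\<close> at the next one.\<close>

datatype 'q control = Compute 'q | Move 'q | Halt

text \<open>Cells hold \<^term>\<open>None\<close> when blank. The first list is the part to the left of the head, nearest
  cell first; the second list starts with the scanned cell; all other cells are blank.\<close>

type_synonym 's tape = "'s option list \<times> 's option list"

fun scanned :: "'s tape \<Rightarrow> 's option" where
  "scanned (l, []) = None"
| "scanned (l, x # r) = x"

fun overwrite :: "'s option \<Rightarrow> 's tape \<Rightarrow> 's tape" where
  "overwrite x (l, r) = (l, x # tl r)"

fun shift :: "dir \<Rightarrow> 's tape \<Rightarrow> 's tape" where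
  "shift Stay t = t"
| "shift Go_Left ([], r) = ([], None # r)"
| "shift Go_Left (x # l, r) = (l, x # r)"
| "shift Go_Right (l, []) = (None # l, [])"
| "shift Go_Right (l, x # r) = (x # l, r)"

text \<open>The state and alphabet types \<open>'q\<close> and \<open>'s\<close> range over finite types, so that
  \<open>trans\<close> is a finite table. A transition depends on the state and the two scanned symbols; it
  yields the new control, the symbol written on the work tape, and the moves of the work head and
  the observation head.\<close>

record ('q, 's) agent =
  start :: 'q
  mark :: 's
  trans :: "'q \<Rightarrow> 's option \<Rightarrow> obs_symbol option \<Rightarrow> 'q control \<times> 's option \<times> dir \<times> dir"

type_synonym ('q, 's) conf = "'q control \<times> 's tape \<times> obs_symbol tape"

definition tm_step :: "('q, 's) agent \<Rightarrow> 'q \<Rightarrow> 's tape \<Rightarrow> obs_symbol tape \<Rightarrow> ('q, 's) conf" where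
  "tm_step A q W I =
     (case trans A q (scanned W) (scanned I) of
        (c, x, d, e) \<Rightarrow> (c, shift d (overwrite x W), shift e I))"

text \<open>The chosen port number is written in unary on the work tape, starting at the head.\<close>

definition chosen_port :: "('q, 's) agent \<Rightarrow> 's tape \<Rightarrow> nat" where
  "chosen_port A W = length (takeWhile (\<lambda>x. x = Some (mark A)) (snd W))"

definition unary_word :: "nat list \<Rightarrow> obs_symbol list" where
  "unary_word ns = concat (map (\<lambda>n. replicate n Stroke @ [Separator]) ns)"

text \<open>The first number is \<open>0\<close> at the start of the execution, and the entry port plus one
  afterwards.\<close>

definition observation ::
  "'a pair_pre_digraph \<Rightarrow> ('a \<Rightarrow> 'a \<Rightarrow> nat) \<Rightarrow> 'a \<Rightarrow> nat option \<Rightarrow> obs_symbol tape" where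
  "observation G \<delta> v entry =
     ([], map Some (unary_word ((case entry of None \<Rightarrow> 0 | Some p \<Rightarrow> Suc p) # binoculars G \<delta> v)))"

lemma unary_word_inject: "unary_word ms = unary_word ns \<longleftrightarrow> ms = ns"
proof
  have rep: "m = n \<and> xs = ys"
    if "replicate m Stroke @ Separator # xs = replicate n Stroke @ Separator # ys" for m n xs ys
    using that
  proof (induction m arbitrary: n)
    case 0 then show ?case by (cases n) auto
  next
    case (Suc m) then show ?case by (cases n) auto
  qed
  show "ms = ns" if "unary_word ms = unary_word ns"
    using that
  proof (induction ms arbitrary: ns)
    case Nil then show ?case by (cases ns) (auto simp: unary_word_def)
  next
    case (Cons m ms)
    then obtain n ns' where ns: "ns = n # ns'" by (cases ns) (auto simp: unary_word_def)
    have "replicate m Stroke @ Separator # unary_word ms =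
        replicate n Stroke @ Separator # unary_word ns'"
      using Cons.prems ns by (simp add: unary_word_def)
    from rep[OF this] have "m = n" "unary_word ms = unary_word ns'" by simp_all
    then show ?case using Cons.IH[of ns'] ns by simp
  qed
qed simp

lemma observation_eq_iff:
  assumes "pair_graph G" "port_numbering G \<delta>" "v \<in> pverts G"
    and "pair_graph H" "port_numbering H \<epsilon>" "w \<in> pverts H"
  shows "observation G \<delta> v p = observation H \<epsilon> w q \<longleftrightarrow> p = q \<and> binoculars_iso G \<delta> v H \<epsilon> w"
proof -
  have "map Some xs = map Some ys \<longleftrightarrow> xs = ys" for xs ys :: "obs_symbol list"
    by (rule inj_map_eq_map) simp
  moreover have "(case p of None \<Rightarrow> 0 | Some x \<Rightarrow> Suc x) = (case q of None \<Rightarrow> 0 | Some x \<Rightarrow> Suc x)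
      \<longleftrightarrow> p = q"
    by (cases p; cases q) simp_all
  ultimately show ?thesis
    by (simp add: observation_def unary_word_inject binoculars_eq_iff[OF assms])
qed

text \<open>A state of the execution consists of the list \<open>ws\<close> of vertices visited so far, the current
  vertex being the last one, and the configuration of the machine. Steps are edge traversals, so
  \<open>length ws - 1\<close> of them have been executed. An agent that chooses a port number not
  present at its vertex is stuck, i.e. it does not halt.\<close>

inductive exec_step ::
  "('q, 's) agent \<Rightarrow> 'a pair_pre_digraph \<Rightarrow> ('a \<Rightarrow> 'a \<Rightarrow> nat) \<Rightarrow>
   'a list \<times> ('q, 's) conf \<Rightarrow> 'a list \<times> ('q, 's) conf \<Rightarrow> bool"
  for A G \<delta> where
  compute: "exec_step A G \<delta> (ws, Compute q, W, I) (ws, tm_step A q W I)"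
| move: "u \<in> nbrs G v \<Longrightarrow> \<delta> v u = chosen_port A W \<Longrightarrow>
    exec_step A G \<delta> (ws @ [v], Move q, W, I)
      (ws @ [v, u], Compute q, W, observation G \<delta> u (Some (\<delta> u v)))"

definition initial ::
  "('q, 's) agent \<Rightarrow> 'a pair_pre_digraph \<Rightarrow> ('a \<Rightarrow> 'a \<Rightarrow> nat) \<Rightarrow> 'a \<Rightarrow> 'a list \<times> ('q, 's) conf" where
  "initial A G \<delta> s = ([s], Compute (start A), ([], []), observation G \<delta> s None)"

definition halting_run ::
  "('q, 's) agent \<Rightarrow> 'a pair_pre_digraph \<Rightarrow> ('a \<Rightarrow> 'a \<Rightarrow> nat) \<Rightarrow> 'a \<Rightarrow> 'a list \<Rightarrow> bool" where
  "halting_run A G \<delta> s ws \<longleftrightarrow>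
     (\<exists>W I. (exec_step A G \<delta>)\<^sup>*\<^sup>* (initial A G \<delta> s) (ws, Halt, W, I))"

lemma exec_step_det:
  assumes "pair_graph G" "port_numbering G \<delta>" "exec_step A G \<delta> x y" "exec_step A G \<delta> x z"
  shows "y = z"
  using assms(3)
proof cases
  case (compute ws q W I)
  show ?thesis using assms(4) by cases (use compute in auto)
next
  case (move u v W ws q I)
  have "v \<in> pverts G"
    using move(3) assms(1) unfolding nbrs_def pair_graph_def pair_digraph_def pair_fin_digraph_def
    by (blast dest: pair_wf_digraph.in_arcsD1)
  then have inj: "inj_on (\<delta> v) (nbrs G v)" using assms(2) unfolding port_numbering_def by blast
  show ?thesis using assms(4)
  proof cases
    case (compute ws' q' W' I')
    then show ?thesis using move(1) by simp
  next
    case m: (move u' v' W' ws' q' I')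
    from m(1) move(1) have eqs: "v' = v" "W' = W" "ws' = ws" "q' = q" by simp_all
    then have "u' = u" using m(3,4) move(3,4) inj by (metis inj_onD)
    then show ?thesis using m(2) move(2) eqs by simp
  qed
qed

lemma halting_run_unique:
  assumes "pair_graph G" "port_numbering G \<delta>" "halting_run A G \<delta> s ws" "halting_run A G \<delta> s ws'"
  shows "ws = ws'"
proof -
  obtain W I W' I' where
    r: "(exec_step A G \<delta>)\<^sup>*\<^sup>* (initial A G \<delta> s) (ws, Halt, W, I)" and
    r': "(exec_step A G \<delta>)\<^sup>*\<^sup>* (initial A G \<delta> s) (ws', Halt, W', I')"
    using assms(3,4) unfolding halting_run_def by blast
  have stop: "\<not> exec_step A G \<delta> (vs, Halt, V, J) y" for vs V J y
    by (auto elim: exec_step.cases)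
  have "y = (ws', Halt, W', I')"
    if "(exec_step A G \<delta>)\<^sup>*\<^sup>* x y" "(exec_step A G \<delta>)\<^sup>*\<^sup>* x (ws', Halt, W', I')"
      "\<And>z. \<not> exec_step A G \<delta> y z" for x y
    using that
  proof (induction rule: converse_rtranclp_induct)
    case base
    from base(1) show ?case by (rule converse_rtranclpE) (use base(2) in blast)+
  next
    case (step x x')
    note IH = step.IH
    from step.prems(1) show ?case
    proof (cases rule: converse_rtranclpE)
      case base
      then show ?thesis using step.hyps(1) stop by blast
    next
      case (step x'')
      then have "x'' = x'" using exec_step_det[OF assms(1,2)] \<open>exec_step A G \<delta> x x'\<close> by blast
      then show ?thesis using step(2) \<open>\<And>z. \<not> exec_step A G \<delta> y z\<close> IH by blast
    qed
  qed
  from this[OF r r' stop] show ?thesis by simp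
qed

definition visits_all_and_halts ::
  "('q, 's) agent \<Rightarrow> 'a pair_pre_digraph \<Rightarrow> ('a \<Rightarrow> 'a \<Rightarrow> nat) \<Rightarrow> 'a \<Rightarrow> bool" where
  "visits_all_and_halts A G \<delta> s \<longleftrightarrow> (\<exists>ws. halting_run A G \<delta> s ws \<and> pverts G \<subseteq> set ws)"

definition never_halts ::
  "('q, 's) agent \<Rightarrow> 'a pair_pre_digraph \<Rightarrow> ('a \<Rightarrow> 'a \<Rightarrow> nat) \<Rightarrow> 'a \<Rightarrow> bool" where
  "never_halts A G \<delta> s \<longleftrightarrow> \<not> (\<exists>ws. halting_run A G \<delta> s ws)"

text \<open>Every finite graph is isomorphic to one with vertices in \<^typ>\<open>nat\<close>.\<close>

definition exploration_algorithm :: "('q, 's) agent \<Rightarrow> bool" where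
  "exploration_algorithm A \<longleftrightarrow>
     (\<forall>(G :: nat pair_pre_digraph) \<delta> s.
        finite_graph G \<and> port_numbering G \<delta> \<and> s \<in> pverts G \<longrightarrow>
        visits_all_and_halts A G \<delta> s \<or> never_halts A G \<delta> s)"

section \<open>Simple connectivity of complexes\<close>

definition clique_complex :: "'a pair_pre_digraph \<Rightarrow> 'a set set" where
  "clique_complex G =
     {S. S \<noteq> {} \<and> finite S \<and> S \<subseteq> pverts G \<and> (\<forall>x\<in>S. \<forall>y\<in>S. x \<noteq> y \<longrightarrow> (x, y) \<in> parcs G)}"

text \<open>Paths are non-empty vertex lists; a list \<open>[u]\<close> is the empty path at \<open>u\<close>.\<close>

definition complex_edge :: "'a set set \<Rightarrow> 'a \<Rightarrow> 'a \<Rightarrow> bool" where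
  "complex_edge K u v \<longleftrightarrow> u \<noteq> v \<and> {u, v} \<in> K"

definition complex_path :: "'a set set \<Rightarrow> 'a list \<Rightarrow> bool" where
  "complex_path K p \<longleftrightarrow> p \<noteq> [] \<and> {hd p} \<in> K \<and> successively (complex_edge K) p"

definition complex_cycle :: "'a set set \<Rightarrow> 'a list \<Rightarrow> bool" where
  "complex_cycle K p \<longleftrightarrow> complex_path K p \<and> hd p = last p"

definition triangle :: "'a set set \<Rightarrow> 'a list \<Rightarrow> bool" where
  "triangle K p \<longleftrightarrow> (\<exists>a b c. p = [a, b, c, a] \<and> distinct [a, b, c] \<and> {a, b, c} \<in> K)"

text \<open>In the last rule the replaced subpath is \<open>q\<close>, and \<open>rev q @ tl q'\<close> is the concatenation of
  the inverse of \<open>q\<close> with \<open>q'\<close>.\<close>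

inductive elementary_homotopy :: "'a set set \<Rightarrow> 'a list \<Rightarrow> 'a list \<Rightarrow> bool" for K where
  insert: "complex_edge K u v \<Longrightarrow> elementary_homotopy K (p @ [u] @ r) (p @ [u, v, u] @ r)"
| delete: "complex_edge K u v \<Longrightarrow> elementary_homotopy K (p @ [u, v, u] @ r) (p @ [u] @ r)"
| triangle: "q \<noteq> [] \<Longrightarrow> q' \<noteq> [] \<Longrightarrow> hd q = hd q' \<Longrightarrow> last q = last q' \<Longrightarrow>
    triangle K (rev q @ tl q') \<Longrightarrow> elementary_homotopy K (p @ q @ r) (p @ q' @ r)"

definition simply_connected_complex :: "'a set set \<Rightarrow> bool" where
  "simply_connected_complex K \<longleftrightarrow>
     (\<forall>p. complex_cycle K p \<longrightarrow> (\<exists>v. (elementary_homotopy K)\<^sup>*\<^sup>* p [v]))"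

definition SC :: "'a pair_pre_digraph set" where
  "SC = {G. finite_graph G \<and> simply_connected_complex (clique_complex G)}"

section \<open>Computable functions\<close>

text \<open>Programs for the partial recursive functions of Kleene.\<close>

datatype recf = Zero | Succ | Proj nat | Comp recf "recf list" | Prim_Rec recf recf | Mu recf

inductive rec_eval :: "recf \<Rightarrow> nat list \<Rightarrow> nat \<Rightarrow> bool" where
  "rec_eval Zero xs 0"
| "rec_eval Succ [x] (Suc x)"
| "i < length xs \<Longrightarrow> rec_eval (Proj i) xs (xs ! i)"
| "list_all2 (\<lambda>g y. rec_eval g xs y) gs ys \<Longrightarrow> rec_eval h ys z \<Longrightarrow> rec_eval (Comp h gs) xs z"
| "rec_eval g xs y \<Longrightarrow> rec_eval (Prim_Rec g h) (0 # xs) y"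
| "rec_eval (Prim_Rec g h) (n # xs) y \<Longrightarrow> rec_eval h (n # y # xs) z \<Longrightarrow>
     rec_eval (Prim_Rec g h) (Suc n # xs) z"
| "rec_eval g (n # xs) 0 \<Longrightarrow> \<forall>m<n. \<exists>y. rec_eval g (m # xs) (Suc y) \<Longrightarrow> rec_eval (Mu g) xs n"

definition computable :: "(nat \<Rightarrow> nat) \<Rightarrow> bool" where
  "computable f \<longleftrightarrow> (\<exists>r. \<forall>n y. rec_eval r [n] y \<longleftrightarrow> y = f n)"

end

theory Submission
  imports Defs "HOL-Library.Countable_Set" "HOL-Computational_Algebra.Primes"
begin

text \<open>
  An agent that halts on a graph \<open>G\<close> after \<open>k\<close> steps also halts after \<open>k\<close> steps on every graph that looks
  like \<open>G\<close> around the vertices that it meets. So it suffices to find, for a given \<open>f\<close>, a graph \<open>G\<close> with a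
  simply connected clique complex and an infinite graph with a map to \<open>G\<close> that is a local isomorphism within
  distance \<open>f |V(G)|\<close> of some vertex: on a large finite piece of the latter a fast agent would halt too early.

  Here \<open>G\<close> triangulates the presentation complex of a trivial group, and the infinite graph is given by
  permutations of an infinite set that satisfy the relators except at defects, which are far from the base
  point. A counter machine computing a function that dominates \<open>f\<close> is turned into rules
  \<open>(q, m k + a) \<rightarrow> (q', c k + d)\<close>, where the counters are exponents of primes. The group has generators
  \<open>x\<close>, \<open>t\<^sub>q\<close>, \<open>\<kappa>\<close> and one generator \<open>r\<close> for each rule. With \<open>T q n = x\<^sup>-\<^sup>n t\<^sub>q x\<^sup>n\<close>, the relators say that \<open>r\<close>
  conjugates \<open>x\<^sup>m\<close> to \<open>x\<^sup>c\<close> and \<open>T q a\<close> to \<open>T q' d\<close>, so that it conjugates \<open>T\<close> of a configuration to \<open>T\<close> of the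
  next one, and that \<open>\<kappa>\<close> commutes with all \<open>r\<close> and with \<open>T\<close> of the final configuration. As the machine halts,
  \<open>\<kappa>\<close> commutes with \<open>T q\<^sub>0 n\<^sub>0\<close>; further relators make the group trivial once this commutator is. In the
  permutation representation, \<open>\<kappa>\<close> acts nontrivially exactly at the configurations that do not reach the final
  one without passing the configuration where the computation is at its peak. Therefore only the relators
  \<open>[\<kappa>, r]\<close> fail, and only at the peak. Every generator changes the size of a configuration by a bounded factor,
  hence the defect is as far away as the peak is high.
\<close>

section \<open>Graphs and their finite pieces\<close>

text \<open>A simply connected clique complex admits no proper connected covering that lifts
  triangles, so the large graph cannot be a covering of \<open>G\<close>: it has to go wrong
  somewhere, and the construction only decides how far away. Algebraically, the group is trivial, so
  an action obeying every relator everywhere would be trivial; infinite orbits need a relator that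
  fails at some points. Distance to these points is measured by a height, essentially
  \<open>M\<close> minus a logarithm to base \<open>C\<close> of the integer at the configuration.
  An edge of the graph can cost up to \<open>U\<close> in height, where \<open>U\<close> bounds the
  length of a relator walk, so \<open>f V\<close> moves are harmless only if the peak is well above
  \<open>C ^ (f V * U)\<close>. The difficulty is circular: \<open>V\<close>, \<open>U\<close> and
  \<open>C\<close> depend on the program that produces the peak. It is resolved by an input
  \<open>j\<close> that is chosen after the program. The input enters a single relator, through the
  power of \<open>x\<close> with exponent \<open>2 ^ j\<close>, so for large \<open>j\<close> the
  graph has at most \<open>4 ^ j\<close> vertices whatever the program is, and the program, knowing
  \<open>j\<close>, computes a value that dominates \<open>f\<close> at all sizes up to
  \<open>4 ^ j\<close>.\<close>

lemma pair_graphI: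
  assumes "finite (pverts G)" "parcs G \<subseteq> pverts G \<times> pverts G" "sym (parcs G)" "irrefl (parcs G)"
  shows "pair_graph G"
proof -
  have "finite (parcs G)" using assms(1,2) finite_subset by blast
  then show ?thesis
    using assms by unfold_locales (auto simp: symmetric_def irrefl_def)
qed

lemma pair_graph_finite: "pair_graph G \<Longrightarrow> finite (pverts G)"
  by (simp add: pair_graph_def pair_digraph_def pair_fin_digraph.pair_finite_verts)

lemma pair_graph_arcs: "pair_graph G \<Longrightarrow> (x, y) \<in> parcs G \<Longrightarrow> x \<in> pverts G \<and> y \<in> pverts G"
  by (auto simp: pair_graph_def pair_digraph_def pair_fin_digraph_def
      dest: pair_wf_digraph.in_arcsD1 pair_wf_digraph.in_arcsD2)

lemma finite_graphI:
  assumes G: "pair_graph G" and s: "s \<in> pverts G"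
    and reach: "\<And>v. v \<in> pverts G \<Longrightarrow> (s, v) \<in> (parcs G)\<^sup>*"
  shows "finite_graph G"
proof -
  have sym: "sym (parcs G)" using pair_graph_sym[OF G] by (auto intro: symI)
  have on: "(u, v) \<in> rtrancl_on (pverts G) ((parcs G)\<^sup>s)"
    if "(u, v) \<in> (parcs G)\<^sup>*" "u \<in> pverts G" for u v
    using that
  proof (induction rule: rtrancl_induct)
    case base then show ?case by (simp add: rtrancl_on_refl)
  next
    case (step y z)
    then show ?case
      using pair_graph_arcs[OF G step(2)]
      by (intro rtrancl_on_into_rtrancl_on[of u y _ _ z]) (auto simp: symcl_def)
  qed
  have "(u, v) \<in> (parcs G)\<^sup>*" if "u \<in> pverts G" "v \<in> pverts G" for u v
    using reach[OF that(1)] reach[OF that(2)] sym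
    by (meson rtrancl_trans sym_rtrancl symD)
  then have "Digraph_Component.connected (with_proj G)"
    unfolding connected_conv using on s by auto
  then show ?thesis using G by (simp add: finite_graph_def)
qed

section \<open>Transfer of runs along local isomorphisms\<close>

text \<open>This is \<open>binoculars_iso\<close> with the isomorphism prescribed as the restriction
  of one global map, so that the local identifications met along a run fit together.\<close>

definition local_iso ::
  "'b pair_pre_digraph \<Rightarrow> ('b \<Rightarrow> 'b \<Rightarrow> nat) \<Rightarrow> 'a pair_pre_digraph \<Rightarrow> ('a \<Rightarrow> 'a \<Rightarrow> nat) \<Rightarrow> ('b \<Rightarrow> 'a) \<Rightarrow> 'b \<Rightarrow> bool"
where
  "local_iso H \<epsilon> G \<delta> \<pi> x \<longleftrightarrow>
     bij_betw \<pi> (closed_nbhd H x) (closed_nbhd G (\<pi> x)) \<and>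
     (\<forall>y\<in>closed_nbhd H x. \<forall>z\<in>closed_nbhd H x.
        ((y, z) \<in> parcs H \<longleftrightarrow> (\<pi> y, \<pi> z) \<in> parcs G) \<and>
        ((y, z) \<in> parcs H \<longrightarrow> \<epsilon> y z = \<delta> (\<pi> y) (\<pi> z)))"

lemma local_iso_observation:
  assumes "pair_graph G" "port_numbering G \<delta>" "pair_graph H" "port_numbering H \<epsilon>"
    and "x \<in> pverts H" "\<pi> x \<in> pverts G" "local_iso H \<epsilon> G \<delta> \<pi> x"
  shows "observation H \<epsilon> x p = observation G \<delta> (\<pi> x) p"
proof -
  have "binoculars_iso H \<epsilon> x G \<delta> (\<pi> x)"
    using assms(7) unfolding local_iso_def binoculars_iso_def by blast
  then show ?thesis using observation_eq_iff[of H \<epsilon> x G \<delta> "\<pi> x"] assms by blast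
qed

text \<open>Equal observations make the machine behave equally, so the run lifts edge by edge with
  the same configuration. \<open>B i\<close> contains everything within \<open>i\<close> moves of
  \<open>s\<close>; as \<open>length ws \<le> Suc k\<close> means at most \<open>k\<close> moves,
  the local isomorphism is needed up to \<open>B k\<close>.\<close>

lemma halting_run_lift:
  assumes G: "pair_graph G" "port_numbering G \<delta>" and H: "pair_graph H" "port_numbering H \<epsilon>"
    and \<pi>: "\<And>x. x \<in> pverts H \<Longrightarrow> \<pi> x \<in> pverts G"
    and s: "s \<in> pverts H" "s \<in> B 0"
    and B: "\<And>i x y. x \<in> B i \<Longrightarrow> (x, y) \<in> parcs H \<Longrightarrow> y \<in> B (Suc i)"
    and iso: "\<And>i x. i \<le> k \<Longrightarrow> x \<in> pverts H \<Longrightarrow> x \<in> B i \<Longrightarrow> local_iso H \<epsilon> G \<delta> \<pi> x"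
    and run: "halting_run A G \<delta> (\<pi> s) ws" "length ws \<le> Suc k"
  shows "\<exists>vs. halting_run A H \<epsilon> s vs \<and> length vs = length ws"
proof -
  obtain W I where *: "(exec_step A G \<delta>)\<^sup>*\<^sup>* (initial A G \<delta> (\<pi> s)) (ws, Halt, W, I)"
    using run(1) unfolding halting_run_def by blast
  have obs: "observation H \<epsilon> x p = observation G \<delta> (\<pi> x) p"
    if "i \<le> k" "x \<in> pverts H" "x \<in> B i" for x i p
    using local_iso_observation[OF G H that(2) \<pi>[OF that(2)] iso[OF that]] .
  have "(\<exists>vs v. (exec_step A H \<epsilon>)\<^sup>*\<^sup>* (initial A H \<epsilon> s) (vs @ [v], snd c) \<and>
          length (vs @ [v]) = length (fst c) \<and> \<pi> v = last (fst c) \<and> v \<in> pverts H \<and> v \<in> B (length vs))"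
    if "(exec_step A G \<delta>)\<^sup>*\<^sup>* (initial A G \<delta> (\<pi> s)) c" "length (fst c) \<le> Suc k" for c
    using that
  proof (induction rule: rtranclp_induct)
    case base
    show ?case
      by (rule exI[of _ "[]"], rule exI[of _ s]) (use s in \<open>simp add: initial_def obs[of 0]\<close>)
  next
    case (step c c')
    from step(2) show ?case
    proof cases
      case (compute us q W I)
      with step obtain vs v where v: "(exec_step A H \<epsilon>)\<^sup>*\<^sup>* (initial A H \<epsilon> s) (vs @ [v], Compute q, W, I)"
        "length (vs @ [v]) = length us" "\<pi> v = last us" "v \<in> pverts H" "v \<in> B (length vs)"
        by fastforce
      have "(exec_step A H \<epsilon>)\<^sup>*\<^sup>* (initial A H \<epsilon> s) (vs @ [v], tm_step A q W I)"
        using v(1) exec_step.compute[of A H \<epsilon> "vs @ [v]" q W I] by (rule rtranclp.rtrancl_into_rtrancl)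
      then show ?thesis using v(2-) compute(2) by (metis fst_conv snd_conv)
    next
      case (move u w W us q I)
      from step.prems move have len: "length us < k" by simp
      with step.IH move obtain vs v where
        v: "(exec_step A H \<epsilon>)\<^sup>*\<^sup>* (initial A H \<epsilon> s) (vs @ [v], Move q, W, I)"
        "length vs = length us" "\<pi> v = w" "v \<in> pverts H" "v \<in> B (length vs)"
        by fastforce
      have li: "local_iso H \<epsilon> G \<delta> \<pi> v" using iso[of "length vs" v] v len by simp
      have "u \<in> closed_nbhd G (\<pi> v)" using move v by (simp add: closed_nbhd_def)
      then obtain x where x: "x \<in> closed_nbhd H v" "\<pi> x = u"
        using li unfolding local_iso_def bij_betw_def by (metis imageE)
      have vv: "v \<in> closed_nbhd H v" by (simp add: closed_nbhd_def)
      have "(\<pi> v, \<pi> x) \<in> parcs G" using move(3) v x by (simp add: nbrs_def)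
      then have vx: "(v, x) \<in> parcs H" "\<epsilon> v x = \<delta> w u"
        using li x v vv unfolding local_iso_def by blast+
      have "(x, v) \<in> parcs H" using vx(1) pair_graph_sym[OF H(1)] by blast
      then have xv: "\<epsilon> x v = \<delta> u w" using li x v(3) vv unfolding local_iso_def by blast
      have xH: "x \<in> pverts H" using pair_graph_arcs[OF H(1) vx(1)] by blast
      have xB: "x \<in> B (Suc (length vs))" using B[OF v(5) vx(1)] .
      have "exec_step A H \<epsilon> (vs @ [v], Move q, W, I)
          (vs @ [v, x], Compute q, W, observation H \<epsilon> x (Some (\<epsilon> x v)))"
        using move(4) vx by (intro exec_step.move) (auto simp: nbrs_def)
      also have "observation H \<epsilon> x (Some (\<epsilon> x v)) = observation G \<delta> u (Some (\<delta> u w))"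
        using obs[OF _ xH xB] len v x xv by simp
      finally have "(exec_step A H \<epsilon>)\<^sup>*\<^sup>* (initial A H \<epsilon> s)
          ((vs @ [v]) @ [x], Compute q, W, observation G \<delta> u (Some (\<delta> u w)))"
        using v(1) by simp
      then show ?thesis
        using move(2) v x xH xB by (intro exI[of _ "vs @ [v]"] exI[of _ x]) simp
    qed
  qed
  from this[OF *] run(2) obtain vs v where
    "(exec_step A H \<epsilon>)\<^sup>*\<^sup>* (initial A H \<epsilon> s) (vs @ [v], Halt, W, I)" "length (vs @ [v]) = length ws"
    by auto
  then show ?thesis unfolding halting_run_def by blast
qed

section \<open>Transport of graphs and runs along injections of the vertices\<close>

definition relabel :: "('a \<Rightarrow> 'b) \<Rightarrow> 'a pair_pre_digraph \<Rightarrow> 'b pair_pre_digraph" where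
  "relabel \<iota> G = \<lparr>pverts = \<iota> ` pverts G, parcs = map_prod \<iota> \<iota> ` parcs G\<rparr>"

lemma relabel_arc [simp]: "inj \<iota> \<Longrightarrow> (\<iota> x, \<iota> y) \<in> parcs (relabel \<iota> G) \<longleftrightarrow> (x, y) \<in> parcs G"
  by (auto simp: relabel_def inj_eq)

lemma relabel_nbrs: "inj \<iota> \<Longrightarrow> nbrs (relabel \<iota> G) (\<iota> x) = \<iota> ` nbrs G x"
  by (force simp: nbrs_def relabel_def dest: injD)

lemma relabel_closed_nbhd: "inj \<iota> \<Longrightarrow> closed_nbhd (relabel \<iota> G) (\<iota> x) = \<iota> ` closed_nbhd G x"
  by (simp add: closed_nbhd_def relabel_nbrs)

lemma relabel_pair_graph:
  assumes "inj \<iota>" "pair_graph G" shows "pair_graph (relabel \<iota> G)"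
proof (rule pair_graphI)
  show "finite (pverts (relabel \<iota> G))" using pair_graph_finite[OF assms(2)] by (simp add: relabel_def)
  show "parcs (relabel \<iota> G) \<subseteq> pverts (relabel \<iota> G) \<times> pverts (relabel \<iota> G)"
    using pair_graph_arcs[OF assms(2)] by (auto simp: relabel_def)
  show "sym (parcs (relabel \<iota> G))" 
    using pair_graph_sym[OF assms(2)] by (force simp: relabel_def sym_def)
  show "irrefl (parcs (relabel \<iota> G))"
    using pair_graph_irrefl[OF assms(2)] assms(1) by (auto simp: relabel_def irrefl_def dest: injD)
qed

lemma relabel_rtrancl: "(x, y) \<in> (parcs G)\<^sup>* \<Longrightarrow> (\<iota> x, \<iota> y) \<in> (parcs (relabel \<iota> G))\<^sup>*"
  by (induction rule: rtrancl_induct)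
    (force simp: relabel_def intro: rtrancl_into_rtrancl)+

lemma relabel_finite_graph:
  assumes "inj \<iota>" "finite_graph G" shows "finite_graph (relabel \<iota> G)"
proof -
  have G: "pair_graph G" "Digraph_Component.connected (with_proj G)"
    using assms(2) by (simp_all add: finite_graph_def)
  have "(parcs G)\<^sup>s = parcs G" using pair_graph_sym[OF G(1)] by (auto simp: symcl_def)
  then have reach: "(u, v) \<in> (parcs G)\<^sup>*" if "u \<in> pverts G" "v \<in> pverts G" for u v
    using G(2) that unfolding connected_conv by (auto intro: rtrancl_on_rtranclI)
  obtain s where s: "s \<in> pverts G" using G(2) unfolding connected_conv by auto
  show ?thesis
  proof (rule finite_graphI[OF relabel_pair_graph[OF assms(1) G(1)], of "\<iota> s"])
    show "\<iota> s \<in> pverts (relabel \<iota> G)" using s by (simp add: relabel_def)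
    show "(\<iota> s, v) \<in> (parcs (relabel \<iota> G))\<^sup>*" if "v \<in> pverts (relabel \<iota> G)" for v
    proof -
      obtain x where "x \<in> pverts G" "v = \<iota> x" using \<open>v \<in> _\<close> by (auto simp: relabel_def)
      then show ?thesis using relabel_rtrancl[OF reach[OF s]] by blast
    qed
  qed
qed

lemma relabel_port_numbering:
  assumes "inj \<iota>" "port_numbering G \<delta>"
  shows "port_numbering (relabel \<iota> G) (\<lambda>x y. \<delta> (inv \<iota> x) (inv \<iota> y))"
  using assms unfolding port_numbering_def
  by (auto simp: relabel_def[of \<iota> G] relabel_nbrs[unfolded relabel_def] inj_on_def) metis

text \<open>A relabelling is a local isomorphism at every vertex, so no radius is involved and
  \<open>B\<close> may be constantly \<open>UNIV\<close>.\<close>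

lemma halting_run_relabelD:
  fixes \<iota> :: "'a \<Rightarrow> 'b"
  assumes \<iota>: "inj \<iota>" and G: "pair_graph G" "port_numbering G \<delta>" and s: "s \<in> pverts G"
    and run: "halting_run A (relabel \<iota> G) (\<lambda>x y. \<delta> (inv \<iota> x) (inv \<iota> y)) (\<iota> s) ws"
  shows "\<exists>vs. halting_run A G \<delta> s vs \<and> length vs = length ws"
proof (rule halting_run_lift[where \<pi> = \<iota> and B = "\<lambda>_. UNIV" and k = "length ws", OF _ _ G _ s])
  show "local_iso G \<delta> (relabel \<iota> G) (\<lambda>x y. \<delta> (inv \<iota> x) (inv \<iota> y)) \<iota> x" for x
    using \<iota> by (auto simp: local_iso_def relabel_closed_nbhd bij_betw_def inj_on_def)
qed (use \<iota> G run in \<open>auto simp: relabel_pair_graph relabel_port_numbering, simp add: relabel_def\<close>)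

lemma halting_run_relabelI:
  fixes \<iota> :: "'a \<Rightarrow> 'b"
  assumes \<iota>: "inj \<iota>" and G: "pair_graph G" "port_numbering G \<delta>" and s: "s \<in> pverts G"
    and run: "halting_run A G \<delta> s ws"
  shows "\<exists>vs. halting_run A (relabel \<iota> G) (\<lambda>x y. \<delta> (inv \<iota> x) (inv \<iota> y)) (\<iota> s) vs \<and> length vs = length ws"
proof (rule halting_run_lift[where \<pi> = "inv \<iota>" and B = "\<lambda>_. UNIV" and k = "length ws", OF G])
  show "local_iso (relabel \<iota> G) (\<lambda>x y. \<delta> (inv \<iota> x) (inv \<iota> y)) G \<delta> (inv \<iota>) x" 
    if "x \<in> pverts (relabel \<iota> G)" for x
  proof -
    obtain y where "x = \<iota> y" using \<open>x \<in> _\<close> by (auto simp: relabel_def)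
    with \<iota> show ?thesis
      by (auto simp: local_iso_def relabel_closed_nbhd bij_betw_def inj_on_def image_image)
  qed
qed (use \<iota> G run s in \<open>auto simp: relabel_pair_graph relabel_port_numbering, auto simp add: relabel_def\<close>)

section \<open>Graphs derived from voltages\<close>

text \<open>The derived graph of a voltage graph, with the voltages acting on the fibre
  \<open>'o\<close> as maps instead of being group elements, and cut down to a set \<open>B\<close>
  to make it finite.\<close>

definition derived_graph ::
  "'v pair_pre_digraph \<Rightarrow> ('v \<Rightarrow> 'v \<Rightarrow> 'o \<Rightarrow> 'o) \<Rightarrow> ('v \<times> 'o) set \<Rightarrow> ('v \<times> 'o) pair_pre_digraph"
where
  "derived_graph G g B = \<lparr>pverts = B,
     parcs = {((u, a), (v, g u v a)) | u v a. (u, v) \<in> parcs G \<and> (u, a) \<in> B \<and> (v, g u v a) \<in> B}\<rparr>"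

fun derived_ball ::
  "'v pair_pre_digraph \<Rightarrow> ('v \<Rightarrow> 'v \<Rightarrow> 'o \<Rightarrow> 'o) \<Rightarrow> 'v \<times> 'o \<Rightarrow> nat \<Rightarrow> ('v \<times> 'o) set" where
  "derived_ball G g x 0 = {x}"
| "derived_ball G g x (Suc i) = derived_ball G g x i \<union>
     {(v, g u v a) | u v a. (u, a) \<in> derived_ball G g x i \<and> (u, v) \<in> parcs G}"

lemma derived_ball_mono: "i \<le> j \<Longrightarrow> derived_ball G g x i \<subseteq> derived_ball G g x j"
  by (induction j) (auto simp: le_Suc_eq)

text \<open>The height \<open>h\<close> bounds the distance from defects: an arc costs at most
  \<open>L\<close>, and above height \<open>L\<close> every triangle of \<open>G\<close> lifts to a
  triangle. Triangles are what binoculars add to the view of a vertex, so \<open>flat\<close> is the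
  condition beyond a plain covering.\<close>

locale voltage =
  fixes G :: "'v pair_pre_digraph" and \<delta> :: "'v \<Rightarrow> 'v \<Rightarrow> nat" and g :: "'v \<Rightarrow> 'v \<Rightarrow> 'o \<Rightarrow> 'o"
    and h :: "'o \<Rightarrow> nat" and L :: nat and s :: 'v and \<omega> :: 'o
  assumes G: "pair_graph G" and \<delta>: "port_numbering G \<delta>" and s: "s \<in> pverts G"
    and back_arc: "\<And>u v a. (u, v) \<in> parcs G \<Longrightarrow> g v u (g u v a) = a"
    and lip: "\<And>u v a. (u, v) \<in> parcs G \<Longrightarrow> h a \<le> h (g u v a) + L"
    and flat: "\<And>u v w a. (u, v) \<in> parcs G \<Longrightarrow> (v, w) \<in> parcs G \<Longrightarrow> (u, w) \<in> parcs G \<Longrightarrow> L < h a \<Longrightarrow>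
      g v w (g u v a) = g u w a"
begin

abbreviation "ball \<equiv> derived_ball G g (s, \<omega>)"
abbreviation "H \<equiv> derived_graph G g"

lemma ball_fst: "x \<in> ball i \<Longrightarrow> fst x \<in> pverts G"
  by (induction i) (use s pair_graph_arcs[OF G] in auto)

lemma finite_ball: "finite (ball i)"
proof (induction i)
  case (Suc i)
  have "{(v, g u v a) | u v a. (u, a) \<in> ball i \<and> (u, v) \<in> parcs G}
      \<subseteq> (\<lambda>((u, a), v). (v, g u v a)) ` (ball i \<times> pverts G)"
    using pair_graph_arcs[OF G] by force
  moreover have "finite (ball i \<times> pverts G)" using Suc pair_graph_finite[OF G] by simp
  ultimately show ?case using Suc finite_surj by (simp, blast)
qed simp

lemma height_ball: "x \<in> ball i \<Longrightarrow> h \<omega> \<le> h (snd x) + i * L"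
proof (induction i arbitrary: x)
  case (Suc i)
  then consider "x \<in> ball i" | u v a where "x = (v, g u v a)" "(u, a) \<in> ball i" "(u, v) \<in> parcs G"
    by auto
  then show ?case
  proof cases
    case 1 then show ?thesis using Suc.IH[of x] by simp
  next
    case 2 then show ?thesis using Suc.IH[of "(u, a)"] lip[of u v a] by simp
  qed
qed simp

lemma arc_back: "(x, y) \<in> parcs (H B) \<Longrightarrow> (y, x) \<in> parcs (H B)"
  using back_arc pair_graph_sym[OF G] by (force simp: derived_graph_def)

lemma pair_graph_H: "pair_graph (H (ball R))"
proof (rule pair_graphI)
  show "finite (pverts (H (ball R)))" by (simp add: derived_graph_def finite_ball)
  show "sym (parcs (H (ball R)))" using arc_back by (auto intro: symI)
qed (use pair_graph_irrefl[OF G] in \<open>auto simp: derived_graph_def irrefl_def\<close>)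

lemma finite_graph_H: "finite_graph (H (ball R))"
proof (rule finite_graphI[OF pair_graph_H])
  show "(s, \<omega>) \<in> pverts (H (ball R))"
    using derived_ball_mono[of 0 R G g "(s, \<omega>)"] by (auto simp: derived_graph_def)
  have "((s, \<omega>), x) \<in> (parcs (H (ball R)))\<^sup>*" if "i \<le> R" "x \<in> ball i" for i x
    using that
  proof (induction i arbitrary: x)
    case (Suc i)
    then consider "x \<in> ball i" | u v a where "x = (v, g u v a)" "(u, a) \<in> ball i" "(u, v) \<in> parcs G"
      by auto
    then show ?case
    proof cases
      case 2
      have "(u, a) \<in> ball R" "x \<in> ball R"
        using derived_ball_mono[of i R G g "(s, \<omega>)"] derived_ball_mono[of "Suc i" R G g "(s, \<omega>)"]
          Suc.prems 2(2) by (auto simp del: derived_ball.simps)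
      then have "((u, a), x) \<in> parcs (H (ball R))" using 2 by (auto simp: derived_graph_def)
      then show ?thesis using Suc.IH[OF _ 2(2)] Suc.prems by (auto intro: rtrancl_into_rtrancl)
    qed (use Suc in auto)
  qed simp
  from this[of R] show "((s, \<omega>), x) \<in> (parcs (H (ball R)))\<^sup>*" if "x \<in> pverts (H (ball R))" for x
    using that by (simp add: derived_graph_def)
qed

lemma port_numbering_H: "port_numbering (H (ball R)) (\<lambda>x y. \<delta> (fst x) (fst y))"
  unfolding port_numbering_def
proof (intro ballI inj_onI)
  fix x y z assume "x \<in> pverts (H (ball R))" "y \<in> nbrs (H (ball R)) x" "z \<in> nbrs (H (ball R)) x"
    and eq: "\<delta> (fst x) (fst y) = \<delta> (fst x) (fst z)"
  then obtain u a v w where x: "x = (u, a)" "y = (v, g u v a)" "z = (w, g u w a)"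
    "(u, v) \<in> parcs G" "(u, w) \<in> parcs G"
    by (auto simp: derived_graph_def nbrs_def)
  then have "v = w" using \<delta> eq pair_graph_arcs[OF G x(4)]
    unfolding port_numbering_def by (auto simp: nbrs_def inj_on_def)
  then show "y = z" using x by simp
qed

text \<open>\<open>i < R\<close> keeps all neighbours of \<open>x\<close> inside the ball. Two
  neighbours that are adjacent in \<open>G\<close> are adjacent above exactly when their triangle
  with \<open>x\<close> closes, and the height left after \<open>i\<close> arcs is still above
  \<open>L\<close>.\<close>

lemma local_iso_H:
  assumes x: "x \<in> ball i" and i: "i < R" and big: "Suc i * L < h \<omega>"
  shows "local_iso (H (ball R)) (\<lambda>x y. \<delta> (fst x) (fst y)) G \<delta> fst x"
proof -
  obtain u a where ua: "x = (u, a)" by (cases x)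
  have ha: "L < h a" using height_ball[OF x] big ua by simp
  have xR: "(u, a) \<in> ball R" using derived_ball_mono[of i R G g "(s, \<omega>)"] x i ua by auto
  have nR: "(v, g u v a) \<in> ball R" if "(u, v) \<in> parcs G" for v
  proof -
    have "(v, g u v a) \<in> ball (Suc i)" using that x ua by auto
    then show ?thesis using derived_ball_mono[of "Suc i" R G g "(s, \<omega>)"] i by (auto simp del: derived_ball.simps)
  qed
  have nb: "nbrs (H (ball R)) x = (\<lambda>v. (v, g u v a)) ` nbrs G u"
    using ua xR nR by (auto simp: nbrs_def derived_graph_def)
  have cn: "closed_nbhd (H (ball R)) x = insert (u, a) ((\<lambda>v. (v, g u v a)) ` nbrs G u)"
    using nb ua by (simp add: closed_nbhd_def)
  have "u \<notin> nbrs G u" using pair_graph_irrefl[OF G] by (simp add: nbrs_def)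
  then have 1: "bij_betw fst (closed_nbhd (H (ball R)) x) (closed_nbhd G u)"
    unfolding cn by (auto simp: closed_nbhd_def bij_betw_def inj_on_def image_image)
  have arc: "((v, b), (w, c)) \<in> parcs (H (ball R)) \<longleftrightarrow>
      (v, w) \<in> parcs G \<and> c = g v w b \<and> (v, b) \<in> ball R \<and> (w, c) \<in> ball R" for v b w c
    by (auto simp: derived_graph_def)
  have 2: "(y, z) \<in> parcs (H (ball R)) \<longleftrightarrow> (fst y, fst z) \<in> parcs G"
    if yz: "y \<in> closed_nbhd (H (ball R)) x" "z \<in> closed_nbhd (H (ball R)) x" for y z
  proof -
    have sy: "(v, u) \<in> parcs G" if "(u, v) \<in> parcs G" for v using that pair_graph_sym[OF G] by blast
    consider "y = (u, a)" "z = (u, a)"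
      | v where "y = (u, a)" "z = (v, g u v a)" "(u, v) \<in> parcs G"
      | v where "y = (v, g u v a)" "z = (u, a)" "(u, v) \<in> parcs G"
      | v w where "y = (v, g u v a)" "z = (w, g u w a)" "(u, v) \<in> parcs G" "(u, w) \<in> parcs G"
      using yz unfolding cn by (auto simp: nbrs_def)
    then show ?thesis
    proof cases
      case 1 then show ?thesis using pair_graph_irrefl[OF G] by (simp add: arc)
    next
      case 2 then show ?thesis using xR nR by (simp add: arc)
    next
      case 3 then show ?thesis using xR nR back_arc sy by (simp add: arc)
    next
      case 4 then show ?thesis using nR flat[OF 4(3) _ 4(4) ha] by (auto simp add: arc)
    qed
  qed
  show ?thesis unfolding local_iso_def using 1 2 ua by auto
qed

lemma long_run_on_derived_graph:
  assumes big: "Suc k * L < h \<omega>" and inf: "infinite (\<Union>i. ball i)"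
    and run: "halting_run A G \<delta> s ws" "length ws \<le> Suc k"
  obtains H \<epsilon> x vs where "finite_graph (H :: ('v \<times> 'o) pair_pre_digraph)" "port_numbering H \<epsilon>"
    "x \<in> pverts H" "halting_run A H \<epsilon> x vs" "length vs < card (pverts H)"
proof -
  obtain F where F: "F \<subseteq> (\<Union>i. ball i)" "finite F" "card F = Suc (Suc k)"
    using infinite_arbitrarily_large[OF inf] by metis
  have "\<exists>R. F \<subseteq> ball R" using F(2,1)
  proof (induction F rule: finite_induct)
    case (insert x F)
    then obtain R R' where "F \<subseteq> ball R" "x \<in> ball R'" by auto
    then show ?case using derived_ball_mono[of R "max R R'" G g "(s, \<omega>)"]
        derived_ball_mono[of R' "max R R'" G g "(s, \<omega>)"]
      by (intro exI[of _ "max R R'"]) auto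
  qed simp
  then obtain R0 where "F \<subseteq> ball R0" by blast
  \<comment> \<open>\<open>F\<close> makes the ball larger than the run is long;
    \<open>Suc k\<close> keeps its boundary, where neighbours are missing, out of sight during
    \<open>k\<close> moves.\<close>
  moreover define R where "R = max R0 (Suc k)"
  ultimately have "F \<subseteq> ball R" "k < R" using derived_ball_mono[of R0 R G g "(s, \<omega>)"] by auto
  then have "Suc k < card (ball R)" using F(3) card_mono[OF finite_ball] by (metis Suc_le_lessD)
  have sR: "(s, \<omega>) \<in> ball R" using derived_ball_mono[of 0 R G g "(s, \<omega>)"] by auto
  have li: "local_iso (H (ball R)) (\<lambda>x y. \<delta> (fst x) (fst y)) G \<delta> fst x" if "i \<le> k" "x \<in> ball i" for i x
  proof (rule local_iso_H[OF that(2)])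
    have "Suc i * L \<le> Suc k * L" using that(1) by simp
    then show "Suc i * L < h \<omega>" using big by linarith
  qed (use that(1) \<open>k < R\<close> in simp)
  have "\<exists>vs. halting_run A (H (ball R)) (\<lambda>x y. \<delta> (fst x) (fst y)) (s, \<omega>) vs \<and> length vs = length ws"
  proof (rule halting_run_lift[where B = ball and \<pi> = fst and k = k, OF G \<delta> pair_graph_H port_numbering_H])
    show "y \<in> ball (Suc i)" if "x \<in> ball i" "(x, y) \<in> parcs (H (ball R))" for i x y
      using that by (auto simp: derived_graph_def)
  qed (use run li sR ball_fst in \<open>auto simp: derived_graph_def\<close>)
  then obtain vs where vs: "halting_run A (H (ball R)) (\<lambda>x y. \<delta> (fst x) (fst y)) (s, \<omega>) vs"
    "length vs = length ws" by blast
  show ?thesis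
  proof (rule that[OF finite_graph_H port_numbering_H _ vs(1)])
    show "length vs < card (pverts (H (ball R)))"
      using vs(2) run(2) \<open>Suc k < _\<close> by (simp add: derived_graph_def)
  qed (use sR in \<open>simp add: derived_graph_def\<close>)
qed

end

text \<open>A run with at most \<open>k\<close> moves would be repeated on a ball with more vertices
  than the run has entries. The agent would halt there with vertices unvisited, and by uniqueness of
  the halting run no other run can visit them.\<close>

lemma exploration_algorithm_long_run:
  fixes G :: "'v::countable pair_pre_digraph" and g :: "'v \<Rightarrow> 'v \<Rightarrow> 'o::countable \<Rightarrow> 'o"
  assumes A: "exploration_algorithm A" and "voltage G \<delta> g h L s"
    and big: "Suc k * L < h \<omega>" and inf: "infinite (\<Union>i. derived_ball G g (s, \<omega>) i)"
    and run: "halting_run A (relabel to_nat G) (\<lambda>x y. \<delta> (inv to_nat x) (inv to_nat y)) (to_nat s) ws"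
  shows "Suc k < length ws"
proof (rule ccontr)
  interpret voltage G \<delta> g h L s \<omega> by fact
  assume "\<not> Suc k < length ws"
  moreover obtain us where us: "halting_run A G \<delta> s us" "length us = length ws"
    using halting_run_relabelD[OF inj_to_nat G \<delta> s run] by blast
  ultimately have "length us \<le> Suc k" by simp
  then obtain H :: "('v \<times> 'o) pair_pre_digraph" and \<epsilon> x vs where
    H: "finite_graph H" "port_numbering H \<epsilon>" "x \<in> pverts H" "halting_run A H \<epsilon> x vs"
      "length vs < card (pverts H)"
    using long_run_on_derived_graph[OF big inf us(1)] by metis
  let ?H = "relabel to_nat H" and ?\<epsilon> = "\<lambda>x y. \<epsilon> (inv to_nat x) (inv to_nat y)"
  have pH: "pair_graph H" using H(1) by (simp add: finite_graph_def)
  obtain ts where ts: "halting_run A ?H ?\<epsilon> (to_nat x) ts" "length ts = length vs"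
    using halting_run_relabelI[OF inj_to_nat pH H(2,3,4)] by blast
  have "finite_graph ?H" using relabel_finite_graph[OF inj_to_nat H(1)] .
  moreover have "to_nat x \<in> pverts ?H" using H(3) by (simp add: relabel_def)
  ultimately have "visits_all_and_halts A ?H ?\<epsilon> (to_nat x)"
    using A ts(1) relabel_port_numbering[OF inj_to_nat H(2)]
    unfolding exploration_algorithm_def never_halts_def by blast
  then obtain ts' where "halting_run A ?H ?\<epsilon> (to_nat x) ts'" "pverts ?H \<subseteq> set ts'"
    unfolding visits_all_and_halts_def by blast
  moreover from this have "ts' = ts"
    using halting_run_unique[OF relabel_pair_graph[OF inj_to_nat pH] relabel_port_numbering[OF inj_to_nat H(2)] _ ts(1)]
    by blast
  ultimately have "card (pverts ?H) \<le> length ts" 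
    by (metis List.finite_set card_length card_mono le_trans)
  moreover have "card (pverts ?H) = card (pverts H)"
    by (simp add: relabel_def card_image inj_on_def)
  ultimately show False using H(5) ts(2) by simp
qed

section \<open>Permutation groups and words\<close>

text \<open>Bijections as a type of their own can be an instance of \<open>group_add\<close>, the
  additively written groups without commutativity; words are then evaluated by sums, both for
  homotopy classes and for the action with defects.\<close>

typedef 'a permut = "{f :: 'a \<Rightarrow> 'a. bij f}" morphisms app Permut
  by (rule exI[of _ id]) simp

lemma bij_app: "bij (app a)" using app by blast

lemma app_Permut: "(\<And>x. f' (f x) = x) \<Longrightarrow> (\<And>x. f (f' x) = x) \<Longrightarrow> app (Permut f) = f"
  by (rule Permut_inverse) (auto intro!: o_bij[of f' f] simp: fun_eq_iff)

text \<open>Sums act from left to right.\<close>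

instantiation permut :: (type) group_add
begin

definition zero_permut where "zero_permut = Permut id"
definition plus_permut where "plus_permut a b = Permut (app b \<circ> app a)"
definition uminus_permut where "uminus_permut a = Permut (inv (app a))"
definition minus_permut :: "'a permut \<Rightarrow> 'a permut \<Rightarrow> 'a permut" where "minus_permut a b = a + - b"

lemma app_zero_raw: "app 0 = id" by (simp add: zero_permut_def Permut_inverse)
lemma app_plus_raw: "app (a + b) = app b \<circ> app a"
  by (simp add: plus_permut_def Permut_inverse bij_comp bij_app)
lemma app_uminus_raw: "app (- a) = inv (app a)"
  by (simp add: uminus_permut_def Permut_inverse bij_imp_bij_inv bij_app)

instance
proof
  fix a b c :: "'a permut"
  show "a + b + c = a + (b + c)" by (simp add: app_inject[symmetric] app_plus_raw o_assoc)
  show "0 + a = a" "a + 0 = a" by (simp_all add: app_inject[symmetric] app_plus_raw app_zero_raw)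
  show "- a + a = 0"
    by (simp add: app_inject[symmetric] app_plus_raw app_zero_raw app_uminus_raw fun_eq_iff
        bij_is_surj[OF bij_app] surj_f_inv_f)
  show "a + - b = a - b" by (simp add: minus_permut_def)
qed

end

lemma app_zero [simp]: "app 0 x = x" by (simp add: app_zero_raw)
lemma app_plus [simp]: "app (a + b) x = app b (app a x)" by (simp add: app_plus_raw)
lemma app_uminus_app [simp]: "app (- a) (app a x) = x" "app a (app (- a) x) = x"
  using app_plus[of a "- a" x] app_plus[of "- a" a x] by (simp_all del: app_plus)
lemma app_minus [simp]: "app (a - b) x = app (- b) (app a x)"
  using app_plus[of a "- b" x] by (simp del: app_plus)
lemma permut_eqI: "(\<And>x. app a x = app b x) \<Longrightarrow> a = b"
  by (simp add: app_inject[symmetric] fun_eq_iff)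
lemma app_uminus_eqI: "app a y = x \<Longrightarrow> app (- a) x = y" by auto

type_synonym 'g word = "('g \<times> bool) list"

definition weval :: "('g \<Rightarrow> 'h::group_add) \<Rightarrow> 'g word \<Rightarrow> 'h" where
  "weval \<phi> w = sum_list (map (\<lambda>(g, s). if s then \<phi> g else - \<phi> g) w)"

lemma weval_simps [simp]:
  "weval \<phi> [] = 0"
  "weval \<phi> ((g, s) # w) = (if s then \<phi> g else - \<phi> g) + weval \<phi> w"
  "weval \<phi> (u @ v) = weval \<phi> u + weval \<phi> v"
  by (simp_all add: weval_def)

definition winv :: "'g word \<Rightarrow> 'g word" where
  "winv w = rev (map (\<lambda>(g, s). (g, \<not> s)) w)"

lemma weval_winv [simp]: "weval \<phi> (winv w) = - weval \<phi> w"
  by (induction w) (auto simp: winv_def minus_add)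

section \<open>Homotopies in clique complexes\<close>

abbreviation homotopic :: "'a pair_pre_digraph \<Rightarrow> 'a list \<Rightarrow> 'a list \<Rightarrow> bool" where
  "homotopic G \<equiv> (elementary_homotopy (clique_complex G))\<^sup>*\<^sup>*"

lemma elementary_homotopy_sym:
  "elementary_homotopy K p q \<Longrightarrow> elementary_homotopy K q p"
proof (induction rule: elementary_homotopy.induct)
  case (insert u v p r) then show ?case by (rule elementary_homotopy.delete)
next
  case (delete u v p r) then show ?case by (rule elementary_homotopy.insert)
next
  case (triangle q q' p r)
  obtain a b c where abc: "rev q @ tl q' = [a, b, c, a]" "distinct [a, b, c]" "{a, b, c} \<in> K"
    using triangle(5) unfolding triangle_def by blast
  have "rev (rev q @ tl q') = rev q' @ tl q"
    using triangle(1-4) by (cases q; cases q') auto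
  then have "rev q' @ tl q = [a, c, b, a]" using abc(1) by (metis rev.simps(1) rev.simps(2) append_Cons append_Nil)
  moreover have "{a, c, b} = {a, b, c}" by blast
  ultimately have "triangle K (rev q' @ tl q)" unfolding triangle_def using abc(2,3) by auto
  then show ?case using triangle(1-4) by (intro elementary_homotopy.triangle) auto
qed

lemma elementary_homotopy_context:
  "elementary_homotopy K p q \<Longrightarrow> elementary_homotopy K (x @ p @ y) (x @ q @ y)"
proof (induction rule: elementary_homotopy.induct)
  case (insert u v p r)
  then show ?case using elementary_homotopy.insert[of K u v "x @ p" "r @ y"] by simp
next
  case (delete u v p r)
  then show ?case using elementary_homotopy.delete[of K u v "x @ p" "r @ y"] by simp
next
  case (triangle q q' p r)
  then show ?case using elementary_homotopy.triangle[of q q' K "x @ p" "r @ y"] by simp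
qed

lemma homotopic_sym: "homotopic G p q \<Longrightarrow> homotopic G q p"
  by (induction rule: rtranclp_induct)
    (auto intro: converse_rtranclp_into_rtranclp elementary_homotopy_sym)

lemma homotopic_context: "homotopic G p q \<Longrightarrow> homotopic G (x @ p @ y) (x @ q @ y)"
  by (induction rule: rtranclp_induct)
    (auto intro: rtranclp.rtrancl_into_rtrancl elementary_homotopy_context)

lemma homotopic_append: "homotopic G p q \<Longrightarrow> homotopic G (p @ y) (q @ y)"
  using homotopic_context[of G p q "[]" y] by simp

lemma homotopic_prepend: "homotopic G p q \<Longrightarrow> homotopic G (x @ p) (x @ q)"
  using homotopic_context[of G p q x "[]"] by simp

lemmas homotopic_trans [trans] = rtranclp_trans[of "elementary_homotopy (clique_complex G)" for G]

lemma complex_edge_clique: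
  "pair_graph G \<Longrightarrow> complex_edge (clique_complex G) u v \<longleftrightarrow> (u, v) \<in> parcs G"
  using pair_graph_sym[of G u v] pair_graph_irrefl[of G u] pair_graph_arcs[of G u v]
  unfolding complex_edge_def clique_complex_def by auto

lemma homotopic_backtrack:
  assumes "pair_graph G" "(u, v) \<in> parcs G"
  shows "homotopic G (x @ [u, v, u] @ y) (x @ [u] @ y)"
proof -
  have "complex_edge (clique_complex G) u v" using assms by (simp add: complex_edge_clique)
  from elementary_homotopy.delete[OF this] show ?thesis by (rule r_into_rtranclp)
qed

lemma homotopic_triangle:
  assumes G: "pair_graph G" and arcs: "(u, v) \<in> parcs G" "(v, w) \<in> parcs G" "(u, w) \<in> parcs G"
  shows "homotopic G (x @ [u, v, w] @ y) (x @ [u, w] @ y)"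
proof -
  have ne: "u \<noteq> v" "v \<noteq> w" "u \<noteq> w" using arcs pair_graph_irrefl[OF G] by blast+
  have rv: "(v, u) \<in> parcs G" "(w, v) \<in> parcs G" "(w, u) \<in> parcs G"
    using arcs pair_graph_sym[OF G] by blast+
  have vs: "u \<in> pverts G" "v \<in> pverts G" "w \<in> pverts G"
    using arcs pair_graph_arcs[OF G] by blast+
  have "{w, v, u} \<in> clique_complex G"
    using arcs rv vs unfolding clique_complex_def by blast
  then have "triangle (clique_complex G) (rev [u, v, w] @ tl [u, w])"
    using ne unfolding triangle_def by auto
  then show ?thesis
    using elementary_homotopy.triangle[of "[u, v, w]" "[u, w]" "clique_complex G" x y]
    by (intro r_into_rtranclp) simp
qed

text \<open>The walk from \<open>last p\<close> back to \<open>hd p\<close> and out again collapses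
  from its turning point, one edge at a time.\<close>

lemma homotopic_rev_append:
  assumes G: "pair_graph G" and "p \<noteq> []" "successively (\<lambda>u v. (u, v) \<in> parcs G) p"
  shows "homotopic G (rev p @ tl p) [last p]"
  using assms(2,3)
proof (induction p rule: induct_list012)
  case (3 u v p)
  have "homotopic G (rev p @ [v, u, v] @ p) (rev p @ [v] @ p)"
    using 3 pair_graph_sym[OF G] by (intro homotopic_backtrack[OF G]) auto
  also have "homotopic G (rev p @ [v] @ p) [last (v # p)]" using 3 by simp
  finally show ?case by simp
qed auto

text \<open>The paths \<open>\<tau>\<close> act as a trivialisation: following a cycle at
  \<open>u\<close> after \<open>\<tau> u\<close> changes nothing up to homotopy, and going back
  along \<open>\<tau> u\<close> first leaves the cycle itself.\<close>

lemma simply_connectedI: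
  assumes G: "pair_graph G"
    and \<tau>: "\<And>v. v \<in> pverts G \<Longrightarrow> \<tau> v \<noteq> [] \<and> last (\<tau> v) = v \<and> successively (\<lambda>u v. (u, v) \<in> parcs G) (\<tau> v)"
    and arc: "\<And>u v. (u, v) \<in> parcs G \<Longrightarrow> homotopic G (\<tau> u @ [v]) (\<tau> v)"
  shows "simply_connected_complex (clique_complex G)"
  unfolding simply_connected_complex_def
proof (intro allI impI)
  fix p assume p: "complex_cycle (clique_complex G) p"
  then obtain u r where pr: "p = u # r" "last p = u" "{u} \<in> clique_complex G"
    unfolding complex_cycle_def complex_path_def by (cases p) auto
  have "complex_edge (clique_complex G) = (\<lambda>u v. (u, v) \<in> parcs G)"
    by (intro ext) (simp add: complex_edge_clique[OF G])
  then have "successively (\<lambda>u v. (u, v) \<in> parcs G) p"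
    using p by (simp add: complex_cycle_def complex_path_def)
  then have "homotopic G (\<tau> u @ r) (\<tau> (last (u # r)))"
    unfolding pr(1)
  proof (induction r arbitrary: u)
    case (Cons v r)
    have "homotopic G ((\<tau> u @ [v]) @ r) (\<tau> v @ r)" using Cons.prems by (intro homotopic_append arc) simp
    also have "homotopic G (\<tau> v @ r) (\<tau> (last (v # r)))" using Cons by simp
    finally show ?case by simp
  qed simp
  then have ur: "homotopic G (\<tau> u @ r) (\<tau> u)" using pr by simp
  have "u \<in> pverts G" using pr(3) by (simp add: clique_complex_def)
  note t = \<tau>[OF this]
  then obtain z t' where zt: "\<tau> u = z # t'" by (cases "\<tau> u") auto
  have ret: "homotopic G (rev t' @ \<tau> u) [u]"
    using homotopic_rev_append[OF G, of "\<tau> u"] t zt by simp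
  have "homotopic G p ((rev t' @ \<tau> u) @ r)"
    using homotopic_sym[OF homotopic_append[OF ret, of r]] pr by simp
  also have "homotopic G ((rev t' @ \<tau> u) @ r) (rev t' @ \<tau> u)"
    using homotopic_prepend[OF ur, of "rev t'"] by simp
  also note ret
  finally show "\<exists>v. homotopic G p [v]" ..
qed

lemma simply_connected_relabel:
  assumes \<iota>: "inj \<iota>" and G: "pair_graph G" and sc: "simply_connected_complex (clique_complex G)"
  shows "simply_connected_complex (clique_complex (relabel \<iota> G))"
proof -
  let ?K = "clique_complex G" and ?L = "clique_complex (relabel \<iota> G)"
  have K: "\<iota> ` S \<in> ?L" if "S \<in> ?K" for S
    using that relabel_arc[OF \<iota>, of _ _ G]
    by (auto simp: clique_complex_def) (auto simp: relabel_def)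
  have edge: "complex_edge ?L (\<iota> u) (\<iota> v)" if "complex_edge ?K u v" for u v
    using that K[of "{u, v}"] \<iota> by (auto simp: complex_edge_def dest: injD)
  have el: "elementary_homotopy ?L (map \<iota> p) (map \<iota> q)" if "elementary_homotopy ?K p q" for p q
    using that
  proof (induction rule: elementary_homotopy.induct)
    case (insert u v p r)
    then show ?case using elementary_homotopy.insert[OF edge, of u v "map \<iota> p" "map \<iota> r"] by simp
  next
    case (delete u v p r)
    then show ?case using elementary_homotopy.delete[OF edge, of u v "map \<iota> p" "map \<iota> r"] by simp
  next
    case (triangle q q' p r)
    obtain a b c where abc: "rev q @ tl q' = [a, b, c, a]" "distinct [a, b, c]" "{a, b, c} \<in> ?K"
      using triangle(5) unfolding triangle_def by blast
    have "rev (map \<iota> q) @ tl (map \<iota> q') = map \<iota> (rev q @ tl q')" by (simp add: rev_map map_tl)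
    then have "rev (map \<iota> q) @ tl (map \<iota> q') = [\<iota> a, \<iota> b, \<iota> c, \<iota> a]" using abc(1) by simp
    moreover have "{\<iota> a, \<iota> b, \<iota> c} \<in> ?L" using K[OF abc(3)] by simp
    ultimately have "triangle ?L (rev (map \<iota> q) @ tl (map \<iota> q'))"
      using abc(2) \<iota> unfolding triangle_def by (auto dest: injD)
    then show ?case using elementary_homotopy.triangle[of "map \<iota> q" "map \<iota> q'" ?L "map \<iota> p" "map \<iota> r"] triangle(1-4)
      by (simp add: hd_map last_map)
  qed
  have hom: "homotopic (relabel \<iota> G) (map \<iota> p) (map \<iota> q)" if "homotopic G p q" for p q
    using that by (induction rule: rtranclp_induct) (auto intro: el rtranclp.rtrancl_into_rtrancl)
  show ?thesis unfolding simply_connected_complex_def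
  proof (intro allI impI)
    fix p assume "complex_cycle ?L p"
    then have p: "p \<noteq> []" "{hd p} \<in> ?L" "successively (complex_edge ?L) p" "hd p = last p"
      by (auto simp: complex_cycle_def complex_path_def)
    have "set p \<subseteq> range \<iota>" using p(1-3)
    proof (induction p rule: induct_list012)
      case (3 x y p)
      then show ?case by (auto simp: complex_edge_def clique_complex_def relabel_def)
    qed (auto simp: clique_complex_def relabel_def)
    then obtain q where q: "p = map \<iota> q" by (metis ex_map_conv subset_iff rangeE)
    have edge': "complex_edge ?K u v" if "complex_edge ?L (\<iota> u) (\<iota> v)" for u v
      using that \<iota> G by (simp add: complex_edge_clique relabel_pair_graph)
    have "complex_path ?K q" 
      using p q edge' \<iota> unfolding complex_path_def
      by (auto simp: hd_map clique_complex_def relabel_def successively_map inj_image_mem_iff dest: injD elim: successively_mono)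
    then have "complex_cycle ?K q" using p q \<iota> unfolding complex_cycle_def
      by (simp add: hd_map last_map inj_eq)
    then obtain v where "homotopic G q [v]" using sc unfolding simply_connected_complex_def by blast
    from hom[OF this] show "\<exists>v. homotopic (relabel \<iota> G) p [v]" using q by auto
  qed
qed

section \<open>The graph of a presentation\<close>

text \<open>A generator \<open>g\<close> is represented by the loop \<open>VP, VG g, VQ, VE\<close>, and every relator by a disc that is
  glued along its boundary walk: the ring \<open>VR i 0, VR i 1, \<dots>\<close> runs parallel to the walk and is coned off
  by \<open>VC i\<close>.\<close>

datatype 'g vert = VP | VQ | VE | VG 'g | VR nat nat | VC nat

instance vert :: (countable) countable by countable_datatype

fun walk :: "'g word \<Rightarrow> 'g vert list" where
  "walk [] = [VP]"
| "walk ((g, s) # w) = VP # (if s then VG g else VE) # VQ # (if s then VE else VG g) # walk w"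

lemma length_walk [simp]: "length (walk w) = Suc (4 * length w)"
  by (induction w rule: walk.induct) auto

lemma walk_hd: "walk w = VP # tl (walk w)"
  by (cases w rule: walk.cases) auto

lemma walk_nonempty [simp]: "walk w \<noteq> []" by (cases w rule: walk.cases) auto

lemma walk_0 [simp]: "walk w ! 0 = VP" by (cases w rule: walk.cases) auto

lemma walk_last: "last (walk w) = VP"
  by (induction w rule: walk.induct) auto

lemma walk_end [simp]: "walk w ! (4 * length w) = VP"
  using walk_last[of w] by (simp add: last_conv_nth)

locale presentation =
  fixes Gs :: "'g set" and Rs :: "'g word list"
  assumes finite_Gs: "finite Gs"
    and Rs: "\<And>w. w \<in> set Rs \<Longrightarrow> w \<noteq> [] \<and> fst ` set w \<subseteq> Gs"
begin

abbreviation len :: "nat \<Rightarrow> nat" where "len i \<equiv> 4 * length (Rs ! i)"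
abbreviation b :: "nat \<Rightarrow> nat \<Rightarrow> 'g vert" where "b i j \<equiv> walk (Rs ! i) ! j"

text \<open>The core is the complete bipartite graph between \<open>VP\<close>, \<open>VQ\<close>
  and the other core vertices. It has no triangles, so relations between loops come from the discs
  alone; this is why a generator takes four edges.\<close>

inductive core_edge :: "'g vert \<Rightarrow> 'g vert \<Rightarrow> bool" where
  "core_edge VP VE"
| "core_edge VE VQ"
| "g \<in> Gs \<Longrightarrow> core_edge VP (VG g)"
| "g \<in> Gs \<Longrightarrow> core_edge (VG g) VQ"

text \<open>A cone directly over the boundary walk would contract all loops on the vertices it
  meets, because walks repeat vertices; the ring keeps the passages apart. Both
  \<open>VR i 0\<close> and \<open>VR i (len i)\<close> are neighbours of the base point, which
  creates one seam triangle \<open>VR i 0\<close>, \<open>VR i (len i)\<close>,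
  \<open>VP\<close>.\<close>

inductive disc_edge :: "'g vert \<Rightarrow> 'g vert \<Rightarrow> bool" where
  ring: "i < length Rs \<Longrightarrow> j < len i \<Longrightarrow> disc_edge (VR i j) (VR i (Suc j))"
| ring_close: "i < length Rs \<Longrightarrow> disc_edge (VR i 0) (VR i (len i))"
| spoke: "i < length Rs \<Longrightarrow> j \<le> len i \<Longrightarrow> disc_edge (VR i j) (b i j)"
| spoke_next: "i < length Rs \<Longrightarrow> j < len i \<Longrightarrow> disc_edge (VR i j) (b i (Suc j))"
| cone: "i < length Rs \<Longrightarrow> j \<le> len i \<Longrightarrow> disc_edge (VC i) (VR i j)"

definition edge :: "'g vert \<Rightarrow> 'g vert \<Rightarrow> bool" where
  "edge u v \<longleftrightarrow> core_edge u v \<or> disc_edge u v"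

definition core :: "'g vert set" where "core = {VP, VQ, VE} \<union> VG ` Gs"

definition graph :: "'g vert pair_pre_digraph" where
  "graph = \<lparr>pverts = core \<union> VC ` {..<length Rs} \<union> (\<Union>i<length Rs. VR i ` {..len i}),
     parcs = {(u, v). edge u v \<or> edge v u}\<rparr>"

lemma arc_iff: "(u, v) \<in> parcs graph \<longleftrightarrow> edge u v \<or> edge v u"
  by (simp add: graph_def)

lemma walk_core_edge:
  assumes "fst ` set w \<subseteq> Gs" "j < 4 * length w"
  shows "core_edge (walk w ! j) (walk w ! Suc j) \<or> core_edge (walk w ! Suc j) (walk w ! j)"
  using assms
proof (induction w arbitrary: j rule: walk.induct)
  case (2 g s w)
  have "j = 0 \<or> j = 1 \<or> j = 2 \<or> j = 3 \<or> (\<exists>k. j = Suc (Suc (Suc (Suc k))))" by presburger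
  then consider "j = 0" | "j = 1" | "j = 2" | "j = 3" | k where "j = Suc (Suc (Suc (Suc k)))" by blast
  then show ?case
  proof cases
    case 5
    then show ?thesis using 2 by simp
  qed (use 2 in \<open>auto simp: numeral_eq_Suc core_edge.simps\<close>)
qed simp

lemma b_edge: "i < length Rs \<Longrightarrow> j < len i \<Longrightarrow> core_edge (b i j) (b i (Suc j)) \<or> core_edge (b i (Suc j)) (b i j)"
  using walk_core_edge[of "Rs ! i" j] Rs[of "Rs ! i"] by simp

lemma core_edge_core: "core_edge u v \<Longrightarrow> u \<in> core \<and> v \<in> core \<and> u \<noteq> v"
  by (auto simp: core_edge.simps core_def)

lemma b_core: "i < length Rs \<Longrightarrow> j \<le> len i \<Longrightarrow> b i j \<in> core"
  using b_edge[of i j] core_edge_core by (cases "j = len i") (auto simp: core_def le_less)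

lemma len_pos: "i < length Rs \<Longrightarrow> 0 < len i"
  using Rs[of "Rs ! i"] by simp

lemma core_not_disc: "VR i j \<notin> core" "VC i \<notin> core" by (auto simp: core_def)

lemma graph_verts:
  "v \<in> core \<Longrightarrow> v \<in> pverts graph"
  "VR i j \<in> pverts graph \<longleftrightarrow> i < length Rs \<and> j \<le> len i"
  "VC i \<in> pverts graph \<longleftrightarrow> i < length Rs"
  by (auto simp: graph_def core_def)

lemma edge_verts: "edge u v \<Longrightarrow> u \<in> pverts graph \<and> v \<in> pverts graph \<and> u \<noteq> v"
  unfolding edge_def
proof (elim disjE)
  assume "core_edge u v" then show ?thesis using core_edge_core by (auto simp: graph_def)
next
  have sp: "VR i j \<in> pverts graph \<and> x \<in> pverts graph \<and> VR i j \<noteq> x"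
    if "i < length Rs" "j \<le> len i" "x \<in> core" for i j x
    using that core_not_disc(1)[of i j] by (auto simp: graph_def)
  assume "disc_edge u v"
  then show ?thesis
  proof cases
    case (spoke i j)
    then show ?thesis using sp[OF _ _ b_core, of i j i j] by simp
  next
    case (spoke_next i j)
    then show ?thesis using sp[OF _ _ b_core, of i j i "Suc j"] by simp
  qed (use len_pos in \<open>auto simp: graph_verts\<close>)
qed

lemma pair_graph_graph: "pair_graph graph"
proof (rule pair_graphI)
  show "finite (pverts graph)" by (auto simp: graph_def core_def finite_Gs)
  show "parcs graph \<subseteq> pverts graph \<times> pverts graph" using edge_verts by (auto simp: arc_iff)
  show "irrefl (parcs graph)" using edge_verts by (auto simp: arc_iff irrefl_def)
  show "sym (parcs graph)" by (auto simp: arc_iff sym_def)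
qed

lemma arcI: "core_edge u v \<Longrightarrow> (u, v) \<in> parcs graph" "core_edge u v \<Longrightarrow> (v, u) \<in> parcs graph"
  "disc_edge u v \<Longrightarrow> (u, v) \<in> parcs graph" "disc_edge u v \<Longrightarrow> (v, u) \<in> parcs graph"
  by (auto simp: arc_iff edge_def)

lemma b_arc: "i < length Rs \<Longrightarrow> j < len i \<Longrightarrow> (b i j, b i (Suc j)) \<in> parcs graph"
  using b_edge arcI by blast

abbreviation hom (infix "\<approx>" 50) where "p \<approx> q \<equiv> homotopic graph p q"

lemmas tri = homotopic_triangle[OF pair_graph_graph]
lemmas bt = homotopic_backtrack[OF pair_graph_graph]

text \<open>The boundary walk is pushed across the disc: each boundary edge is traded, by three
  triangles, for moving the last spoke one place along the ring.\<close>

lemma disc_walk: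
  assumes i: "i < length Rs" and j: "j \<le> len i"
  shows "take (Suc j) (walk (Rs ! i)) \<approx> [VP, VR i 0, VC i, VR i j, b i j]"
  using j
proof (induction j)
  case 0
  have s: "(VR i 0, VP) \<in> parcs graph" "(VP, VR i 0) \<in> parcs graph"
    using arcI(3,4)[OF spoke[OF i, of 0]] by simp_all
  have "[] @ [VP] @ [] \<approx> [] @ [VP, VR i 0, VP] @ []" by (intro homotopic_sym[OF bt] s)
  also have "[] @ [VP, VR i 0, VP] @ [] = [VP] @ [VR i 0] @ [VP]" by simp
  also have "[VP] @ [VR i 0] @ [VP] \<approx> [VP] @ [VR i 0, VC i, VR i 0] @ [VP]"
    using i by (intro homotopic_sym[OF bt] arcI cone) auto
  finally show ?case by (subst walk_hd) simp
next
  case (Suc j)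
  let ?a = "VR i j" and ?a' = "VR i (Suc j)" and ?b = "b i j" and ?b' = "b i (Suc j)" 
  have "take (Suc (Suc j)) (walk (Rs ! i)) = take (Suc j) (walk (Rs ! i)) @ [?b']"
    using Suc.prems by (intro take_Suc_conv_app_nth) simp
  also have "\<dots> \<approx> [VP, VR i 0, VC i, ?a, ?b] @ [?b']" using Suc by (intro homotopic_append) simp
  also have "[VP, VR i 0, VC i, ?a, ?b] @ [?b'] = [VP, VR i 0, VC i] @ [?a, ?b, ?b'] @ []" by simp
  also have "\<dots> \<approx> [VP, VR i 0, VC i] @ [?a, ?b'] @ []"
    using i Suc.prems by (intro tri b_arc arcI disc_edge.intros) auto
  also have "\<dots> \<approx> [VP, VR i 0, VC i] @ [?a, ?a', ?b'] @ []"
    using i Suc.prems by (intro homotopic_sym[OF tri] arcI(3) disc_edge.intros) auto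
  also have "\<dots> = [VP, VR i 0] @ [VC i, ?a, ?a'] @ [?b']" by simp
  also have "\<dots> \<approx> [VP, VR i 0] @ [VC i, ?a'] @ [?b']"
    using i Suc.prems by (intro tri arcI(3) disc_edge.intros) auto
  finally show ?case by simp
qed

lemma relator_homotopic: "i < length Rs \<Longrightarrow> walk (Rs ! i) \<approx> [VP]"
proof -
  assume i: "i < length Rs"
  let ?a = "VR i 0" and ?z = "VR i (len i)"
  have vz: "(?z, VP) \<in> parcs graph" "(VP, ?z) \<in> parcs graph" "(VP, ?a) \<in> parcs graph"
    using arcI(3,4)[OF spoke[OF i, of "len i"]] arcI(4)[OF spoke[OF i, of 0]] by simp_all
  have "walk (Rs ! i) \<approx> [VP] @ [?a, VC i, ?z] @ [VP]"
    using disc_walk[OF i order_refl] by simp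
  also have "\<dots> \<approx> [VP] @ [?a, ?z] @ [VP]" 
    by (rule tri; (rule arcI(3), rule ring_close[OF i] | rule arcI(4), rule cone[OF i] | rule arcI(3), rule cone[OF i])) simp_all
  also have "\<dots> = [] @ [VP, ?a, ?z] @ [VP]" by simp
  also have "\<dots> \<approx> [] @ [VP, ?z] @ [VP]" by (rule tri[OF vz(3) arcI(3)[OF ring_close[OF i]] vz(2)])
  also have "\<dots> = [] @ [VP, ?z, VP] @ []" by simp
  also have "\<dots> \<approx> [] @ [VP] @ []" using vz by (intro bt)
  finally show ?thesis by simp
qed

section \<open>Action of loops on homotopy classes of paths\<close>

definition cl :: "'g vert list \<Rightarrow> 'g vert list set" where "cl p = {q. p \<approx> q}"

lemma cl_eq: "cl p = cl q \<longleftrightarrow> p \<approx> q"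
  unfolding cl_def using homotopic_sym homotopic_trans by (metis (mono_tags, lifting) Collect_cong mem_Collect_eq rtranclp.rtrancl_refl)

text \<open>Homotopy classes of paths to \<open>VP\<close> are extended by a loop \<open>t\<close> at \<open>VP\<close>, of which the first vertex
  is omitted.\<close>

definition extend :: "'g vert list \<Rightarrow> 'g vert list set \<Rightarrow> 'g vert list set" where
  "extend t C = (if \<exists>q. C = cl (q @ [VP]) then cl ((SOME q. C = cl (q @ [VP])) @ [VP] @ t) else C)"

lemma extend_cl: "extend t (cl (q @ [VP])) = cl (q @ [VP] @ t)"
proof -
  have "cl (q @ [VP]) = cl ((SOME r. cl (q @ [VP]) = cl (r @ [VP])) @ [VP])" by (rule someI) simp
  then have "(SOME r. cl (q @ [VP]) = cl (r @ [VP])) @ [VP] \<approx> q @ [VP]" by (simp add: cl_eq[symmetric])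
  from homotopic_append[OF this, of t] show ?thesis by (auto simp: extend_def cl_eq)
qed

lemma extend_other: "\<nexists>q. C = cl (q @ [VP]) \<Longrightarrow> extend t C = C" by (simp add: extend_def)

text \<open>Right multiplication by the loop of \<open>g\<close>. Permutations of classes stand in
  for the fundamental group: they form a group at once, and classes of paths that end elsewhere are
  fixed so that the map is defined everywhere.\<close>

definition loop_act :: "'g \<Rightarrow> 'g vert list set permut" where
  "loop_act g = (if g \<in> Gs then Permut (extend [VG g, VQ, VE, VP]) else 0)"

lemma loop_back: "g \<in> Gs \<Longrightarrow> q @ [VP, VG g, VQ, VE, VP, VE, VQ, VG g, VP] @ r \<approx> q @ [VP] @ r"
  "g \<in> Gs \<Longrightarrow> q @ [VP, VE, VQ, VG g, VP, VG g, VQ, VE, VP] @ r \<approx> q @ [VP] @ r"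
proof -
  assume g: "g \<in> Gs"
  note c = arcI(1,2)[OF core_edge.intros(1)] arcI(1,2)[OF core_edge.intros(2)]
    arcI(1,2)[OF core_edge.intros(3)[OF g]] arcI(1,2)[OF core_edge.intros(4)[OF g]]
  show "q @ [VP, VG g, VQ, VE, VP, VE, VQ, VG g, VP] @ r \<approx> q @ [VP] @ r"
    using homotopic_context[OF homotopic_rev_append[OF pair_graph_graph, of "[VP, VE, VQ, VG g, VP]"], of q r] c
    by simp
  show "q @ [VP, VE, VQ, VG g, VP, VG g, VQ, VE, VP] @ r \<approx> q @ [VP] @ r"
    using homotopic_context[OF homotopic_rev_append[OF pair_graph_graph, of "[VP, VG g, VQ, VE, VP]"], of q r] c
    by simp
qed

lemma extend_inverse:
  assumes g: "g \<in> Gs"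
  shows "extend [VE, VQ, VG g, VP] (extend [VG g, VQ, VE, VP] C) = C" (is ?A)
    and "extend [VG g, VQ, VE, VP] (extend [VE, VQ, VG g, VP] C) = C" (is ?B)
proof -
  have *: "extend t (extend (u @ [VP]) (cl (q @ [VP]))) = cl (q @ [VP] @ u @ [VP] @ t)" for t u q
    using extend_cl[of t "q @ [VP] @ u"] by (simp add: extend_cl)
  show ?A
  proof (cases "\<exists>q. C = cl (q @ [VP])")
    case True
    then obtain q where "C = cl (q @ [VP])" by blast
    then show ?thesis using *[of _ "[VG g, VQ, VE]" q] loop_back(1)[OF g, of q "[]"] by (simp add: cl_eq)
  qed (simp add: extend_other)
  show ?B
  proof (cases "\<exists>q. C = cl (q @ [VP])")
    case True
    then obtain q where "C = cl (q @ [VP])" by blast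
    then show ?thesis using *[of _ "[VE, VQ, VG g]" q] loop_back(2)[OF g, of q "[]"] by (simp add: cl_eq)
  qed (simp add: extend_other)
qed

lemma app_loop_act:
  assumes "g \<in> Gs"
  shows "app (loop_act g) C = extend [VG g, VQ, VE, VP] C"
    and "app (- loop_act g) C = extend [VE, VQ, VG g, VP] C"
proof -
  show *: "app (loop_act g) C = extend [VG g, VQ, VE, VP] C" for C
    using assms app_Permut[OF extend_inverse[OF assms]] by (simp add: loop_act_def)
  show "app (- loop_act g) C = extend [VE, VQ, VG g, VP] C"
    by (rule app_uminus_eqI) (simp add: * extend_inverse[OF assms])
qed

lemma weval_loop_act:
  assumes "fst ` set w \<subseteq> Gs"
  shows "app (weval loop_act w) (cl (q @ [VP])) = cl (q @ walk w)"
    and "\<nexists>q. C = cl (q @ [VP]) \<Longrightarrow> app (weval loop_act w) C = C"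
proof -
  show "app (weval loop_act w) (cl (q @ [VP])) = cl (q @ walk w)" using assms
  proof (induction w arbitrary: q rule: walk.induct)
    case (2 g s w)
    show ?case
      using 2(1)[of "q @ [VP, VG g, VQ, VE]"] 2(1)[of "q @ [VP, VE, VQ, VG g]"] 2(2)
      by (auto simp: app_loop_act extend_cl)
  qed simp
  show "app (weval loop_act w) C = C" if "\<nexists>q. C = cl (q @ [VP])" using assms
    by (induction w rule: walk.induct) (auto simp: app_loop_act extend_other[OF that])
qed

lemma weval_relator: "w \<in> set Rs \<Longrightarrow> weval loop_act w = 0"
proof (rule permut_eqI)
  fix C assume w: "w \<in> set Rs"
  then have sub: "fst ` set w \<subseteq> Gs" using Rs by blast
  obtain i where "i < length Rs" "w = Rs ! i" using w by (metis in_set_conv_nth)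
  then have "walk w \<approx> [VP]" using relator_homotopic by blast
  then have *: "cl (q @ walk w) = cl (q @ [VP])" for q
    unfolding cl_eq by (rule homotopic_prepend)
  show "app (weval loop_act w) C = app 0 C"
  proof (cases "\<exists>q. C = cl (q @ [VP])")
    case True
    then show ?thesis using weval_loop_act(1)[OF sub] * by fastforce
  next
    case False
    then show ?thesis using weval_loop_act(2)[OF sub, of C] by simp
  qed
qed

section \<open>Spanning tree and simple connectivity\<close>

fun tree_path :: "'g vert \<Rightarrow> 'g vert list" where
  "tree_path VP = [VP]"
| "tree_path VE = [VP, VE]"
| "tree_path VQ = [VP, VE, VQ]"
| "tree_path (VG g) = [VP, VG g]"
| "tree_path (VR i j) = (case b i j of VG g \<Rightarrow> [VP, VG g] | VE \<Rightarrow> [VP, VE] | VQ \<Rightarrow> [VP, VE, VQ] | _ \<Rightarrow> [VP]) @ [VR i j]"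
| "tree_path (VC i) = [VP, VR i 0, VC i]"

lemma tree_path_core: "v \<in> core \<Longrightarrow> tree_path v \<noteq> [] \<and> last (tree_path v) = v \<and>
    successively (\<lambda>u v. (u, v) \<in> parcs graph) (tree_path v)"
  by (auto simp: core_def intro!: arcI(1) core_edge.intros)

lemma tree_path_VR: "i < length Rs \<Longrightarrow> j \<le> len i \<Longrightarrow> tree_path (VR i j) = tree_path (b i j) @ [VR i j]"
  using b_core[of i j] by (auto simp: core_def)

lemma tree_path_path:
  assumes "v \<in> pverts graph"
  shows "tree_path v \<noteq> [] \<and> last (tree_path v) = v \<and>
    successively (\<lambda>u v. (u, v) \<in> parcs graph) (tree_path v)"
proof -
  consider "v \<in> core" | i j where "v = VR i j" "i < length Rs" "j \<le> len i" | i where "v = VC i" "i < length Rs"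
    using assms by (auto simp: graph_def)
  then show ?thesis
  proof cases
    case 1 then show ?thesis by (rule tree_path_core)
  next
    case 2
    then show ?thesis
      using tree_path_core[OF b_core[OF 2(2,3)]] arcI(4)[OF spoke[OF 2(2,3)]]
      by (simp add: tree_path_VR successively_append_iff del: tree_path.simps)
  next
    case 3
    then show ?thesis using arcI(4)[OF spoke[OF 3(2), of 0]] arcI(4)[OF cone[OF 3(2), of 0]] by simp
  qed
qed

lemma finite_graph_graph: "finite_graph graph"
proof (rule finite_graphI[OF pair_graph_graph, of VP])
  show "VP \<in> pverts graph" by (simp add: graph_verts core_def)
  have path: "p \<noteq> [] \<Longrightarrow> successively (\<lambda>u v. (u, v) \<in> parcs graph) p \<Longrightarrow> (hd p, last p) \<in> (parcs graph)\<^sup>*" for p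
    by (induction p rule: induct_list012) (auto intro: converse_rtrancl_into_rtrancl)
  have hd: "hd (tree_path v) = VP" for v by (cases v) (auto split: vert.splits)
  show "(VP, v) \<in> (parcs graph)\<^sup>*" if "v \<in> pverts graph" for v
    using path[of "tree_path v"] tree_path_path[OF that] hd by simp
qed

text \<open>In the tree of \<open>tree_path\<close> the only core arcs left over join
  \<open>VG g\<close> and \<open>VQ\<close>, and closing one gives the loop of \<open>g\<close>.
  Arcs in a disc are handled by its triangles.\<close>

lemma simply_connected_graph:
  assumes triv: "\<And>g. g \<in> Gs \<Longrightarrow> loop_act g = 0"
  shows "simply_connected_complex (clique_complex graph)"
proof (rule simply_connectedI[where \<tau> = tree_path, OF pair_graph_graph tree_path_path])
  have rev: "tree_path v @ [u] \<approx> tree_path u" if "tree_path u @ [v] \<approx> tree_path v" "edge u v" for u v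
  proof -
    have "u \<in> pverts graph" using edge_verts[OF that(2)] by blast
    from tree_path_path[OF this] obtain p where p: "tree_path u = p @ [u]" by (metis append_butlast_last_id)
    have "tree_path v @ [u] \<approx> (tree_path u @ [v]) @ [u]"
      by (rule homotopic_append[OF homotopic_sym[OF that(1)]])
    also have "\<dots> = p @ [u, v, u] @ []" using p by simp
    also have "\<dots> \<approx> p @ [u] @ []" using that(2) by (intro bt) (simp add: arc_iff)
    finally show ?thesis using p by simp
  qed
  have gq: "[VP, VG g, VQ] \<approx> [VP, VE, VQ]" if g: "g \<in> Gs" for g
  proof -
    note c = core_edge.intros(1,2) core_edge.intros(3,4)[OF g]
    \<comment> \<open>Applied to the class of the constant path, \<open>loop_act g = 0\<close> says
      that the loop of \<open>g\<close> is contractible.\<close>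
    have "cl ([] @ [VP]) = extend [VG g, VQ, VE, VP] (cl ([] @ [VP]))"
      using app_loop_act(1)[OF g] triv[OF g] by simp
    then have l: "[VP, VG g, VQ, VE, VP] \<approx> [VP]" unfolding extend_cl cl_eq by (simp add: homotopic_sym)
    have "[VP, VG g, VQ] = [VP, VG g] @ [VQ] @ []" by simp
    also have "\<dots> \<approx> [VP, VG g] @ [VQ, VE, VQ] @ []" by (intro homotopic_sym[OF bt] arcI(2) c)
    also have "\<dots> = [VP, VG g, VQ] @ [VE] @ [VQ]" by simp
    also have "\<dots> \<approx> [VP, VG g, VQ] @ [VE, VP, VE] @ [VQ]" by (intro homotopic_sym[OF bt] arcI(2) c)
    also have "\<dots> = [VP, VG g, VQ, VE, VP] @ [VE, VQ]" by simp
    also have "\<dots> \<approx> [VP] @ [VE, VQ]" using l by (rule homotopic_append)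
    finally show ?thesis by simp
  qed
  have core1: "tree_path u @ [v] \<approx> tree_path v" if "core_edge u v" for u v
    using that gq by cases auto
  have core2: "tree_path u @ [v] \<approx> tree_path v" if "core_edge u v \<or> core_edge v u" for u v
    using that core1 rev by (auto simp: edge_def)
  have spl: "\<exists>p. tree_path v = p @ [v]" if "v \<in> pverts graph" for v
    using tree_path_path[OF that] by (metis append_butlast_last_id)
  have ring1: "tree_path (VR i j) @ [b i (Suc j)] \<approx> tree_path (b i (Suc j))"
    if ij: "i < length Rs" "j < len i" for i j
  proof -
    obtain p where p: "tree_path (b i j) = p @ [b i j]"
      using spl[of "b i j"] b_core[of i j] ij by (auto simp: graph_verts)
    have "tree_path (VR i j) @ [b i (Suc j)] = p @ [b i j, VR i j, b i (Suc j)] @ []"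
      using p tree_path_VR[of i j] ij by simp
    also have "\<dots> \<approx> p @ [b i j, b i (Suc j)] @ []"
      using ij by (intro tri b_arc arcI(4)[OF spoke] arcI(3)[OF spoke_next]) auto
    also have "\<dots> = tree_path (b i j) @ [b i (Suc j)]" using p by simp
    also have "\<dots> \<approx> tree_path (b i (Suc j))" using ij by (intro core2 b_edge)
    finally show ?thesis .
  qed
  have ring2: "tree_path (VR i j) @ [VR i (Suc j)] \<approx> tree_path (VR i (Suc j))"
    if ij: "i < length Rs" "j < len i" for i j
  proof -
    obtain p where p: "tree_path (VR i j) = p @ [VR i j]"
      using spl[of "VR i j"] ij by (auto simp: graph_verts)
    have "tree_path (VR i j) @ [VR i (Suc j)] = p @ [VR i j, VR i (Suc j)] @ []" using p by simp
    also have "\<dots> \<approx> p @ [VR i j, b i (Suc j), VR i (Suc j)] @ []"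
      using ij by (intro homotopic_sym[OF tri] arcI(3)[OF spoke_next] arcI(4)[OF spoke] arcI(3)[OF ring]) auto
    also have "\<dots> = (tree_path (VR i j) @ [b i (Suc j)]) @ [VR i (Suc j)]" using p by simp
    also have "\<dots> \<approx> tree_path (b i (Suc j)) @ [VR i (Suc j)]" using ring1[OF ij] by (rule homotopic_append)
    finally show ?thesis using tree_path_VR[of i "Suc j"] ij by simp
  qed
  have cone1: "tree_path (VC i) @ [VR i j] \<approx> tree_path (VR i j)" if i: "i < length Rs" and j: "j \<le> len i" for i j
    using j
  proof (induction j)
    case 0
    have "[VP] @ [VR i 0, VC i, VR i 0] @ [] \<approx> [VP] @ [VR i 0] @ []"
      using i by (intro bt arcI(4)[OF cone]) auto
    then show ?case by simp
  next
    case (Suc j)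
    have "tree_path (VC i) @ [VR i (Suc j)] = [VP, VR i 0] @ [VC i, VR i (Suc j)] @ []" by simp
    also have "\<dots> \<approx> [VP, VR i 0] @ [VC i, VR i j, VR i (Suc j)] @ []"
      using i Suc.prems by (intro homotopic_sym[OF tri] arcI(3)[OF cone] arcI(3)[OF ring]) auto
    also have "\<dots> = (tree_path (VC i) @ [VR i j]) @ [VR i (Suc j)]" by simp
    also have "\<dots> \<approx> tree_path (VR i j) @ [VR i (Suc j)]" using Suc by (intro homotopic_append) simp
    also have "\<dots> \<approx> tree_path (VR i (Suc j))" using i Suc.prems by (intro ring2) auto
    finally show ?case .
  qed
  have disc: "tree_path u @ [v] \<approx> tree_path v" if "disc_edge u v" for u v
    using that
  proof cases
    case (ring_close i)
    have "[] @ [VP, VR i 0, VR i (len i)] @ [] \<approx> [] @ [VP, VR i (len i)] @ []"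
      using arcI(4)[OF spoke[OF ring_close(3), of 0]] arcI(4)[OF spoke[OF ring_close(3), of "len i"]]
      by (intro tri arcI(3)[OF disc_edge.ring_close[OF ring_close(3)]]) auto
    then show ?thesis using ring_close tree_path_VR[of i "len i"] by simp
  next
    case (spoke i j)
    obtain p where p: "tree_path (b i j) = p @ [b i j]"
      using spl[of "b i j"] b_core[of i j] spoke by (auto simp: graph_verts)
    have "p @ [b i j, VR i j, b i j] @ [] \<approx> p @ [b i j] @ []"
      using spoke by (intro bt arcI(4)[OF disc_edge.spoke]) auto
    then show ?thesis using spoke p tree_path_VR[of i j] by simp
  qed (use ring1 ring2 cone1 in blast)+
  show "tree_path u @ [v] \<approx> tree_path v" if "(u, v) \<in> parcs graph" for u v
    using that core1 disc rev unfolding arc_iff edge_def by blast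
qed

end

section \<open>Voltages on the graph of a presentation\<close>

definition lipschitz_by :: "nat \<Rightarrow> ('o \<Rightarrow> nat) \<Rightarrow> 'o permut \<Rightarrow> bool" where
  "lipschitz_by n h p \<longleftrightarrow> (\<forall>a. h a \<le> h (app p a) + n \<and> h (app p a) \<le> h a + n)"

lemma lipschitz_by_0: "lipschitz_by n h 0" by (simp add: lipschitz_by_def)

lemma lipschitz_by_plus: "lipschitz_by m h p \<Longrightarrow> lipschitz_by n h q \<Longrightarrow> lipschitz_by (m + n) h (p + q)"
  unfolding lipschitz_by_def app_plus by (metis add.assoc add.commute add_le_mono1 le_trans)

lemma lipschitz_by_uminus: "lipschitz_by n h p \<Longrightarrow> lipschitz_by n h (- p)"
  unfolding lipschitz_by_def by (metis app_uminus_app(2))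

lemma lipschitz_by_mono: "lipschitz_by m h p \<Longrightarrow> m \<le> n \<Longrightarrow> lipschitz_by n h p"
  unfolding lipschitz_by_def by (meson add_left_mono le_trans)

context presentation
begin

text \<open>The permutation of \<open>g\<close> sits on the arc outside the spanning tree, so the
  walk of a word composes to the value of the word.\<close>

fun core_volt :: "('g \<Rightarrow> 'o permut) \<Rightarrow> 'g vert \<Rightarrow> 'g vert \<Rightarrow> 'o permut" where
  "core_volt \<phi> (VG g) VQ = \<phi> g"
| "core_volt \<phi> VQ (VG g) = - \<phi> g"
| "core_volt \<phi> _ _ = 0"

primrec prefix_volt :: "('g \<Rightarrow> 'o permut) \<Rightarrow> nat \<Rightarrow> nat \<Rightarrow> 'o permut" where
  "prefix_volt \<phi> i 0 = 0"
| "prefix_volt \<phi> i (Suc j) = prefix_volt \<phi> i j + core_volt \<phi> (b i j) (b i (Suc j))"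

text \<open>With the disc trivialised, a spoke carries the transport along the boundary up to its
  foot. The foot is \<open>b i j\<close> or \<open>b i (Suc j)\<close>, which differ because they
  are adjacent.\<close>

definition ring_volt :: "('g \<Rightarrow> 'o permut) \<Rightarrow> nat \<Rightarrow> nat \<Rightarrow> 'g vert \<Rightarrow> 'o permut" where
  "ring_volt \<phi> i j v = (if v = b i j then prefix_volt \<phi> i j else prefix_volt \<phi> i (Suc j))"

text \<open>Ring vertices and cones are trivialised over a whole disc, so that only the triangle closing the
  ring can have non-trivial holonomy.\<close>

definition volt :: "('g \<Rightarrow> 'o permut) \<Rightarrow> 'g vert \<Rightarrow> 'g vert \<Rightarrow> 'o permut" where
  "volt \<phi> u v = (case u of VR i j \<Rightarrow> (if v \<in> core then ring_volt \<phi> i j v else 0)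
     | _ \<Rightarrow> (case v of VR i j \<Rightarrow> (if u \<in> core then - ring_volt \<phi> i j u else 0) | _ \<Rightarrow> core_volt \<phi> u v))"

lemma core_volt_flip: "core_volt \<phi> v u = - core_volt \<phi> u v"
  by (cases "(\<phi>, u, v)" rule: core_volt.cases) auto

lemma volt_flip: "volt \<phi> v u = - volt \<phi> u v"
  by (cases u; cases v) (auto simp: volt_def core_not_disc core_volt_flip[of \<phi> v u])

lemma volt_core: "u \<in> core \<Longrightarrow> v \<in> core \<Longrightarrow> volt \<phi> u v = core_volt \<phi> u v"
  by (auto simp: volt_def core_def)

lemma volt_ring: "volt \<phi> (VR i j) (VR k l) = 0" "volt \<phi> (VR i j) (VC k) = 0" "volt \<phi> (VC k) (VR i j) = 0"
  by (simp_all add: volt_def core_not_disc)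

lemma volt_spoke:
  assumes "i < length Rs" "k \<le> len i" "k = j \<or> k = Suc j"
  shows "volt \<phi> (VR i j) (b i k) = prefix_volt \<phi> i k"
proof -
  have "b i (Suc j) \<noteq> b i j" if "k = Suc j"
    using b_edge[of i j] core_edge_core assms that by fastforce
  then show ?thesis using assms b_core[of i k] by (auto simp: volt_def ring_volt_def)
qed

text \<open>A return to the same vertex after two edges is a backtrack, whose voltages cancel; after
  one edge it is impossible. Backtracks do occur, for instance where a positive letter is followed
  by a negative one.\<close>

lemma prefix_volt_eq:
  assumes i: "i < length Rs" and kl: "k \<le> l" "l \<le> k + 2" "l \<le> len i" and b: "b i k = b i l"
  shows "prefix_volt \<phi> i k = prefix_volt \<phi> i l"
proof -
  have ne: "l \<noteq> Suc k" using b_edge[of i k] core_edge_core i kl b by fastforce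
  show ?thesis
  proof (cases "l = k")
    case False
    then have l: "l = Suc (Suc k)" using ne kl by simp
    have "core_volt \<phi> (b i k) (b i (Suc k)) + core_volt \<phi> (b i (Suc k)) (b i l) = 0"
      unfolding b[symmetric] by (simp add: core_volt_flip[of \<phi> "b i k"])
    then show ?thesis unfolding l by (simp add: add.assoc l)
  qed simp
qed

lemma arc_VR:
  assumes "(VR i j, v) \<in> parcs graph"
  shows "i < length Rs \<and> j \<le> len i \<and>
    (v = VC i \<or> (\<exists>l. v = VR i l \<and> l \<le> len i \<and> (l = Suc j \<or> j = Suc l \<or> (j = 0 \<and> l = len i) \<or> (l = 0 \<and> j = len i)))
      \<or> (\<exists>k. v = b i k \<and> v \<in> core \<and> k \<le> len i \<and> (k = j \<or> k = Suc j)))"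
proof -
  have "core_edge (VR i j) v \<Longrightarrow> False" "core_edge v (VR i j) \<Longrightarrow> False"
    using core_edge_core core_not_disc by blast+
  then consider "disc_edge (VR i j) v" | "disc_edge v (VR i j)" using assms unfolding arc_iff edge_def by blast
  then show ?thesis
  proof cases
    case 1
    then show ?thesis
    proof cases
      case ring then show ?thesis by auto
    next
      case ring_close then show ?thesis by auto
    next
      case spoke then show ?thesis using b_core by blast
    next
      case spoke_next then show ?thesis using b_core[of i "Suc j"] by auto
    qed
  next
    case 2
    then show ?thesis
    proof cases
      case ring then show ?thesis by auto
    next
      case ring_close then show ?thesis by auto
    next
      case (spoke i' j') then show ?thesis using b_core core_not_disc by metis
    next
      case (spoke_next i' j') then show ?thesis using b_core[of i' "Suc j'"] core_not_disc by (metis Suc_leI)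
    next
      case cone then show ?thesis by auto
    qed
  qed
qed

lemma not_arc_VC_core: "v \<in> core \<Longrightarrow> (VC i, v) \<notin> parcs graph"
proof
  assume v: "v \<in> core" and "(VC i, v) \<in> parcs graph"
  then consider "core_edge (VC i) v" | "core_edge v (VC i)" | "disc_edge (VC i) v" | "disc_edge v (VC i)"
    unfolding arc_iff edge_def by blast
  then show False
  proof cases
    case 3 then show False using v core_not_disc by cases auto
  next
    case 4 then show False using v core_not_disc by cases auto
  qed (use core_edge_core core_not_disc in blast)+
qed

lemma core_arc: "u \<in> core \<Longrightarrow> v \<in> core \<Longrightarrow> (u, v) \<in> parcs graph \<Longrightarrow> core_edge u v \<or> core_edge v u"
  unfolding arc_iff edge_def using core_not_disc by (auto elim!: disc_edge.cases)

lemma flat_flip: "volt \<phi> u v + volt \<phi> v w = volt \<phi> u w \<Longrightarrow> volt \<phi> u w + volt \<phi> w v = volt \<phi> u v"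
  by (metis add.assoc add.right_inverse add_0_right volt_flip)

lemma flat_rotate: "volt \<phi> u v + volt \<phi> v w = volt \<phi> u w \<Longrightarrow> volt \<phi> v u + volt \<phi> u w = volt \<phi> v w"
  by (metis add.assoc left_minus add_0_left volt_flip)

definition closing :: "'g vert \<Rightarrow> 'g vert \<Rightarrow> 'g vert \<Rightarrow> bool" where
  "closing u v w \<longleftrightarrow> (\<exists>i<length Rs. {u, v, w} = {VR i 0, VR i (len i), VP})"

text \<open>Neighbouring ring vertices touch \<open>w\<close> at boundary positions at most two
  apart. Across the seam the positions are at opposite ends of the walk, which forces
  \<open>w = VP\<close> and gives the seam triangle.\<close>

lemma ring_core_flat:
  assumes "(VR i j, VR i l) \<in> parcs graph" "(VR i j, w) \<in> parcs graph" "(VR i l, w) \<in> parcs graph" "w \<in> core"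
  shows "volt \<phi> (VR i l) w = volt \<phi> (VR i j) w \<or> closing (VR i j) (VR i l) w"
proof -
  have i: "i < length Rs" using arc_VR[OF assms(1)] by blast
  have pick: "\<exists>k. w = b i k \<and> k \<le> len i \<and> (k = j \<or> k = Suc j)" if "(VR i j, w) \<in> parcs graph" for j
    using arc_VR[OF that] assms(4) core_not_disc by auto
  obtain k where k: "w = b i k" "k \<le> len i" "k = j \<or> k = Suc j" using pick[OF assms(2)] by blast
  obtain k' where k': "w = b i k'" "k' \<le> len i" "k' = l \<or> k' = Suc l" using pick[OF assms(3)] by blast
  have eq: "volt \<phi> (VR i j) w = prefix_volt \<phi> i k" "volt \<phi> (VR i l) w = prefix_volt \<phi> i k'"
    using volt_spoke[OF i k(2,3)] volt_spoke[OF i k'(2,3)] k(1) k'(1) by metis+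
  have bb: "b i k = b i k'" using k k' by simp
  have "l = Suc j \<or> j = Suc l \<or> (j = 0 \<and> l = len i) \<or> (l = 0 \<and> j = len i)"
    using arc_VR[OF assms(1)] core_not_disc b_core by auto
  moreover have ?thesis if "l = Suc j \<or> j = Suc l"
  proof -
    have "prefix_volt \<phi> i k = prefix_volt \<phi> i k'"
    proof (cases "k \<le> k'")
      case True
      then show ?thesis using prefix_volt_eq[OF i, of k k' \<phi>] bb k k' that by fastforce
    next
      case False
      then show ?thesis using prefix_volt_eq[OF i, of k' k \<phi>] bb k k' that by fastforce
    qed
    then show ?thesis using eq by simp
  qed
  moreover have "closing (VR i j) (VR i l) w" if "(j = 0 \<and> l = len i) \<or> (l = 0 \<and> j = len i)"
  proof -
    have "w = VP" using that k k' by fastforce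
    then show ?thesis using that i unfolding closing_def by (auto simp: insert_commute)
  qed
  ultimately show ?thesis by blast
qed

lemma ring_flat:
  assumes uv: "(VR i j, v) \<in> parcs graph" and uw: "(VR i j, w) \<in> parcs graph" and vw: "(v, w) \<in> parcs graph"
  shows "volt \<phi> (VR i j) v + volt \<phi> v w = volt \<phi> (VR i j) w \<or> closing (VR i j) v w"
proof -
  have kinds: "v = VC i \<or> (\<exists>l. v = VR i l) \<or> v \<in> core" if "(VR i j, v) \<in> parcs graph" for v
    using arc_VR[OF that] by blast
  have wv: "(w, v) \<in> parcs graph" using vw pair_graph_sym[OF pair_graph_graph] by blast
  consider "v \<in> core" "w \<in> core" | l where "v = VR i l" "w \<in> core" | l where "w = VR i l" "v \<in> core"
    | "v \<notin> core" "w \<notin> core" "v = VC i \<or> (\<exists>l. v = VR i l)" "w = VC i \<or> (\<exists>l. w = VR i l)"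
    using kinds[OF uv] kinds[OF uw] not_arc_VC_core vw wv by metis
  then show ?thesis
  proof cases
    case 1
    obtain k where k: "i < length Rs" "v = b i k" "k \<le> len i" "k = j \<or> k = Suc j"
      using arc_VR[OF uv] 1 core_not_disc by auto
    obtain k' where k': "w = b i k'" "k' \<le> len i" "k' = j \<or> k' = Suc j"
      using arc_VR[OF uw] 1 core_not_disc by auto
    have eq: "volt \<phi> (VR i j) v = prefix_volt \<phi> i k" "volt \<phi> (VR i j) w = prefix_volt \<phi> i k'"
      using volt_spoke[OF k(1,3,4)] volt_spoke[OF k(1) k'(2,3)] k(2) k'(1) by metis+
    have "v \<noteq> w" using vw pair_graph_irrefl[OF pair_graph_graph] by blast
    then have "(k = j \<and> k' = Suc j) \<or> (k = Suc j \<and> k' = j)" using k k' by auto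
    then have "prefix_volt \<phi> i k + core_volt \<phi> v w = prefix_volt \<phi> i k'"
      using k(2) k'(1) core_volt_flip[of \<phi> v w] by (auto simp: add.assoc)
    then show ?thesis using eq volt_core[OF 1, of \<phi>] by simp
  next
    case 2
    then show ?thesis using ring_core_flat[of i j l w \<phi>] uv uw vw by (auto simp: volt_ring)
  next
    case 3
    then have "volt \<phi> (VR i j) w + volt \<phi> w v = volt \<phi> (VR i j) v \<or> closing (VR i j) w v"
      using ring_core_flat[of i j l v \<phi>] uv uw wv by (auto simp: volt_ring)
    then show ?thesis using flat_flip[of \<phi> "VR i j" w v] by (auto simp: closing_def insert_commute)
  next
    case 4
    have "v \<noteq> w" using vw pair_graph_irrefl[OF pair_graph_graph] by blast
    then show ?thesis using 4 by (auto simp: volt_ring)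
  qed
qed

text \<open>Every triangle contains a ring vertex: the core has no triangle, and a cone vertex is
  adjacent to ring vertices only. After reordering the vertices, \<open>ring_flat\<close>
  applies.\<close>

lemma flat_or_closing:
  assumes uv: "(u, v) \<in> parcs graph" and vw: "(v, w) \<in> parcs graph" and uw: "(u, w) \<in> parcs graph"
  shows "volt \<phi> u v + volt \<phi> v w = volt \<phi> u w \<or> closing u v w"
proof -
  have sym: "(v, u) \<in> parcs graph" "(w, v) \<in> parcs graph" "(w, u) \<in> parcs graph"
    using assms pair_graph_sym[OF pair_graph_graph] by blast+
  have "\<exists>i j. u = VR i j \<or> v = VR i j \<or> w = VR i j"
  proof (rule ccontr)
    assume no: "\<not> ?thesis"
    have "x \<in> pverts graph" if "x = u \<or> x = v \<or> x = w" for x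
      using that pair_graph_arcs[OF pair_graph_graph uv] pair_graph_arcs[OF pair_graph_graph vw] by blast
    moreover have "x \<in> core \<or> (\<exists>i. x = VC i) \<or> (\<exists>i j. x = VR i j)" if "x \<in> pverts graph" for x
      using that by (auto simp: graph_def)
    ultimately have kind: "x \<in> core \<or> (\<exists>i. x = VC i)" if "x = u \<or> x = v \<or> x = w" for x
      using that no by metis
    have cone: "(VC i, VC k) \<notin> parcs graph" for i k
      by (auto simp: arc_iff edge_def disc_edge.simps core_edge.simps)
    have c: "x \<in> core" if xy: "(x, y) \<in> parcs graph" "x = u \<or> x = v \<or> x = w" "y = u \<or> y = v \<or> y = w" for x y
    proof (rule ccontr)
      assume "x \<notin> core"
      then obtain i where x: "x = VC i" using kind xy(2) by blast
      have "y \<notin> core" using not_arc_VC_core xy(1) x by blast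
      then obtain k where "y = VC k" using kind xy(3) by blast
      then show False using xy(1) x cone by blast
    qed
    have "u \<in> core" "v \<in> core" "w \<in> core" using c uv vw sym(2) by blast+
    then have "core_edge u v \<or> core_edge v u" "core_edge v w \<or> core_edge w v" "core_edge u w \<or> core_edge w u"
      using core_arc assms by blast+
    then show False by (auto elim!: core_edge.cases)
  qed
  then obtain i j where "u = VR i j \<or> v = VR i j \<or> w = VR i j" by blast
  then consider "u = VR i j" | "v = VR i j" | "w = VR i j" by blast
  then show ?thesis
  proof cases
    case 1 then show ?thesis using ring_flat[of i j v w \<phi>] assms by simp
  next
    case 2
    then have "volt \<phi> v u + volt \<phi> u w = volt \<phi> v w \<or> closing v u w"
      using ring_flat[of i j u w \<phi>] assms sym by simp
    then show ?thesis using flat_rotate[of \<phi> v u w] by (auto simp: closing_def insert_commute)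
  next
    case 3
    then have "volt \<phi> w u + volt \<phi> u v = volt \<phi> w v \<or> closing w u v"
      using ring_flat[of i j u v \<phi>] assms sym by simp
    then show ?thesis using flat_flip[OF flat_rotate[of \<phi> w u v]] by (auto simp: closing_def insert_commute)
  qed
qed

lemma prefix_volt_len: "prefix_volt \<phi> i (len i) = weval \<phi> (Rs ! i)"
proof -
  define pre where "pre w j = sum_list (map (\<lambda>k. core_volt \<phi> (walk w ! k) (walk w ! Suc k)) [0..<j])" for w j
  have "prefix_volt \<phi> i j = pre (Rs ! i) j" for j by (induction j) (simp_all add: pre_def)
  moreover have "pre w (4 * length w) = weval \<phi> w" for w
  proof (induction w rule: walk.induct)
    case (2 g s w)
    have "[0..<4 * length ((g, s) # w)] = [0, 1, 2, 3] @ map (\<lambda>k. k + 4) [0..<4 * length w]"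
    proof -
      have "[0..<4 * length ((g, s) # w)] = [0..<4] @ [4..<4 + 4 * length w]"
        using upt_add_eq_append[of 0 4 "4 * length w"] by simp
      also have "[4..<4 + 4 * length w] = map (\<lambda>k. k + 4) [0..<4 * length w]"
        by (simp add: map_add_upt add.commute)
      also have "[0..<4] = [0, 1, 2, 3]" by (simp add: upt_rec)
      finally show ?thesis .
    qed
    then have "pre ((g, s) # w) (4 * length ((g, s) # w)) =
        (if s then \<phi> g else - \<phi> g) + pre w (4 * length w)"
      by (simp add: pre_def comp_def numeral_eq_Suc)
    then show ?case using 2 by simp
  qed (simp add: pre_def)
  ultimately show ?thesis by simp
qed

lemma lipschitz_core_volt:
  assumes "\<And>g. g \<in> Gs \<Longrightarrow> lipschitz_by 1 h (\<phi> g)" "u \<in> core" "v \<in> core"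
  shows "lipschitz_by 1 h (core_volt \<phi> u v)"
  using assms by (cases "(\<phi>, u, v)" rule: core_volt.cases)
    (auto simp: core_def intro: lipschitz_by_0 lipschitz_by_uminus)

lemma lipschitz_prefix_volt:
  assumes "\<And>g. g \<in> Gs \<Longrightarrow> lipschitz_by 1 h (\<phi> g)" "i < length Rs" "j \<le> len i"
  shows "lipschitz_by j h (prefix_volt \<phi> i j)"
  using assms(3)
proof (induction j)
  case (Suc j)
  then have "lipschitz_by (j + 1) h (prefix_volt \<phi> i j + core_volt \<phi> (b i j) (b i (Suc j)))"
    using assms by (intro lipschitz_by_plus lipschitz_core_volt b_core) auto
  then show ?case by simp
qed (simp add: lipschitz_by_0)

lemma lipschitz_volt:
  assumes \<phi>: "\<And>g. g \<in> Gs \<Longrightarrow> lipschitz_by 1 h (\<phi> g)" and L: "1 \<le> L" "\<And>i. i < length Rs \<Longrightarrow> len i \<le> L"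
    and arc: "(u, v) \<in> parcs graph"
  shows "lipschitz_by L h (volt \<phi> u v)"
proof -
  have ring: "lipschitz_by L h (volt \<phi> (VR i j) v)" if uv: "(VR i j, v) \<in> parcs graph" for i j v
  proof -
    from arc_VR[OF uv] consider "volt \<phi> (VR i j) v = 0"
      | k where "v = b i k" "i < length Rs" "k \<le> len i" "k = j \<or> k = Suc j"
      by (auto simp: volt_ring)
    then show ?thesis
    proof cases
      case 1 then show ?thesis by (simp add: lipschitz_by_0)
    next
      case 2
      then show ?thesis
        using lipschitz_by_mono[OF lipschitz_prefix_volt[OF \<phi> 2(2,3)] order_trans[OF 2(3) L(2)[OF 2(2)]]]
          volt_spoke[OF 2(2-4), of \<phi>] by simp
    qed
  qed
  have sym: "(v, u) \<in> parcs graph" using arc pair_graph_sym[OF pair_graph_graph] by blast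
  consider i j where "u = VR i j" | i j where "v = VR i j" | "u \<in> core" "v \<in> core" | "volt \<phi> u v = 0"
    using pair_graph_arcs[OF pair_graph_graph arc] not_arc_VC_core arc sym
    by (auto simp: graph_def volt_def)
  then show ?thesis
  proof cases
    case 1 then show ?thesis using ring arc by simp
  next
    case 2 then show ?thesis using ring[of i j u] sym volt_flip[of \<phi> u v] lipschitz_by_uminus[of L h "volt \<phi> v u"] by simp
  next
    case 3
    then show ?thesis using lipschitz_by_mono[OF lipschitz_core_volt[OF \<phi>] L(1)] by (simp add: volt_core)
  next
    case 4 then show ?thesis by (simp add: lipschitz_by_0)
  qed
qed

lemma voltage_graph:
  assumes \<delta>: "port_numbering graph \<delta>"
    and \<phi>: "\<And>g. g \<in> Gs \<Longrightarrow> lipschitz_by 1 h (\<phi> g)" and L: "1 \<le> L" "\<And>i. i < length Rs \<Longrightarrow> len i \<le> L"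
    and rel: "\<And>w a. w \<in> set Rs \<Longrightarrow> 0 < h a \<Longrightarrow> app (weval \<phi> w) a = a"
  shows "voltage graph \<delta> (\<lambda>u v. app (volt \<phi> u v)) h L VP"
proof (rule voltage.intro)
  show "pair_graph graph" by (rule pair_graph_graph)
  show "VP \<in> pverts graph" by (simp add: graph_verts core_def)
  show "app (volt \<phi> v u) (app (volt \<phi> u v) a) = a" if "(u, v) \<in> parcs graph" for u v a by (simp add: volt_flip[of \<phi> v u])
  show "h a \<le> h (app (volt \<phi> u v) a) + L" if "(u, v) \<in> parcs graph" for u v a
    using lipschitz_volt[OF \<phi> L that] by (simp add: lipschitz_by_def)
  show "app (volt \<phi> v w) (app (volt \<phi> u v) a) = app (volt \<phi> u w) a"
    if arcs: "(u, v) \<in> parcs graph" "(v, w) \<in> parcs graph" "(u, w) \<in> parcs graph" and h: "L < h a" for u v w a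
  proof (cases "volt \<phi> u v + volt \<phi> v w = volt \<phi> u w")
    case True then show ?thesis by (metis app_plus)
  next
    case False
    then obtain i where i: "i < length Rs" "{u, v, w} = {VR i 0, VR i (len i), VP}"
      using flat_or_closing[OF arcs] unfolding closing_def by blast
    \<comment> \<open>Among the arcs of the seam triangle only those between
      \<open>VR i (len i)\<close> and \<open>VP\<close> carry a voltage, the value of the relator or
      its inverse; in every order of the vertices the triangle closes at points fixed by it.\<close>
    define \<rho> where "\<rho> = weval \<phi> (Rs ! i)"
    have \<rho>: "app \<rho> a = a" using rel[of "Rs ! i" a] i h by (simp add: \<rho>_def)
    then have \<rho>': "app (- \<rho>) a = a" by (metis app_uminus_app(1))
    have v0: "volt \<phi> (VR i 0) VP = 0" using volt_spoke[OF i(1), of 0 0 \<phi>] by simp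
    have v1: "volt \<phi> (VR i (len i)) VP = \<rho>"
      using volt_spoke[OF i(1), of "len i" "len i" \<phi>] prefix_volt_len by (simp add: \<rho>_def)
    have v2: "volt \<phi> VP (VR i 0) = 0" "volt \<phi> VP (VR i (len i)) = - \<rho>"
      using v0 v1 volt_flip[of \<phi> VP] by simp_all
    have ne: "u \<noteq> v" "v \<noteq> w" "u \<noteq> w" using arcs pair_graph_irrefl[OF pair_graph_graph] by blast+
    have "u \<in> {VR i 0, VR i (len i), VP}" "v \<in> {VR i 0, VR i (len i), VP}" "w \<in> {VR i 0, VR i (len i), VP}"
      using i(2) by blast+
    then show ?thesis using ne \<rho> \<rho>' v0 v1 v2 by (auto simp: volt_ring)
  qed
qed (rule \<delta>)

lemma infinite_derived_ball:
  assumes x: "x \<in> Gs" and inf: "infinite (range (\<lambda>n. (app (\<phi> x) ^^ n) \<omega>))"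
  shows "infinite (\<Union>n. derived_ball graph (\<lambda>u v. app (volt \<phi> u v)) (VP, \<omega>) n)"
proof -
  let ?B = "derived_ball graph (\<lambda>u v. app (volt \<phi> u v)) (VP, \<omega>)"
  note c = core_edge.intros(1,2) core_edge.intros(3,4)[OF x]
  have core: "VP \<in> core" "VQ \<in> core" "VE \<in> core" "VG x \<in> core" using x by (auto simp: core_def)
  have step: "(v, app (volt \<phi> u v) a) \<in> ?B (Suc n)" if "(u, a) \<in> ?B n" "(u, v) \<in> parcs graph" for u v a n
    using that by auto
  have "(VP, (app (\<phi> x) ^^ n) \<omega>) \<in> ?B (4 * n)" for n
  proof (induction n)
    case (Suc n)
    let ?a = "(app (\<phi> x) ^^ n) \<omega>"
    have 1: "(VG x, ?a) \<in> ?B (Suc (4 * n))" using step[OF Suc arcI(1)[OF c(3)]] core by (simp add: volt_core del: derived_ball.simps)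
    have 2: "(VQ, app (\<phi> x) ?a) \<in> ?B (Suc (Suc (4 * n)))" using step[OF 1 arcI(1)[OF c(4)]] core by (simp add: volt_core del: derived_ball.simps)
    have 3: "(VE, app (\<phi> x) ?a) \<in> ?B (Suc (Suc (Suc (4 * n))))" using step[OF 2 arcI(2)[OF c(2)]] core by (simp add: volt_core del: derived_ball.simps)
    have four: "4 * Suc n = Suc (Suc (Suc (Suc (4 * n))))" by simp
    show ?case unfolding four using step[OF 3 arcI(2)[OF c(1)]] core by (simp add: volt_core del: derived_ball.simps)
  qed simp
  then have "range (\<lambda>n. (app (\<phi> x) ^^ n) \<omega>) \<subseteq> snd ` (\<Union>n. ?B n)" by force
  then show ?thesis using inf finite_surj by blast
qed

text \<open>Each relator contributes one cone vertex and a ring of \<open>4 * length w + 1\<close>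
  vertices.\<close>

lemma card_graph: "card (pverts graph) \<le> 3 + card Gs + (\<Sum>w\<leftarrow>Rs. 4 * length w + 2)"
proof -
  have "card core \<le> 3 + card Gs"
  proof -
    have "card core \<le> card {VP, VQ, VE :: 'g vert} + card (VG ` Gs)" unfolding core_def by (rule card_Un_le)
    also have "\<dots> \<le> 3 + card Gs" using card_image_le[OF finite_Gs, of VG] by simp
    finally show ?thesis .
  qed
  moreover have "card (VC ` {..<length Rs} :: 'g vert set) \<le> length Rs"
    using card_image_le[of "{..<length Rs}" VC] by simp
  moreover have "card (\<Union>i<length Rs. VR i ` {..len i} :: 'g vert set) \<le> (\<Sum>i<length Rs. Suc (len i))"
  proof -
    have "card (\<Union>i<length Rs. VR i ` {..len i} :: 'g vert set) \<le> (\<Sum>i<length Rs. card (VR i ` {..len i} :: 'g vert set))"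
      by (rule card_UN_le) simp
    also have "\<dots> \<le> (\<Sum>i<length Rs. Suc (len i))"
      by (rule sum_mono) (metis card_atMost card_image_le finite_atMost)
    finally show ?thesis .
  qed
  moreover have "card (pverts graph) \<le> card core + card (VC ` {..<length Rs} :: 'g vert set)
      + card (\<Union>i<length Rs. VR i ` {..len i} :: 'g vert set)"
    unfolding graph_def pair_pre_digraph.simps
    by (meson add_le_mono1 card_Un_le le_trans)
  moreover have "(\<Sum>w\<leftarrow>Rs. 4 * length w + 2) = length Rs + (\<Sum>i<length Rs. Suc (len i))"
    by (simp add: sum_list_sum_nth sum_Suc atLeast0LessThan)
  ultimately show ?thesis by linarith
qed

end

section \<open>Residue class rewriting and its group\<close>

text \<open>With states added, these are rules of the kind that define generalised Collatz
  functions.\<close>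

datatype rule = Rule (src: nat) (md: nat) (res: nat) (tgt: nat) (mul: nat) (off: nat)

inductive nstep :: "rule list \<Rightarrow> nat \<times> nat \<Rightarrow> nat \<times> nat \<Rightarrow> bool" for rs where
  "i < length rs \<Longrightarrow> r = rs ! i \<Longrightarrow> nstep rs (src r, md r * k + res r) (tgt r, mul r * k + off r)"

text \<open>\<open>Zed\<close> is the commutator that vanishes when the machine halts. The involutions \<open>V1 g\<close>, \<open>Sig1\<close>, \<open>V2 g\<close>,
  \<open>Sig2\<close> have product \<open>g\<close>, and each involution \<open>u\<close> is linked to \<open>Tau\<close> via \<open>Aux u\<close>: if two involutions have a
  product of order three and one of them is trivial, then so is the other.\<close>

datatype sgen = GX | GK | GT nat | GR nat
datatype igen = Sig1 | Sig2 | Zed | V1 sgen | V2 sgen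
datatype gen = Str sgen | Inv igen | Aux igen | Tau

instance sgen :: countable by countable_datatype
instance igen :: countable by countable_datatype
instance gen :: countable by countable_datatype

abbreviation pos :: "'a \<Rightarrow> 'a \<times> bool" where "pos g \<equiv> (g, True)"
abbreviation neg :: "'a \<Rightarrow> 'a \<times> bool" where "neg g \<equiv> (g, False)"

definition xw :: "nat \<Rightarrow> sgen word" where "xw n = replicate n (pos GX)"
definition tw :: "nat \<Rightarrow> nat \<Rightarrow> sgen word" where "tw q n = winv (xw n) @ [pos (GT q)] @ xw n"

definition sgens :: "rule list \<Rightarrow> nat \<Rightarrow> sgen list" where
  "sgens rs nq = [GX, GK] @ map GT [0..<nq] @ map GR [0..<length rs]"

definition igens :: "rule list \<Rightarrow> nat \<Rightarrow> igen list" where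
  "igens rs nq = [Sig1, Sig2, Zed] @ map V1 (sgens rs nq) @ map V2 (sgens rs nq)"

definition gens :: "rule list \<Rightarrow> nat \<Rightarrow> gen set" where
  "gens rs nq = Str ` set (sgens rs nq) \<union> Inv ` set (igens rs nq) \<union> Aux ` set (igens rs nq) \<union> {Tau}"

definition rule_rels :: "rule list \<Rightarrow> nat \<Rightarrow> sgen word list" where
  "rule_rels rs i = (let r = rs ! i in
     [neg (GR i) # xw (md r) @ pos (GR i) # winv (xw (mul r)),
      neg (GR i) # tw (src r) (res r) @ pos (GR i) # winv (tw (tgt r) (off r)),
      [pos GK, pos (GR i), neg GK, neg (GR i)]])"

definition final_rel :: "nat \<Rightarrow> sgen word" where
  "final_rel qh = pos GK # tw qh 1 @ neg GK # winv (tw qh 1)"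

definition struct_rels :: "rule list \<Rightarrow> nat \<Rightarrow> sgen word list" where
  "struct_rels rs qh = final_rel qh # concat (map (rule_rels rs) [0..<length rs])"

definition comm_word :: "nat \<Rightarrow> nat \<Rightarrow> sgen word" where
  "comm_word q n = winv (tw q n) @ neg GK # tw q n @ [pos GK]"

definition str_word :: "sgen word \<Rightarrow> gen word" where "str_word = map (map_prod Str id)"

definition kill_rel :: "sgen \<Rightarrow> gen word" where
  "kill_rel g = [neg (Str g), pos (Inv (V1 g)), pos (Inv Sig1), pos (Inv (V2 g)), pos (Inv Sig2)]"

text \<open>Two involutions whose product has trivial cube are conjugate, so triviality passes both
  ways. \<open>Aux u\<close> is put between \<open>u\<close> and \<open>Tau\<close> since a single
  permutation for \<open>Tau\<close> has to suit all \<open>u\<close> at once: it is confined to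
  fresh points, to which each \<open>Aux u\<close> connects the points moved by
  \<open>u\<close>.\<close>

definition link_rels :: "igen \<Rightarrow> gen word list" where
  "link_rels u = [[pos (Inv u), pos (Inv u)], [pos (Aux u), pos (Aux u)],
     [pos (Inv u), pos (Aux u), pos (Inv u), pos (Aux u), pos (Inv u), pos (Aux u)],
     [pos (Aux u), pos Tau, pos (Aux u), pos Tau, pos (Aux u), pos Tau]]"

definition zed_rel :: "nat \<Rightarrow> nat \<Rightarrow> gen word" where
  "zed_rel q n = neg (Inv Zed) # str_word (comm_word q n)"

definition rels :: "rule list \<Rightarrow> nat \<Rightarrow> nat \<Rightarrow> nat \<Rightarrow> nat \<Rightarrow> gen word list" where
  "rels rs nq qh q0 n0 = zed_rel q0 n0 # [pos Tau, pos Tau] # map kill_rel (sgens rs nq) @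
     concat (map link_rels (igens rs nq)) @ map str_word (struct_rels rs qh)"

section \<open>Consequences of the relators in any group\<close>

lemma weval_str_word: "weval \<phi> (str_word w) = weval (\<phi> \<circ> Str) w"
  by (induction w) (auto simp: str_word_def)

definition nmul :: "nat \<Rightarrow> 'a::group_add \<Rightarrow> 'a" where "nmul n x = sum_list (replicate n x)"

lemma nmul_simps [simp]: "nmul 0 x = 0" "nmul (Suc n) x = x + nmul n x"
  by (simp_all add: nmul_def)

lemma nmul_add: "nmul (m + n) x = nmul m x + nmul n x"
  by (induction m) (simp_all add: add.assoc)

lemma nmul_mult: "nmul (m * n) x = nmul n (nmul m x)"
  by (induction n) (simp_all add: nmul_add)

lemma nmul_conj: "nmul n (- r + x + r) = - r + nmul n x + r" for r :: "'a::group_add"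
  by (induction n) (simp_all add: add.assoc)

lemma weval_xw: "weval \<phi> (xw n) = nmul n (\<phi> GX)"
  by (induction n) (simp_all add: xw_def)

lemma weval_tw: "weval \<phi> (tw q n) = - nmul n (\<phi> GX) + \<phi> (GT q) + nmul n (\<phi> GX)"
  by (simp add: tw_def weval_xw add.assoc)

text \<open>Two relators per rule cover all \<open>k\<close> for this reason: the configurations of
  a residue class are conjugates of a single one by multiples of
  \<open>nmul m (\<phi> GX)\<close>.\<close>

lemma tw_affine:
  "weval \<phi> (tw q (m * k + a)) = - nmul k (nmul m (\<phi> GX)) + weval \<phi> (tw q a) + nmul k (nmul m (\<phi> GX))"
  by (simp add: weval_tw add.commute[of "m * k" a] nmul_add nmul_mult add.assoc minus_add diff_conv_add_uminus del: add_uminus_conv_diff)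

lemma conj_eq: "- r + a + r = b \<longleftrightarrow> a = r + b - r" for r :: "'a::group_add"
proof
  assume "- r + a + r = b"
  then have "r + b - r = r + (- r + a + r) - r" by simp
  then show "a = r + b - r" by (simp add: add.assoc minus_add diff_conv_add_uminus del: add_uminus_conv_diff)
qed (simp add: add.assoc minus_add diff_conv_add_uminus del: add_uminus_conv_diff)

context
  fixes \<phi> :: "sgen \<Rightarrow> 'a::group_add" and rs :: "rule list" and qh :: nat
  assumes rels: "\<And>w. w \<in> set (struct_rels rs qh) \<Longrightarrow> weval \<phi> w = 0"
begin

lemma rule_rel:
  assumes i: "i < length rs" and r: "r = rs ! i"
  shows "- \<phi> (GR i) + nmul (md r) (\<phi> GX) + \<phi> (GR i) = nmul (mul r) (\<phi> GX)"
    and "- \<phi> (GR i) + weval \<phi> (tw (src r) (res r)) + \<phi> (GR i) = weval \<phi> (tw (tgt r) (off r))"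
    and "\<phi> GK + \<phi> (GR i) = \<phi> (GR i) + \<phi> GK"
proof -
  have "weval \<phi> w = 0" if "w \<in> set (rule_rels rs i)" for w
    using that i by (intro rels) (auto simp: struct_rels_def)
  then have "weval \<phi> (neg (GR i) # xw (md r) @ pos (GR i) # winv (xw (mul r))) = 0"
    "weval \<phi> (neg (GR i) # tw (src r) (res r) @ pos (GR i) # winv (tw (tgt r) (off r))) = 0"
    "weval \<phi> [pos GK, pos (GR i), neg GK, neg (GR i)] = 0"
    unfolding rule_rels_def Let_def r by (meson list.set_intros)+
  then have "(- \<phi> (GR i) + nmul (md r) (\<phi> GX) + \<phi> (GR i)) - nmul (mul r) (\<phi> GX) = 0"
    "(- \<phi> (GR i) + weval \<phi> (tw (src r) (res r)) + \<phi> (GR i)) - weval \<phi> (tw (tgt r) (off r)) = 0"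
    "(\<phi> GK + \<phi> (GR i)) - (\<phi> (GR i) + \<phi> GK) = 0"
    by (simp_all add: weval_xw add.assoc diff_conv_add_uminus minus_add del: add_uminus_conv_diff)
  then show "- \<phi> (GR i) + nmul (md r) (\<phi> GX) + \<phi> (GR i) = nmul (mul r) (\<phi> GX)"
    "- \<phi> (GR i) + weval \<phi> (tw (src r) (res r)) + \<phi> (GR i) = weval \<phi> (tw (tgt r) (off r))"
    "\<phi> GK + \<phi> (GR i) = \<phi> (GR i) + \<phi> GK"
    by (simp_all only: right_minus_eq)
qed

lemma tw_step:
  assumes i: "i < length rs" and r: "r = rs ! i"
  shows "- \<phi> (GR i) + weval \<phi> (tw (src r) (md r * k + res r)) + \<phi> (GR i) = weval \<phi> (tw (tgt r) (mul r * k + off r))"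
proof -
  let ?R = "\<phi> (GR i)" and ?x = "nmul (md r) (\<phi> GX)" and ?t = "weval \<phi> (tw (src r) (res r))"
  have "- ?R + weval \<phi> (tw (src r) (md r * k + res r)) + ?R
      = - (- ?R + nmul k ?x + ?R) + (- ?R + ?t + ?R) + (- ?R + nmul k ?x + ?R)"
    by (simp add: tw_affine add.assoc minus_add diff_conv_add_uminus del: add_uminus_conv_diff)
  also have "\<dots> = weval \<phi> (tw (tgt r) (mul r * k + off r))"
    unfolding nmul_conj[where n = k and r = ?R and x = ?x, symmetric] rule_rel(1,2)[OF i r] tw_affine ..
  finally show ?thesis .
qed

lemma trajectory_commutes:
  assumes "(nstep rs)\<^sup>*\<^sup>* c (qh, 1)"
  shows "\<phi> GK + weval \<phi> (tw (fst c) (snd c)) = weval \<phi> (tw (fst c) (snd c)) + \<phi> GK"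
  using assms
proof (induction rule: converse_rtranclp_induct)
  case base
  have "weval \<phi> (final_rel qh) = 0" by (rule rels) (simp add: struct_rels_def)
  then have "(\<phi> GK + weval \<phi> (tw qh 1)) - (weval \<phi> (tw qh 1) + \<phi> GK) = 0"
    unfolding final_rel_def weval_simps weval_winv
    by (simp add: add.assoc diff_conv_add_uminus minus_add del: add_uminus_conv_diff One_nat_def)
  then show ?case by simp
next
  case (step c d)
  from step(1) show ?case
  proof cases
    case (1 i r k)
    let ?R = "\<phi> (GR i)" and ?K = "\<phi> GK" and ?d = "weval \<phi> (tw (fst d) (snd d))"
    have c: "weval \<phi> (tw (fst c) (snd c)) = ?R + ?d - ?R"
      using tw_step[OF 1(3,4), of k] 1 unfolding conj_eq by simp
    have KR: "?K + ?R = ?R + ?K" using rule_rel(3)[OF 1(3,4)] .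
    then have RK: "?K - ?R = - ?R + ?K" 
    proof -
      have "- ?R + (?K + ?R) + - ?R = - ?R + (?R + ?K) + - ?R" using KR by simp
      then show ?thesis by (simp add: add.assoc minus_add diff_conv_add_uminus del: add_uminus_conv_diff)
    qed
    have "?K + (?R + ?d - ?R) = ?R + (?K + ?d) - ?R" using KR by (simp add: add_diff_eq add.assoc[symmetric])
    also have "\<dots> = ?R + ?d + (?K - ?R)" using step(3) by (simp add: add.assoc add_diff_eq)
    also have "\<dots> = (?R + ?d - ?R) + ?K" unfolding RK by (simp add: add.assoc minus_add diff_conv_add_uminus del: add_uminus_conv_diff)
    finally show ?thesis using c by simp
  qed
qed

end

text \<open>The halting run makes \<open>Zed\<close> trivial, and the links spread this to
  \<open>Aux Zed\<close>, \<open>Tau\<close>, every \<open>Aux u\<close> and every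
  \<open>Inv u\<close>; finally \<open>kill_rel\<close> writes each \<open>Str g\<close> as a
  product of trivial involutions.\<close>

lemma rels_trivial:
  fixes \<phi> :: "gen \<Rightarrow> 'a::group_add"
  assumes rel: "\<And>w. w \<in> set (rels rs nq qh q0 n0) \<Longrightarrow> weval \<phi> w = 0"
    and run: "(nstep rs)\<^sup>*\<^sup>* (q0, n0) (qh, 1)" and g: "g \<in> gens rs nq"
  shows "\<phi> g = 0"
proof -
  let ?K = "\<phi> (Str GK)" and ?T = "weval (\<phi> \<circ> Str) (tw q0 n0)"
  have str: "weval (\<phi> \<circ> Str) w = 0" if "w \<in> set (struct_rels rs qh)" for w
    using rel[of "str_word w"] that by (simp add: rels_def weval_str_word)
  have KT: "?K + ?T = ?T + ?K" using trajectory_commutes[of rs qh "\<phi> \<circ> Str", OF str run] by simp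
  have "weval \<phi> (zed_rel q0 n0) = 0" by (rule rel) (simp add: rels_def)
  then have "- \<phi> (Inv Zed) + (- (?K + ?T) + (?T + ?K)) = 0"
    by (simp add: zed_rel_def weval_str_word comm_word_def add.assoc minus_add diff_conv_add_uminus del: add_uminus_conv_diff)
  then have zed: "\<phi> (Inv Zed) = 0" unfolding KT by simp
  have link: "weval \<phi> w = 0" if "w \<in> set (link_rels u)" "u \<in> set (igens rs nq)" for w u
    using rel[of w] that by (auto simp: rels_def)
  have cube: "b = 0" if "a = 0" "b + b = 0" "a + (b + (a + (b + (a + b)))) = 0" for a b :: 'a
    using that by (simp add: add.assoc[symmetric])
  have cube': "a = 0" if "b = 0" "a + a = 0" "a + (b + (a + (b + (a + b)))) = 0" for a b :: 'a
    using that by (simp add: add.assoc[symmetric])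
  have sq: "\<phi> (Inv u) + \<phi> (Inv u) = 0" "\<phi> (Aux u) + \<phi> (Aux u) = 0"
    and c1: "\<phi> (Inv u) + (\<phi> (Aux u) + (\<phi> (Inv u) + (\<phi> (Aux u) + (\<phi> (Inv u) + \<phi> (Aux u))))) = 0"
    and c2: "\<phi> (Aux u) + (\<phi> Tau + (\<phi> (Aux u) + (\<phi> Tau + (\<phi> (Aux u) + \<phi> Tau)))) = 0"
    if "u \<in> set (igens rs nq)" for u
  proof -
    have "\<forall>w\<in>set (link_rels u). weval \<phi> w = 0" using link that by blast
    then show "\<phi> (Inv u) + \<phi> (Inv u) = 0" "\<phi> (Aux u) + \<phi> (Aux u) = 0"
      "\<phi> (Inv u) + (\<phi> (Aux u) + (\<phi> (Inv u) + (\<phi> (Aux u) + (\<phi> (Inv u) + \<phi> (Aux u))))) = 0"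
      "\<phi> (Aux u) + (\<phi> Tau + (\<phi> (Aux u) + (\<phi> Tau + (\<phi> (Aux u) + \<phi> Tau)))) = 0"
      by (simp_all add: link_rels_def)
  qed
  have Zed: "Zed \<in> set (igens rs nq)" by (simp add: igens_def)
  have tt: "\<phi> Tau + \<phi> Tau = 0" using rel[of "[pos Tau, pos Tau]"] by (simp add: rels_def)
  have "\<phi> (Aux Zed) = 0" using cube[OF zed sq(2)[OF Zed] c1[OF Zed]] .
  then have tau: "\<phi> Tau = 0" using cube[OF _ tt c2[OF Zed]] by blast
  have aux: "\<phi> (Aux u) = 0" if "u \<in> set (igens rs nq)" for u
    using cube'[OF tau sq(2)[OF that] c2[OF that]] .
  have inv: "\<phi> (Inv u) = 0" if "u \<in> set (igens rs nq)" for u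
    using cube'[OF aux[OF that] sq(1)[OF that] c1[OF that]] .
  have str: "\<phi> (Str g) = 0" if "g \<in> set (sgens rs nq)" for g
  proof -
    have "weval \<phi> (kill_rel g) = 0" using that by (intro rel) (simp add: rels_def)
    moreover have "\<phi> (Inv (V1 g)) = 0" "\<phi> (Inv (V2 g)) = 0" "\<phi> (Inv Sig1) = 0" "\<phi> (Inv Sig2) = 0"
      using that by (auto intro!: inv simp: igens_def)
    ultimately show ?thesis by (simp add: kill_rel_def)
  qed
  show ?thesis using g tau aux inv str by (auto simp: gens_def)
qed

lemma finite_gens: "finite (gens rs nq)" by (simp add: gens_def)

lemma fst_set_tw: "fst ` set (tw q n) \<subseteq> {GX, GT q}" "fst ` set (winv (tw q n)) \<subseteq> {GX, GT q}"
  "fst ` set (xw n) \<subseteq> {GX}" "fst ` set (winv (xw n)) \<subseteq> {GX}"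
  by (auto simp: tw_def xw_def winv_def)

lemma rels_wf:
  assumes "\<And>r. r \<in> set rs \<Longrightarrow> src r < nq \<and> tgt r < nq" "q0 < nq" "qh < nq"
    and w: "w \<in> set (rels rs nq qh q0 n0)"
  shows "w \<noteq> [] \<and> fst ` set w \<subseteq> gens rs nq"
proof -
  have G: "GX \<in> set (sgens rs nq)" "GK \<in> set (sgens rs nq)"
    "q < nq \<Longrightarrow> GT q \<in> set (sgens rs nq)" "i < length rs \<Longrightarrow> GR i \<in> set (sgens rs nq)" for q i
    by (auto simp: sgens_def)
  have t: "fst ` set (tw q n) \<subseteq> set (sgens rs nq)" "fst ` set (winv (tw q n)) \<subseteq> set (sgens rs nq)" if "q < nq" for q n
  proof -
    have sub: "{GX, GT q} \<subseteq> set (sgens rs nq)" using G(1,3) that by simp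
    show "fst ` set (tw q n) \<subseteq> set (sgens rs nq)" "fst ` set (winv (tw q n)) \<subseteq> set (sgens rs nq)"
      using order_trans[OF fst_set_tw(1) sub] order_trans[OF fst_set_tw(2) sub] .
  qed
  have x: "fst ` set (xw n) \<subseteq> set (sgens rs nq)" "fst ` set (winv (xw n)) \<subseteq> set (sgens rs nq)" for n
  proof -
    have sub: "{GX} \<subseteq> set (sgens rs nq)" using G(1) by simp
    show "fst ` set (xw n) \<subseteq> set (sgens rs nq)" "fst ` set (winv (xw n)) \<subseteq> set (sgens rs nq)"
      using order_trans[OF fst_set_tw(3) sub] order_trans[OF fst_set_tw(4) sub] .
  qed
  have "v \<noteq> [] \<and> fst ` set v \<subseteq> set (sgens rs nq)" if v: "v \<in> set (struct_rels rs qh)" for v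
  proof -
    consider "v = final_rel qh" | i where "i < length rs" "v \<in> set (rule_rels rs i)"
      using v by (auto simp: struct_rels_def)
    then show ?thesis
    proof cases
      case 1 then show ?thesis using t[OF assms(3), of 1] G by (simp add: final_rel_def image_Un)
    next
      case 2
      then have "src (rs ! i) < nq" "tgt (rs ! i) < nq" using assms(1) by simp_all
      note tt = t[OF this(1)] t[OF this(2)]
      have "v = neg (GR i) # xw (md (rs ! i)) @ pos (GR i) # winv (xw (mul (rs ! i))) \<or>
          v = neg (GR i) # tw (src (rs ! i)) (res (rs ! i)) @ pos (GR i) # winv (tw (tgt (rs ! i)) (off (rs ! i))) \<or>
          v = [pos GK, pos (GR i), neg GK, neg (GR i)]"
        using 2(2) by (simp add: rule_rels_def Let_def)
      then show ?thesis using tt x G(2) G(4)[OF 2(1)] by (elim disjE) (simp_all add: image_Un)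
    qed
  qed
  moreover have "fst ` set (comm_word q0 n0) \<subseteq> set (sgens rs nq)"
    using t[OF assms(2), of n0] G by (simp add: comm_word_def image_Un)
  moreover have "fst ` set (str_word v) = Str ` fst ` set v" "str_word v = [] \<longleftrightarrow> v = []" for v
    by (simp_all add: str_word_def image_image)
  ultimately have str: "\<forall>v\<in>set (struct_rels rs qh). v \<noteq> [] \<and> fst ` set (str_word v) \<subseteq> gens rs nq"
    and zed: "fst ` set (str_word (comm_word q0 n0)) \<subseteq> gens rs nq"
    by (auto simp: gens_def)
  consider "w = zed_rel q0 n0" | "w = [pos Tau, pos Tau]" | g where "g \<in> set (sgens rs nq)" "w = kill_rel g"
    | u where "u \<in> set (igens rs nq)" "w \<in> set (link_rels u)" | v where "v \<in> set (struct_rels rs qh)" "w = str_word v"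
    using w by (auto simp: rels_def)
  then show ?thesis
  proof cases
    case 1
    then show ?thesis using zed by (simp add: zed_rel_def) (simp add: gens_def igens_def)
  next
    case 5
    then show ?thesis using str by (simp add: str_word_def)
  qed (auto simp: gens_def kill_rel_def link_rels_def igens_def)
qed

text \<open>Only \<open>zed_rel\<close> depends on \<open>n0\<close>. It contains four blocks of
  \<open>n0\<close> letters, and a letter takes four edges, whence \<open>16 * n0\<close>; the
  constant \<open>22\<close> is \<open>4 * 5 + 2\<close>.\<close>

lemma rels_size:
  "\<exists>\<alpha>. \<forall>n0. (\<Sum>w\<leftarrow>rels rs nq qh q0 n0. 4 * length w + 2) = \<alpha> + 16 * n0"
proof -
  have "length (zed_rel q0 n0) = 4 * n0 + 5" for n0
    by (simp add: zed_rel_def str_word_def comm_word_def winv_def tw_def xw_def)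
  then have "(\<Sum>w\<leftarrow>rels rs nq qh q0 n0. 4 * length w + 2) =
      (22 + (\<Sum>w\<leftarrow>tl (rels rs nq qh q0 0). 4 * length w + 2)) + 16 * n0" for n0
    by (simp add: rels_def)
  then show ?thesis by blast
qed

section \<open>Permutations that satisfy all relators away from a defect\<close>

text \<open>Fibres over the same value are either both empty or both countably infinite, so they can
  be matched one by one. Rule maps use this with patterns as values, links with heights.\<close>

lemma ex_fibre_bij:
  fixes A :: "'a::countable set" and B :: "'b::countable set"
  assumes inf: "\<And>p. p \<in> f ` A \<union> g ` B \<Longrightarrow> infinite {a \<in> A. f a = p} \<and> infinite {b \<in> B. g b = p}"
  shows "\<exists>\<beta>. bij_betw \<beta> A B \<and> (\<forall>a\<in>A. g (\<beta> a) = f a)"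
proof -
  have "\<exists>F. bij_betw F {a \<in> A. f a = p} {b \<in> B. g b = p}" for p
  proof (cases "p \<in> f ` A \<union> g ` B")
    case True
    note inf = inf[OF this]
    have "bij_betw (to_nat_on {a \<in> A. f a = p}) {a \<in> A. f a = p} UNIV"
      using inf by (intro to_nat_on_infinite) auto
    moreover have "bij_betw (from_nat_into {b \<in> B. g b = p}) UNIV {b \<in> B. g b = p}"
      using inf by (intro bij_betw_from_nat_into) auto
    ultimately have "bij_betw (from_nat_into {b \<in> B. g b = p} \<circ> to_nat_on {a \<in> A. f a = p})
        {a \<in> A. f a = p} {b \<in> B. g b = p}" by (rule bij_betw_trans)
    then show ?thesis by (rule exI[where P = "\<lambda>F. bij_betw F {a \<in> A. f a = p} {b \<in> B. g b = p}"])
  next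
    case False
    then have e: "{a \<in> A. f a = p} = {}" "{b \<in> B. g b = p} = {}" by auto
    show ?thesis unfolding e by (simp add: bij_betw_def)
  qed
  then obtain F where F: "\<And>p. bij_betw (F p) {a \<in> A. f a = p} {b \<in> B. g b = p}" by metis
  have img: "F p ` {a \<in> A. f a = p} = {b \<in> B. g b = p}" for p
    using F[of p] by (simp add: bij_betw_def)
  have in_B: "F (f a) a \<in> B \<and> g (F (f a) a) = f a" if "a \<in> A" for a
    using img[of "f a"] that by blast
  have "bij_betw (\<lambda>a. F (f a) a) A B"
    unfolding bij_betw_def
  proof (intro conjI inj_onI set_eqI iffI)
    fix x y assume xy: "x \<in> A" "y \<in> A" "F (f x) x = F (f y) y"
    then have "f x = f y" using in_B by metis
    then show "x = y" using F[of "f x"] xy by (auto simp: bij_betw_def inj_on_def)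
  next
    fix z assume "z \<in> B"
    then have "z \<in> F (g z) ` {a \<in> A. f a = g z}" using img[of "g z"] by simp
    then obtain a where "a \<in> A" "f a = g z" "z = F (g z) a" by blast
    then show "z \<in> (\<lambda>a. F (f a) a) ` A" by (intro image_eqI[of _ _ a]) simp_all
  qed (use in_B in auto)
  then show ?thesis using in_B by blast
qed

datatype lev = LB nat | LR nat nat lev | LI nat lev | LC nat lev

instance lev :: countable by countable_datatype

text \<open>Level, integer and two bits. \<open>GT\<close> flips the first bit only where the second
  is off, and \<open>GK\<close> flips the second: this is what makes their commutator
  visible.\<close>

type_synonym site = "lev \<times> int \<times> bool \<times> bool"

text \<open>A point \<open>Sh y c v s\<close> lies over the site \<open>y\<close> in the sheet \<open>s\<close> of the copy \<open>(c, v)\<close>; in a copy with small \<open>v\<close>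
  all points count as close to a defect. The points \<open>Sp b c v\<close> are moved by \<open>Tau\<close> and the \<open>Aux u\<close> only.\<close>

datatype om = Sh site nat nat nat | Sp bool nat nat

instance om :: countable by countable_datatype

text \<open>The rules on all integers, since the shift \<open>GX\<close> has to be a bijection and a
  rule must move a residue class as a whole.\<close>

inductive zstep :: "rule list \<Rightarrow> nat \<times> int \<Rightarrow> nat \<times> int \<Rightarrow> bool" for rs where
  "i < length rs \<Longrightarrow> r = rs ! i \<Longrightarrow>
    zstep rs (src r, int (md r) * k + int (res r)) (tgt r, int (mul r) * k + int (off r))"

section \<open>Affine maps between residue classes\<close>

definition blocks :: "nat \<Rightarrow> (lev \<times> nat) set" where "blocks m = {(l, j). j < m}"

text \<open>A bijection \<open>\<beta>\<close> of residue classes is extended affinely to their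
  elements. Shifting the argument by \<open>m\<close> then shifts the value by \<open>m'\<close> on
  every level, as the first relator of a rule demands.\<close>

definition block_map :: "nat \<Rightarrow> nat \<Rightarrow> (lev \<times> nat \<Rightarrow> lev \<times> nat) \<Rightarrow> lev \<times> int \<Rightarrow> lev \<times> int" where
  "block_map m m' \<beta> x = (case \<beta> (fst x, nat (snd x mod int m)) of (l, j) \<Rightarrow> (l, int m' * (snd x div int m) + int j))"

lemma block_map_affine:
  assumes "j < m" "\<beta> (l, j) = (l', j')"
  shows "block_map m m' \<beta> (l, int m * k + int j) = (l', int m' * k + int j')"
  using assms by (simp add: block_map_def)

lemma block_cases:
  assumes "0 < m" obtains k j where "j < m" "n = int m * k + int j"
proof
  show "nat (n mod int m) < m" using assms by (simp add: nat_less_iff)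
  show "n = int m * (n div int m) + int (nat (n mod int m))" using assms by simp
qed

lemma block_map_inverse:
  assumes "0 < m" and \<beta>: "\<And>x. x \<in> blocks m \<Longrightarrow> \<beta> x \<in> blocks m' \<and> \<beta>' (\<beta> x) = x"
  shows "block_map m' m \<beta>' (block_map m m' \<beta> x) = x"
proof -
  obtain l n where x: "x = (l, n)" by (cases x)
  obtain k j where j: "j < m" "n = int m * k + int j" using block_cases[OF assms(1)] by blast
  obtain l' j' where \<beta>lj: "\<beta> (l, j) = (l', j')" by (cases "\<beta> (l, j)")
  have *: "j' < m'" "\<beta>' (l', j') = (l, j)" using \<beta>[of "(l, j)"] j \<beta>lj by (auto simp: blocks_def)
  show ?thesis
    unfolding x j(2) block_map_affine[where \<beta> = \<beta> and k = k, OF j(1) \<beta>lj] block_map_affine[where \<beta> = \<beta>' and k = k, OF *] ..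
qed

lemma block_map_bound:
  assumes "0 < m" "\<beta> ` blocks m \<subseteq> blocks m'" "m' \<le> C"
  shows "\<bar>snd (block_map m m' \<beta> x)\<bar> + 1 \<le> int C * (\<bar>snd x\<bar> + 1)"
proof -
  obtain l n where x: "x = (l, n)" by (cases x)
  obtain k j where j: "j < m" "n = int m * k + int j" using block_cases[OF assms(1)] by blast
  obtain l' j' where \<beta>lj: "\<beta> (l, j) = (l', j')" by (cases "\<beta> (l, j)")
  have j': "j' < m'" using assms(2) j(1) \<beta>lj imageI[of "(l, j)" "blocks m" \<beta>] by (auto simp: blocks_def)
  have k: "\<bar>k\<bar> \<le> \<bar>n\<bar>"
  proof (cases "0 \<le> k")
    case True
    then have "1 * k \<le> int m * k" using assms(1) by (intro mult_right_mono) auto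
    then show ?thesis using True j by linarith
  next
    case False
    have "int m * (- k - 1) \<ge> 1 * (- k - 1)" using False assms(1) by (intro mult_right_mono) auto
    then have "- k - 1 \<le> - n - int (m - j)" using j by (simp add: algebra_simps of_nat_diff)
    then show ?thesis using False j(1) by linarith
  qed
  have "\<bar>int m' * k + int j'\<bar> + 1 \<le> int m' * \<bar>k\<bar> + int j' + 1" by (simp add: abs_mult order_trans[OF abs_triangle_ineq])
  also have "\<dots> \<le> int m' * \<bar>n\<bar> + int m'" 
    using mult_left_mono[OF k, of "int m'"] j' by linarith
  also have "\<dots> = int m' * (\<bar>n\<bar> + 1)" by (simp add: algebra_simps)
  also have "\<dots> \<le> int C * (\<bar>n\<bar> + 1)" using assms(3) by (intro mult_right_mono) auto
  finally show ?thesis unfolding x j(2) block_map_affine[where \<beta> = \<beta> and k = k, OF j(1) \<beta>lj] by simp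
qed

section \<open>Sheets, telescoping products and linked involutions\<close>

fun emb_fun :: "site permut \<Rightarrow> om \<Rightarrow> om" where
  "emb_fun p (Sh y c v s) = (if s = 0 then Sh (app p y) c v s else Sh y c v s)"
| "emb_fun p (Sp b c v) = Sp b c v"

definition emb :: "site permut \<Rightarrow> om permut" where "emb p = Permut (emb_fun p)"

lemma app_emb: "app (emb p) = emb_fun p"
proof -
  have "emb_fun (- p) (emb_fun p x) = x" "emb_fun p (emb_fun (- p) x) = x" for x by (cases x; simp)+
  then show ?thesis unfolding emb_def by (rule app_Permut)
qed

lemma emb_hom: "emb 0 = 0" "emb (p + q) = emb p + emb q" "emb (- p) = - emb p"
proof -
  have "emb_fun 0 x = x" for x by (cases x) simp_all
  then show 0: "emb 0 = 0" by (intro permut_eqI) (simp add: app_emb)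
  have "emb_fun (p + q) x = emb_fun q (emb_fun p x)" for p q x by (cases x) simp_all
  then show plus: "emb (p + q) = emb p + emb q" for p q
    by (intro permut_eqI) (simp add: app_emb)
  show "emb (- p) = - emb p" using plus[of p "- p"] 0 by (metis minus_unique right_minus)
qed

text \<open>An Eilenberg swindle in involutions: \<open>swap_even p\<close> and then
  \<open>swap_even 0\<close> act by \<open>p\<close> on even sheets and by \<open>- p\<close> on odd
  ones, and the two odd swaps undo this on every sheet except \<open>0\<close>.\<close>

fun swap_even :: "site permut \<Rightarrow> om \<Rightarrow> om" where
  "swap_even p (Sh y c v s) = (if even s then Sh (app p y) c v (Suc s) else Sh (app (- p) y) c v (s - 1))"
| "swap_even p (Sp b c v) = Sp b c v"

fun swap_odd :: "site permut \<Rightarrow> om \<Rightarrow> om" where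
  "swap_odd p (Sh y c v s) = (if s = 0 then Sh y c v s
     else if odd s then Sh (app p y) c v (Suc s) else Sh (app (- p) y) c v (s - 1))"
| "swap_odd p (Sp b c v) = Sp b c v"

lemma swap_even_invol: "swap_even p (swap_even p x) = x"
proof (cases x)
  case (Sh y c v s) then show ?thesis by (cases s) auto
qed simp

lemma swap_odd_invol: "swap_odd p (swap_odd p x) = x"
proof (cases x)
  case (Sh y c v s) then show ?thesis by (cases s) auto
qed simp

text \<open>The sheets with positive index carry an infinite alternating product of copies of \<open>p\<close> and its
  inverse, which telescopes.\<close>

lemma swap_telescope: "swap_odd 0 (swap_odd p (swap_even 0 (swap_even p x))) = emb_fun p x"
proof (cases x)
  have neg0: "app (- 0) y = y" for y :: site by simp
  case (Sh y c v s) then show ?thesis by (cases s) (auto simp: neg0)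
qed simp

text \<open>For \<open>r\<close> in \<open>R\<close> the points \<open>f r\<close>,
  \<open>r\<close>, \<open>Sp False z\<close>, \<open>Sp True z\<close>, where \<open>z\<close> is
  \<open>\<beta> r\<close> split into its components, form a row in which \<open>f\<close>,
  \<open>aux_fun\<close> and \<open>tau_fun\<close> swap neighbours; products of adjacent
  transpositions have order three.\<close>

definition aux_fun :: "om set \<Rightarrow> (om \<Rightarrow> nat \<times> nat) \<Rightarrow> om \<Rightarrow> om" where
  "aux_fun R \<beta> x = (if x \<in> R then Sp False (fst (\<beta> x)) (snd (\<beta> x))
     else case x of Sp b c v \<Rightarrow> (if b then x else inv_into R \<beta> (c, v)) | _ \<Rightarrow> x)"

definition tau_fun :: "om \<Rightarrow> om" where
  "tau_fun x = (case x of Sp b c v \<Rightarrow> Sp (\<not> b) c v | _ \<Rightarrow> x)"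

text \<open>\<open>R\<close> is a transversal of the pairs exchanged by \<open>f\<close>.
  \<open>\<beta>\<close> is onto because \<open>tau_fun\<close> moves all points
  \<open>Sp b c v\<close>, and its cube relator with \<open>aux_fun\<close> must hold at each of
  them.\<close>

locale link =
  fixes f :: "om \<Rightarrow> om" and R :: "om set" and \<beta> :: "om \<Rightarrow> nat \<times> nat"
  assumes f_invol: "f (f x) = x" and f_Sp: "f (Sp b c v) = Sp b c v"
    and R_f: "x \<in> R \<Longrightarrow> f x \<notin> R" and f_R: "x \<notin> R \<Longrightarrow> f x = x \<or> f x \<in> R"
    and R_Sh: "Sp b c v \<notin> R" and \<beta>: "bij_betw \<beta> R UNIV"
begin

abbreviation "a \<equiv> aux_fun R \<beta>"

lemma inv_R: "inv_into R \<beta> z \<in> R" "\<beta> (inv_into R \<beta> z) = z"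
  using \<beta> by (auto simp: bij_betw_def inv_into_into f_inv_into_f)

lemma inv_\<beta>: "x \<in> R \<Longrightarrow> inv_into R \<beta> (\<beta> x) = x"
  using \<beta> by (auto simp: bij_betw_def)

lemma a_simps: "x \<in> R \<Longrightarrow> a x = Sp False (fst (\<beta> x)) (snd (\<beta> x))"
  "a (Sp True c v) = Sp True c v" "a (Sp False c v) = inv_into R \<beta> (c, v)"
  "Sh y c v s \<notin> R \<Longrightarrow> a (Sh y c v s) = Sh y c v s"
  using R_Sh by (auto simp: aux_fun_def)

lemma aux_invol: "a (a x) = x"
proof (cases "x \<in> R")
  case True then show ?thesis by (simp add: a_simps inv_\<beta>)
next
  case False
  then show ?thesis
  proof (cases x)
    case (Sp b c v) then show ?thesis using inv_R[of "(c, v)"] by (cases b) (simp_all add: a_simps)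
  qed (simp add: a_simps)
qed

lemma f_Sh: "\<exists>y c v s. f (Sh y' c' v' s') = Sh y c v s"
  using f_invol[of "Sh y' c' v' s'"] f_Sp by (cases "f (Sh y' c' v' s')") auto

lemma a_f: "x \<in> R \<Longrightarrow> a (f x) = f x"
proof -
  assume x: "x \<in> R"
  then obtain y c v s where "x = Sh y c v s" using R_Sh by (cases x) auto
  then show ?thesis using f_Sh[of y c v s] R_f[OF x] a_simps(4) by metis
qed

lemma cube_f_a: "a (f (a (f (a (f x))))) = x"
proof -
  have R: "a (f (a (f (a (f x))))) = x" if "x \<in> R" for x
    using that by (simp add: a_f f_invol a_simps f_Sp inv_\<beta>)
  show ?thesis
  proof (cases x)
    case (Sh y c v s)
    consider "x \<in> R" | "x \<notin> R" "f x = x" | "x \<notin> R" "f x \<in> R" using f_R by blast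
    then show ?thesis
    proof cases
      case 2 then show ?thesis using Sh by (simp add: a_simps)
    next
      case 3
      have "a (f x) = Sp False (fst (\<beta> (f x))) (snd (\<beta> (f x)))" using 3 by (simp add: a_simps)
      then have "a (f (a (f x))) = f x" using 3 by (simp add: f_Sp a_simps inv_\<beta>)
      moreover have "a x = x" using 3(1) Sh by (simp add: a_simps)
      ultimately show ?thesis by (simp add: f_invol)
    qed (rule R)
  next
    case (Sp b c v)
    show ?thesis
    proof (cases b)
      case False
      let ?r = "inv_into R \<beta> (c, v)"
      have "a (f x) = ?r" using Sp False by (simp add: f_Sp a_simps)
      then show ?thesis using Sp False inv_R[of "(c, v)"] by (simp add: a_f f_invol a_simps)
    qed (use Sp in \<open>simp add: f_Sp a_simps\<close>)
  qed
qed

lemma cube_a_tau: "tau_fun (a (tau_fun (a (tau_fun (a x))))) = x"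
proof -
  have tR: "tau_fun r = r" if "r \<in> R" for r using that R_Sh by (cases r) (auto simp: tau_fun_def)
  have t: "tau_fun (Sp b c v) = Sp (\<not> b) c v" for b c v by (simp add: tau_fun_def)
  show ?thesis
  proof (cases "x \<in> R")
    case True
    then show ?thesis by (simp add: a_simps t inv_\<beta> tR)
  next
    case False
    show ?thesis
    proof (cases x)
      case (Sh y c v s) then show ?thesis using False by (simp add: a_simps tau_fun_def)
    next
      case (Sp b c v)
      then show ?thesis using inv_R[of "(c, v)"] by (cases b) (simp_all add: a_simps t tR)
    qed
  qed
qed

end

inductive_set halt_class :: "rule list \<Rightarrow> nat \<Rightarrow> nat \<times> int \<Rightarrow> (nat \<times> int) set" for rs qh peak where
  final: "(qh, 1) \<in> halt_class rs qh peak"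
| before: "zstep rs c d \<Longrightarrow> c \<noteq> peak \<Longrightarrow> d \<in> halt_class rs qh peak \<Longrightarrow> c \<in> halt_class rs qh peak"

locale residue_machine =
  fixes rs :: "rule list" and nq qh q0 n0 C M :: nat and peak :: "nat \<times> int"
  assumes rule: "\<And>r. r \<in> set rs \<Longrightarrow> res r < md r \<and> off r < mul r \<and> md r \<le> C \<and> mul r \<le> C"
    and C2: "2 \<le> C"
    and det: "\<And>c d d'. zstep rs c d \<Longrightarrow> zstep rs c d' \<Longrightarrow> d = d'"
    and final_stops: "\<And>d. \<not> zstep rs (qh, 1) d"
    and reach: "(zstep rs)\<^sup>*\<^sup>* (q0, int n0) peak" and peak_final: "peak \<noteq> (qh, 1)"
    and far: "int C ^ M * (int n0 + 1) < \<bar>snd peak\<bar> + 1"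
begin

abbreviation "S \<equiv> halt_class rs qh peak"

lemma peak_notin: "peak \<notin> S"
  using peak_final by (auto elim: halt_class.cases)

lemma S_step: "zstep rs c d \<Longrightarrow> c \<noteq> peak \<Longrightarrow> c \<in> S \<longleftrightarrow> d \<in> S"
proof
  assume cd: "zstep rs c d" "c \<noteq> peak" and "c \<in> S"
  from this(3) show "d \<in> S"
  proof cases
    case final then show ?thesis using cd final_stops by blast
  next
    case (before d') then show ?thesis using det[OF cd(1)] by blast
  qed
qed (rule halt_class.before)

text \<open>Membership in \<open>S\<close> is constant along a trajectory until it leaves the peak,
  and the peak is outside.\<close>

lemma start_notin: "(q0, int n0) \<notin> S"
  using reach
proof (induction rule: converse_rtranclp_induct)
  case (step c d)
  then show ?case using S_step[OF step(1)] peak_notin by blast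
qed (rule peak_notin)

text \<open>The levels form a system of copies of the integers carrying subsets that is closed under
  restriction to residue classes and its converse; \<open>LB q\<close> carries the configurations with state \<open>q\<close>.\<close>

primrec pat :: "lev \<Rightarrow> int set" where
  "pat (LB q) = {n. (q, n) \<in> S}"
| "pat (LR m j l) = {k. int m * k + int j \<in> pat l}"
| "pat (LI m l) = {n. n div int m \<in> pat l}"
| "pat (LC c l) = pat l"

definition block_pat :: "nat \<Rightarrow> lev \<times> nat \<Rightarrow> int set" where
  "block_pat m x = {k. int m * k + int (snd x) \<in> pat (fst x)}"

text \<open>\<open>LR\<close> turns a residue class into a level of its own, \<open>LI m'\<close>
  spreads a level over a class modulo \<open>m'\<close>, and \<open>LC c\<close> supplies infinitely
  many copies. One class on a base level is left out because a rule prescribes what corresponds to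
  it.\<close>

lemma infinite_block_pat:
  assumes "0 < m'" shows "infinite {y \<in> blocks m' - {(LB q, i)}. block_pat m' y = block_pat m x}"
proof -
  let ?f = "\<lambda>c. (LI m' (LC c (LR m (snd x) (fst x))), 0 :: nat)"
  have "range ?f \<subseteq> {y \<in> blocks m' - {(LB q, i)}. block_pat m' y = block_pat m x}"
    using assms by (auto simp: blocks_def block_pat_def)
  moreover have "infinite (range ?f)" by (rule range_inj_infinite) (simp add: inj_def)
  ultimately show ?thesis using infinite_super by blast
qed

text \<open>The class on which the rule is defined must go to the class of its results, and there
  the machine itself decides about the pattern; the other classes are merely matched by
  pattern.\<close>

definition rule_bij :: "rule \<Rightarrow> lev \<times> nat \<Rightarrow> lev \<times> nat" where
  "rule_bij r = (SOME \<beta>. bij_betw \<beta> (blocks (md r)) (blocks (mul r)) \<and>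
     \<beta> (LB (src r), res r) = (LB (tgt r), off r) \<and>
     (\<forall>x\<in>blocks (md r) - {(LB (src r), res r)}. block_pat (mul r) (\<beta> x) = block_pat (md r) x))"

lemma rule_bij:
  assumes r: "r \<in> set rs"
  shows "bij_betw (rule_bij r) (blocks (md r)) (blocks (mul r))"
    and "rule_bij r (LB (src r), res r) = (LB (tgt r), off r)"
    and "\<And>x. x \<in> blocks (md r) \<Longrightarrow> x \<noteq> (LB (src r), res r) \<Longrightarrow>
      block_pat (mul r) (rule_bij r x) = block_pat (md r) x"
proof -
  let ?x = "(LB (src r), res r)" and ?y = "(LB (tgt r), off r)"
  have pos: "0 < md r" "0 < mul r" "?x \<in> blocks (md r)" "?y \<in> blocks (mul r)"
    using rule[OF r] by (auto simp: blocks_def)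
  have "\<exists>\<beta>. bij_betw \<beta> (blocks (md r) - {?x}) (blocks (mul r) - {?y}) \<and>
      (\<forall>x\<in>blocks (md r) - {?x}. block_pat (mul r) (\<beta> x) = block_pat (md r) x)"
    by (rule ex_fibre_bij) (use infinite_block_pat pos in blast)
  then obtain \<beta> where \<beta>: "bij_betw \<beta> (blocks (md r) - {?x}) (blocks (mul r) - {?y})"
    "\<forall>x\<in>blocks (md r) - {?x}. block_pat (mul r) (\<beta> x) = block_pat (md r) x" by blast
  have eq: "bij_betw (\<beta>(?x := ?y)) (blocks (md r) - {?x}) (blocks (mul r) - {?y})"
    using \<beta>(1) by (subst bij_betw_cong[of _ _ \<beta>]) auto
  have "bij_betw (\<beta>(?x := ?y)) ((blocks (md r) - {?x}) \<union> {?x}) ((blocks (mul r) - {?y}) \<union> {?y})"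
    by (rule bij_betw_combine[OF eq]) (auto simp: bij_betw_def)
  moreover have "(blocks (md r) - {?x}) \<union> {?x} = blocks (md r)" "(blocks (mul r) - {?y}) \<union> {?y} = blocks (mul r)"
    using pos by auto
  ultimately have "bij_betw (\<beta>(?x := ?y)) (blocks (md r)) (blocks (mul r))" by simp
  then have "\<exists>\<beta>. bij_betw \<beta> (blocks (md r)) (blocks (mul r)) \<and> \<beta> ?x = ?y \<and>
     (\<forall>x\<in>blocks (md r) - {?x}. block_pat (mul r) (\<beta> x) = block_pat (md r) x)"
    using \<beta>(2) by (intro exI[of _ "\<beta>(?x := ?y)"]) auto
  from someI_ex[OF this, folded rule_bij_def]
  show "bij_betw (rule_bij r) (blocks (md r)) (blocks (mul r))"
    "rule_bij r ?x = ?y"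
    "\<And>x. x \<in> blocks (md r) \<Longrightarrow> x \<noteq> ?x \<Longrightarrow> block_pat (mul r) (rule_bij r x) = block_pat (md r) x"
    by auto
qed

definition rule_map :: "rule \<Rightarrow> lev \<times> int \<Rightarrow> lev \<times> int" where
  "rule_map r = block_map (md r) (mul r) (rule_bij r)"

definition rule_map' :: "rule \<Rightarrow> lev \<times> int \<Rightarrow> lev \<times> int" where
  "rule_map' r = block_map (mul r) (md r) (inv_into (blocks (md r)) (rule_bij r))"

lemma rule_map_inverse:
  assumes r: "r \<in> set rs"
  shows "rule_map' r (rule_map r x) = x" "rule_map r (rule_map' r x) = x"
proof -
  have "0 < md r" "0 < mul r" using rule[OF r] by auto
  note b = rule_bij(1)[OF r] bij_betw_inv_into[OF rule_bij(1)[OF r]]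
  show "rule_map' r (rule_map r x) = x" unfolding rule_map_def rule_map'_def
    using b by (intro block_map_inverse \<open>0 < md r\<close>) (auto simp: bij_betw_def)
  show "rule_map r (rule_map' r x) = x" unfolding rule_map_def rule_map'_def
    using b by (intro block_map_inverse \<open>0 < mul r\<close>) (auto simp: bij_betw_def f_inv_into_f inv_into_into)
qed

lemma rule_map_bound:
  assumes r: "r \<in> set rs"
  shows "\<bar>snd (rule_map r x)\<bar> + 1 \<le> int C * (\<bar>snd x\<bar> + 1)"
    and "\<bar>snd x\<bar> + 1 \<le> int C * (\<bar>snd (rule_map r x)\<bar> + 1)"
proof -
  have pos: "0 < md r" "0 < mul r" "md r \<le> C" "mul r \<le> C" using rule[OF r] by auto
  note b = rule_bij(1)[OF r] bij_betw_inv_into[OF rule_bij(1)[OF r]]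
  show "\<bar>snd (rule_map r x)\<bar> + 1 \<le> int C * (\<bar>snd x\<bar> + 1)"
    unfolding rule_map_def using b pos by (intro block_map_bound) (auto simp: bij_betw_def)
  have "\<bar>snd (rule_map' r y)\<bar> + 1 \<le> int C * (\<bar>snd y\<bar> + 1)" for y
    unfolding rule_map'_def using b(2) pos by (intro block_map_bound) (auto simp: bij_betw_def)
  from this[of "rule_map r x"] show "\<bar>snd x\<bar> + 1 \<le> int C * (\<bar>snd (rule_map r x)\<bar> + 1)"
    by (simp add: rule_map_inverse[OF r])
qed

lemma rule_map_shift:
  assumes r: "r \<in> set rs"
  shows "rule_map r (l, n + int (md r)) = (fst (rule_map r (l, n)), snd (rule_map r (l, n)) + int (mul r))"
proof -
  have pos: "0 < md r" using rule[OF r] by auto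
  obtain k j where j: "j < md r" "n = int (md r) * k + int j" using block_cases[OF pos] by blast
  obtain l' j' where lj: "rule_bij r (l, j) = (l', j')" by (cases "rule_bij r (l, j)")
  have *: "n + int (md r) = int (md r) * (k + 1) + int j" using j by (simp add: algebra_simps)
  show ?thesis unfolding * unfolding j(2) rule_map_def block_map_affine[where \<beta> = "rule_bij r", OF j(1) lj] by (simp add: algebra_simps)
qed

lemma rule_map_base:
  assumes r: "r \<in> set rs" shows "rule_map r (LB (src r), int (res r)) = (LB (tgt r), int (off r))"
  using block_map_affine[where \<beta> = "rule_bij r" and m = "md r" and m' = "mul r" and k = 0, OF _ rule_bij(2)[OF r]] rule[OF r] by (simp add: rule_map_def)

text \<open>\<open>GK\<close> acts off the pattern, so this is the commutation of \<open>GK\<close>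
  with a rule. On the class of the rule itself it expresses that a machine step preserves membership
  in \<open>S\<close>, which can fail only when leaving the peak.\<close>

lemma rule_map_pat:
  assumes r: "r \<in> set rs" and ne: "(l, n) \<noteq> (LB (fst peak), snd peak)"
  shows "snd (rule_map r (l, n)) \<in> pat (fst (rule_map r (l, n))) \<longleftrightarrow> n \<in> pat l"
proof -
  have pos: "0 < md r" using rule[OF r] by auto
  obtain k j where j: "j < md r" "n = int (md r) * k + int j" using block_cases[OF pos] by blast
  obtain l' j' where lj: "rule_bij r (l, j) = (l', j')" by (cases "rule_bij r (l, j)")
  have *: "rule_map r (l, n) = (l', int (mul r) * k + int j')"
    unfolding rule_map_def j(2) block_map_affine[where \<beta> = "rule_bij r", OF j(1) lj] ..
  show ?thesis
  proof (cases "(l, j) = (LB (src r), res r)")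
    case True
    then have lj': "l' = LB (tgt r)" "j' = off r" using rule_bij(2)[OF r] lj by auto
    obtain i where i: "i < length rs" "r = rs ! i" using r by (metis in_set_conv_nth)
    have "zstep rs (src r, n) (tgt r, int (mul r) * k + int (off r))"
      using zstep.intros[OF i, of k] True j by simp
    moreover have "(src r, n) \<noteq> peak" using ne True by auto
    ultimately show ?thesis using S_step * lj' True by simp
  next
    case False
    have "block_pat (mul r) (l', j') = block_pat (md r) (l, j)"
      using rule_bij(3)[OF r _ False] lj j by (simp add: blocks_def)
    then have "k \<in> block_pat (mul r) (l', j') \<longleftrightarrow> k \<in> block_pat (md r) (l, j)" by simp
    then show ?thesis using * j by (simp add: block_pat_def)
  qed
qed

section \<open>Action of the structural generators on sites\<close>

definition sact_fun :: "sgen \<Rightarrow> site \<Rightarrow> site" where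
  "sact_fun g x = (case x of (l, n, b, b') \<Rightarrow> (case g of
     GX \<Rightarrow> (l, n + 1, b, b')
   | GK \<Rightarrow> (l, n, b, if n \<in> pat l then b' else \<not> b')
   | GT q \<Rightarrow> (l, n, if l = LB q \<and> n = 0 \<and> \<not> b' then \<not> b else b, b')
   | GR i \<Rightarrow> (if i < length rs then (fst (rule_map (rs ! i) (l, n)), snd (rule_map (rs ! i) (l, n)), b, b') else x)))"

definition sact :: "sgen \<Rightarrow> site permut" where "sact g = Permut (sact_fun g)"

lemma app_sact: "app (sact g) = sact_fun g"
proof (cases g)
  case GX
  then show ?thesis unfolding sact_def
    by (intro app_Permut[where f' = "\<lambda>(l, n, b, b'). (l, n - 1, b, b')"]) (auto simp: sact_fun_def)
next
  case GK
  then show ?thesis unfolding sact_def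
    by (intro app_Permut[where f' = "sact_fun g"]) (auto simp: sact_fun_def split: if_splits)
next
  case (GT q)
  then show ?thesis unfolding sact_def
    by (intro app_Permut[where f' = "sact_fun g"]) (auto simp: sact_fun_def split: if_splits)
next
  case (GR i)
  then show ?thesis unfolding sact_def
    using rule_map_inverse[of "rs ! i"]
    by (intro app_Permut[where f' = "\<lambda>(l, n, b, b'). if i < length rs then
        (fst (rule_map' (rs ! i) (l, n)), snd (rule_map' (rs ! i) (l, n)), b, b') else (l, n, b, b')"])
      (auto simp: sact_fun_def split: prod.splits)
qed

lemma app_GX: "app (sact GX) (l, n, b, b') = (l, n + 1, b, b')"
  by (simp add: app_sact sact_fun_def)
lemma app_GK: "app (sact GK) (l, n, b, b') = (l, n, b, if n \<in> pat l then b' else \<not> b')"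
  by (simp add: app_sact sact_fun_def)
lemma app_GT: "app (sact (GT q)) (l, n, b, b') = (l, n, if l = LB q \<and> n = 0 \<and> \<not> b' then \<not> b else b, b')"
  by (simp add: app_sact sact_fun_def)
lemma app_GR: "i < length rs \<Longrightarrow> app (sact (GR i)) (l, n, b, b') =
    (fst (rule_map (rs ! i) (l, n)), snd (rule_map (rs ! i) (l, n)), b, b')"
  by (simp add: app_sact sact_fun_def)

lemma app_shift: "app (nmul m (sact GX)) (l, n, b, b') = (l, n + int m, b, b')"
  by (induction m arbitrary: n) (simp_all add: app_GX)

lemma app_shift': "app (- nmul m (sact GX)) (l, n, b, b') = (l, n - int m, b, b')"
  by (rule app_uminus_eqI) (simp add: app_shift)

lemma app_GK': "app (- sact GK) (l, n, b, b') = (l, n, b, if n \<in> pat l then b' else \<not> b')"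
  by (rule app_uminus_eqI) (auto simp: app_GK)

lemma app_tw: "app (weval sact (tw q m)) (l, n, b, b') =
    (l, n, if l = LB q \<and> n = int m \<and> \<not> b' then \<not> b else b, b')"
  by (auto simp: weval_tw app_shift app_shift' app_GT)

lemma app_tw': "app (- weval sact (tw q m)) (l, n, b, b') =
    (l, n, if l = LB q \<and> n = int m \<and> \<not> b' then \<not> b else b, b')"
  by (rule app_uminus_eqI) (auto simp: app_tw)

text \<open>The start is outside \<open>S\<close>, so \<open>GK\<close> toggles the second bit
  there, and exactly one of the two occurrences of \<open>tw\<close> finds it off.\<close>

lemma app_comm_word: "app (weval sact (comm_word q0 n0)) (l, n, b, b') =
    (l, n, if l = LB q0 \<and> n = int n0 then \<not> b else b, b')"
  using start_notin by (auto simp: comm_word_def app_tw app_tw' app_GK app_GK')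

lemma commute_pointwise:
  "app (p + q) x = app (q + p) x \<Longrightarrow> app (p + q - p - q) x = x"
  by (metis app_minus app_plus app_uminus_app(1))

lemma final_rel_holds: "weval sact (final_rel qh) = 0"
proof -
  have "sact GK + weval sact (tw qh 1) = weval sact (tw qh 1) + sact GK"
  proof (rule permut_eqI)
    fix x :: site obtain l n b b' where x: "x = (l, n, b, b')" by (cases x)
    have "(qh, 1) \<in> S" by (rule halt_class.final)
    then show "app (sact GK + weval sact (tw qh 1)) x = app (weval sact (tw qh 1) + sact GK) x"
      unfolding x by (auto simp: app_tw app_GK)
  qed
  then have "(sact GK + weval sact (tw qh 1)) - (weval sact (tw qh 1) + sact GK) = 0" by simp
  then show ?thesis unfolding final_rel_def weval_simps weval_winv
    by (simp add: add.assoc minus_add diff_conv_add_uminus del: add_uminus_conv_diff One_nat_def)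
qed

text \<open>The first two relators hold at all points, by the affine form of the rule maps; the peak
  matters to the third only.\<close>

lemma rule_rels_hold:
  assumes i: "i < length rs" and w: "w \<in> set (rule_rels rs i)"
    and x: "(l, n) \<noteq> (LB (fst peak), snd peak)"
  shows "app (weval sact w) (l, n, b, b') = (l, n, b, b')"
proof -
  let ?r = "rs ! i" and ?R = "sact (GR i)"
  have r: "?r \<in> set rs" using i by simp
  have X: "nmul (md ?r) (sact GX) + ?R = ?R + nmul (mul ?r) (sact GX)"
  proof (rule permut_eqI)
    fix x :: site obtain l n b b' where "x = (l, n, b, b')" by (cases x)
    then show "app (nmul (md ?r) (sact GX) + ?R) x = app (?R + nmul (mul ?r) (sact GX)) x"
      by (simp add: app_shift app_GR[OF i] rule_map_shift[OF r])
  qed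
  have inj: "rule_map ?r (l, n) = (LB (tgt ?r), int (off ?r)) \<longleftrightarrow> (l, n) = (LB (src ?r), int (res ?r))" for l n
    using rule_map_base[OF r] rule_map_inverse(1)[OF r] by metis
  have T: "weval sact (tw (src ?r) (res ?r)) + ?R = ?R + weval sact (tw (tgt ?r) (off ?r))"
  proof (rule permut_eqI)
    fix x :: site obtain l n b b' where x: "x = (l, n, b, b')" by (cases x)
    obtain l' n' where ln': "rule_map ?r (l, n) = (l', n')" by (cases "rule_map ?r (l, n)")
    show "app (weval sact (tw (src ?r) (res ?r)) + ?R) x = app (?R + weval sact (tw (tgt ?r) (off ?r))) x"
      unfolding x using inj[of l n] by (auto simp: app_tw app_GR[OF i] ln')
  qed
  consider "w = neg (GR i) # xw (md ?r) @ pos (GR i) # winv (xw (mul ?r))"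
    | "w = neg (GR i) # tw (src ?r) (res ?r) @ pos (GR i) # winv (tw (tgt ?r) (off ?r))"
    | "w = [pos GK, pos (GR i), neg GK, neg (GR i)]"
    using w by (auto simp: rule_rels_def Let_def)
  then show ?thesis
  proof cases
    case 1
    have "weval sact w = - ?R + ((nmul (md ?r) (sact GX) + ?R) - nmul (mul ?r) (sact GX))"
      unfolding 1 by (simp add: weval_xw add.assoc add_diff_eq)
    then have "weval sact w = 0" unfolding X by (simp add: add.assoc)
    then show ?thesis by simp
  next
    case 2
    have "weval sact w = - ?R + ((weval sact (tw (src ?r) (res ?r)) + ?R) - weval sact (tw (tgt ?r) (off ?r)))"
      unfolding 2 by (simp add: add.assoc add_diff_eq)
    then have "weval sact w = 0" unfolding T by (simp add: add.assoc)
    then show ?thesis by simp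
  next
    case 3
    have "app (sact GK + ?R) (l, n, b, b') = app (?R + sact GK) (l, n, b, b')"
      using rule_map_pat[OF r x] by (simp add: app_GK app_GR[OF i])
    from commute_pointwise[OF this] show ?thesis unfolding 3 by (simp add: add.assoc)
  qed
qed

end

section \<open>Heights of sites and points\<close>

context residue_machine
begin

text \<open>A logarithm to base \<open>C\<close>, rounded up. The factor \<open>int n0 + 1\<close>
  gives all integers up to \<open>n0\<close> in absolute value the full height \<open>M\<close>; the
  \<open>1\<close> added to the absolute value lets shifts by one, too, change the measured size by
  at most a factor \<open>C\<close>.\<close>

definition lam :: "int \<Rightarrow> nat" where "lam n = (LEAST i. \<bar>n\<bar> + 1 \<le> int C ^ i * (int n0 + 1))"

definition pot :: "int \<Rightarrow> nat" where "pot n = M - lam n"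

lemma lam: "\<bar>n\<bar> + 1 \<le> int C ^ lam n * (int n0 + 1)"
  unfolding lam_def
proof (rule LeastI)
  let ?i = "nat (\<bar>n\<bar> + 1)"
  have "\<bar>n\<bar> + 1 = int ?i" by simp
  also have "\<dots> \<le> 2 ^ ?i" using less_exp[of ?i] by (metis less_imp_le of_nat_le_iff of_nat_numeral of_nat_power)
  also have "\<dots> \<le> int C ^ ?i" using C2 by (intro power_mono) auto
  also have "\<dots> \<le> int C ^ ?i * (int n0 + 1)" using C2 by (simp add: mult_le_cancel_left1)
  finally show "\<bar>n\<bar> + 1 \<le> int C ^ ?i * (int n0 + 1)" .
qed

lemma pot_lip:
  assumes "\<bar>n'\<bar> + 1 \<le> int C * (\<bar>n\<bar> + 1)" shows "pot n \<le> pot n' + 1"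
proof -
  have "int C * (\<bar>n\<bar> + 1) \<le> int C * (int C ^ lam n * (int n0 + 1))"
    using lam[of n] by (intro mult_left_mono) auto
  then have "\<bar>n'\<bar> + 1 \<le> int C ^ Suc (lam n) * (int n0 + 1)" using assms by (simp add: mult.assoc)
  then have "lam n' \<le> Suc (lam n)" unfolding lam_def[of n'] by (rule Least_le)
  then show ?thesis by (simp add: pot_def)
qed

lemma pot_le: "pot n \<le> M" by (simp add: pot_def)

lemma pot_small: "\<bar>n\<bar> \<le> int n0 \<Longrightarrow> pot n = M"
proof -
  assume "\<bar>n\<bar> \<le> int n0"
  then have "lam n \<le> 0" unfolding lam_def by (intro Least_le) simp
  then show ?thesis by (simp add: pot_def)
qed

lemma pot_peak: "pot (snd peak) = 0"
proof (rule ccontr)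
  assume "pot (snd peak) \<noteq> 0"
  then have "lam (snd peak) \<le> M" by (simp add: pot_def)
  then have "int C ^ lam (snd peak) * (int n0 + 1) \<le> int C ^ M * (int n0 + 1)"
    using C2 by (intro mult_right_mono power_increasing) auto
  then show False using lam[of "snd peak"] far by linarith
qed

definition site_lip :: "site permut \<Rightarrow> bool" where
  "site_lip p \<longleftrightarrow> (\<forall>y. pot (fst (snd y)) \<le> pot (fst (snd (app p y))) + 1 \<and>
     pot (fst (snd (app p y))) \<le> pot (fst (snd y)) + 1)"

lemma site_lip_0: "site_lip 0" by (simp add: site_lip_def)

lemma site_lip_uminus: "site_lip p \<Longrightarrow> site_lip (- p)"
  unfolding site_lip_def by (metis app_uminus_app(2))

lemma site_lip_sact: "site_lip (sact g)"
  unfolding site_lip_def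
proof (intro allI)
  fix y :: site obtain l n b b' where y: "y = (l, n, b, b')" by (cases y)
  have C: "\<bar>k\<bar> + 2 \<le> int C * (\<bar>k\<bar> + 1)" for k
  proof -
    have "2 * (\<bar>k\<bar> + 1) \<le> int C * (\<bar>k\<bar> + 1)" using C2 by (intro mult_right_mono) auto
    moreover have "\<bar>k\<bar> + 2 \<le> 2 * (\<bar>k\<bar> + 1)" by simp
    ultimately show ?thesis by (rule order_trans[rotated])
  qed
  show "pot (fst (snd y)) \<le> pot (fst (snd (app (sact g) y))) + 1 \<and>
     pot (fst (snd (app (sact g) y))) \<le> pot (fst (snd y)) + 1"
  proof (cases g)
    case GX
    have "\<bar>n + 1\<bar> + 1 \<le> int C * (\<bar>n\<bar> + 1)" "\<bar>n\<bar> + 1 \<le> int C * (\<bar>n + 1\<bar> + 1)"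
      by (rule order_trans[OF _ C]; simp)+
    then show ?thesis using pot_lip by (simp add: y GX app_GX)
  next
    case (GR i)
    show ?thesis
    proof (cases "i < length rs")
      case True
      then show ?thesis using rule_map_bound[of "rs ! i" "(l, n)"] pot_lip by (simp add: y GR app_GR)
    next
      case False
      then show ?thesis by (simp add: y GR app_sact sact_fun_def)
    qed
  qed (simp_all add: y app_GK app_GT)
qed

text \<open>All involutions have infinitely many pairs of points at each height, so that they can be linked by
  height-preserving bijections.\<close>

fun height :: "om \<Rightarrow> nat" where
  "height (Sh y c v s) = min (pot (fst (snd y))) v"
| "height (Sp b c v) = min v M"

fun reps :: "igen \<Rightarrow> om set" where
  "reps Sig1 = {Sh y c v s | y c v s. even s}"
| "reps (V1 g) = {Sh y c v s | y c v s. even s}"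
| "reps Sig2 = {Sh y c v s | y c v s. odd s}"
| "reps (V2 g) = {Sh y c v s | y c v s. odd s}"
| "reps Zed = {Sh (LB q0, int n0, False, b) c v 0 | b c v. True}"

lemma Sh_reps [simp]:
  "Sh y c v s \<in> reps Sig1 \<longleftrightarrow> even s" "Sh y c v s \<in> reps (V1 g) \<longleftrightarrow> even s"
  "Sh y c v s \<in> reps Sig2 \<longleftrightarrow> odd s" "Sh y c v s \<in> reps (V2 g) \<longleftrightarrow> odd s"
  "Sh (l, n, b, b') c v s \<in> reps Zed \<longleftrightarrow> l = LB q0 \<and> n = int n0 \<and> \<not> b \<and> s = 0"
  by (cases y; auto)+

declare reps.simps [simp del]

fun ifun :: "igen \<Rightarrow> om \<Rightarrow> om" where
  "ifun Sig1 = swap_even 0"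
| "ifun (V1 g) = swap_even (sact g)"
| "ifun Sig2 = swap_odd 0"
| "ifun (V2 g) = swap_odd (sact g)"
| "ifun Zed = emb_fun (weval sact (comm_word q0 n0))"

definition ibij :: "igen \<Rightarrow> om \<Rightarrow> nat \<times> nat" where
  "ibij u = (SOME \<beta>. bij_betw \<beta> (reps u) UNIV \<and> (\<forall>x\<in>reps u. min (snd (\<beta> x)) M = height x))"

lemma height_le: "height x \<le> M"
  by (cases x) (use pot_le in \<open>auto intro: min.coboundedI1\<close>)

lemma ibij: "bij_betw (ibij u) (reps u) UNIV" "x \<in> reps u \<Longrightarrow> min (snd (ibij u x)) M = height x"
proof -
  have "\<exists>\<beta> :: om \<Rightarrow> nat \<times> nat. bij_betw \<beta> (reps u) UNIV \<and> (\<forall>x\<in>reps u. min (snd (\<beta> x)) M = height x)"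
  proof (rule ex_fibre_bij[where f = height and g = "\<lambda>x :: nat \<times> nat. min (snd x) M"])
    fix p assume "p \<in> height ` reps u \<union> (\<lambda>x :: nat \<times> nat. min (snd x) M) ` UNIV"
    then have p: "p \<le> M" using height_le by auto
    \<comment> \<open>All these points lie over \<open>n0\<close>, where the potential has its
      maximum \<open>M\<close>, so taking \<open>p\<close> for \<open>v\<close> sets the height to
      \<open>p\<close>; \<open>s\<close> is 0 or 1 according to the parity that
      \<open>reps u\<close> asks for.\<close>
    obtain s where s: "\<And>c. Sh (LB q0, int n0, False, False) c p s \<in> reps u"
      by (cases u) (auto intro: that[of 0] that[of 1])
    have "range (\<lambda>c. Sh (LB q0, int n0, False, False) c p s) \<subseteq> {x \<in> reps u. height x = p}"
      using s p by (auto simp: pot_small)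
    moreover have "infinite (range (\<lambda>c. Sh (LB q0, int n0, False, False) c p s))"
      by (rule range_inj_infinite) (simp add: inj_def)
    ultimately have 1: "infinite {x \<in> reps u. height x = p}" using infinite_super by blast
    have "range (\<lambda>c. (c :: nat, p)) \<subseteq> {x \<in> UNIV. min (snd x) M = p}" using p by auto
    moreover have "infinite (range (\<lambda>c. (c :: nat, p)))" by (rule range_inj_infinite) (simp add: inj_def)
    ultimately have "infinite {x :: nat \<times> nat. x \<in> UNIV \<and> min (snd x) M = p}" using infinite_super by blast
    with 1 show "infinite {x \<in> reps u. height x = p} \<and> infinite {x :: nat \<times> nat. x \<in> UNIV \<and> min (snd x) M = p}"
      by blast
  qed
  from someI_ex[OF this, folded ibij_def]
  show "bij_betw (ibij u) (reps u) UNIV" "x \<in> reps u \<Longrightarrow> min (snd (ibij u x)) M = height x" by auto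
qed

lemma link: "link (ifun u) (reps u) (ibij u)"
proof (rule link.intro[OF _ _ _ _ _ ibij(1)])
  have z: "weval sact (comm_word q0 n0) + weval sact (comm_word q0 n0) = 0"
  proof (rule permut_eqI)
    fix y :: site obtain l n b b' where "y = (l, n, b, b')" by (cases y)
    then show "app (weval sact (comm_word q0 n0) + weval sact (comm_word q0 n0)) y = app 0 y"
      by (simp add: app_comm_word)
  qed
  have "emb (weval sact (comm_word q0 n0)) + emb (weval sact (comm_word q0 n0)) = 0"
    using z emb_hom(1,2) by metis
  then have "app (emb (weval sact (comm_word q0 n0)) + emb (weval sact (comm_word q0 n0))) x = x" for x by simp
  then have zz: "emb_fun (weval sact (comm_word q0 n0)) (emb_fun (weval sact (comm_word q0 n0)) x) = x" for x
    by (simp add: app_emb)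
  show "ifun u (ifun u x) = x" for x
    by (cases u) (simp_all add: swap_even_invol swap_odd_invol zz)
  show "ifun u (Sp b c v) = Sp b c v" for b c v by (cases u) simp_all
  show Sp: "Sp b c v \<notin> reps u" for b c v by (cases u) (simp_all add: reps.simps)
  show "ifun u x \<notin> reps u" if "x \<in> reps u" for x
  proof (cases x)
    case (Sh y c v s)
    obtain l n b b' where y: "y = (l, n, b, b')" by (cases y)
    show ?thesis using that Sh
      by (cases u) (simp_all add: y app_comm_word)
  qed (use Sp that in simp)
  show "ifun u x = x \<or> ifun u x \<in> reps u" if "x \<notin> reps u" for x
  proof (cases x)
    case (Sh y c v s)
    obtain l n b b' where y: "y = (l, n, b, b')" by (cases y)
    show ?thesis using that Sh
      by (cases u) (auto simp: y app_comm_word)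
  next
    case (Sp b c v) then show ?thesis by (cases u) simp_all
  qed
qed

section \<open>Action of all generators\<close>

fun act :: "gen \<Rightarrow> om permut" where
  "act (Str g) = emb (sact g)"
| "act (Inv u) = Permut (ifun u)"
| "act (Aux u) = Permut (aux_fun (reps u) (ibij u))"
| "act Tau = Permut tau_fun"

lemma app_act: "app (act (Str g)) = emb_fun (sact g)" "app (act (Inv u)) = ifun u"
  "app (act (Aux u)) = aux_fun (reps u) (ibij u)" "app (act Tau) = tau_fun"
proof -
  show "app (act (Str g)) = emb_fun (sact g)" by (simp add: app_emb)
  show "app (act (Inv u)) = ifun u"
    using link.f_invol[OF link] by (simp add: app_Permut[of "ifun u" "ifun u"])
  show "app (act (Aux u)) = aux_fun (reps u) (ibij u)"
    using link.aux_invol[OF link]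
    by (simp add: app_Permut[of "aux_fun (reps u) (ibij u)" "aux_fun (reps u) (ibij u)"])
  have "tau_fun (tau_fun x) = x" for x by (cases x) (simp_all add: tau_fun_def)
  then show "app (act Tau) = tau_fun" by (simp add: app_Permut[of tau_fun tau_fun])
qed

lemma lipschitz_act: "lipschitz_by 1 height (act g)"
  unfolding lipschitz_by_def
proof (intro allI)
  fix x
  have swap: "height (Sh y c v s) \<le> Suc (height (Sh (app p y) c v s')) \<and>
      height (Sh (app p y) c v s') \<le> Suc (height (Sh y c v s))" if "site_lip p" for p y c v s s'
  proof -
    have "pot (fst (snd y)) \<le> pot (fst (snd (app p y))) + 1" "pot (fst (snd (app p y))) \<le> pot (fst (snd y)) + 1"
      using that unfolding site_lip_def by blast+
    then show ?thesis by (simp add: min_def)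
  qed
  note sw = swap[OF site_lip_sact] swap[OF site_lip_uminus[OF site_lip_sact]]
    swap[OF site_lip_0] swap[OF site_lip_uminus[OF site_lip_0]]
  show "height x \<le> height (app (act g) x) + 1 \<and> height (app (act g) x) \<le> height x + 1"
  proof (cases g)
    case (Str a)
    then show ?thesis unfolding Str app_act
      by (cases x) (simp_all del: height.simps add: sw)
  next
    case (Inv u)
    show ?thesis
    proof (cases x)
      case (Sh y c v s)
      obtain l n b b' where y: "y = (l, n, b, b')" by (cases y)
      show ?thesis
      proof (cases u)
        case Zed
        show ?thesis unfolding Inv app_act Sh Zed by (simp add: y app_comm_word)
      next
        case Sig1 then show ?thesis by (simp add: Inv app_act Sh del: act.simps)
      next
        case Sig2 then show ?thesis by (simp add: Inv app_act Sh del: act.simps)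
      qed (simp_all del: height.simps act.simps add: Inv app_act Sh sw)
    next
      case (Sp b c v)
      then show ?thesis using link.f_Sp[OF link] by (simp add: Inv app_act del: act.simps)
    qed
  next
    case (Aux u)
    have "height (aux_fun (reps u) (ibij u) x) = height x"
    proof (cases "x \<in> reps u")
      case True
      then show ?thesis using ibij(2)[OF True] by (simp add: link.a_simps[OF link])
    next
      case False
      then show ?thesis
      proof (cases x)
        case (Sp b c v)
        show ?thesis
        proof (cases b)
          case F: False
          note r = link.inv_R[OF link[of u], of "(c, v)"]
          show ?thesis using ibij(2)[OF r(1)] r(2) F Sp by (simp add: link.a_simps[OF link])
        qed (use Sp in \<open>simp add: link.a_simps[OF link]\<close>)
      qed (simp add: link.a_simps[OF link])
    qed
    then show ?thesis by (simp add: Aux app_act del: act.simps)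
  next
    case Tau
    then show ?thesis by (cases x) (simp_all add: app_act tau_fun_def del: act.simps)
  qed
qed

lemma weval_act_str: "weval (act \<circ> Str) w = emb (weval sact w)"
  by (induction w) (auto simp: emb_hom)

lemma rels_hold:
  assumes w: "w \<in> set (rels rs nq qh q0 n0)" and x: "0 < height x"
  shows "app (weval act w) x = x"
proof -
  consider "w = zed_rel q0 n0" | "w = [pos Tau, pos Tau]" | g where "w = kill_rel g"
    | u where "w \<in> set (link_rels u)" | v where "v \<in> set (struct_rels rs qh)" "w = str_word v"
    using w by (auto simp: rels_def)
  then show ?thesis
  proof cases
    case 1
    have "act (Inv Zed) = emb (weval sact (comm_word q0 n0))"
      by (rule permut_eqI) (simp add: app_act app_emb del: act.simps)
    then show ?thesis unfolding 1 zed_rel_def by (simp add: weval_str_word weval_act_str del: act.simps)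
  next
    case 2
    then show ?thesis by (cases x) (simp_all add: app_act tau_fun_def del: act.simps)
  next
    case 3
    have "act (Str g) = act (Inv (V1 g)) + (act (Inv Sig1) + (act (Inv (V2 g)) + act (Inv Sig2)))"
      by (rule permut_eqI) (simp add: app_act swap_telescope del: act.simps)
    then show ?thesis unfolding 3 kill_rel_def by (simp del: act.simps)
  next
    case 4
    note l = link.f_invol[OF link] link.aux_invol[OF link] link.cube_f_a[OF link] link.cube_a_tau[OF link]
    show ?thesis using 4 by (auto simp: link_rels_def app_act l simp del: act.simps)
  next
    case 5
    have "emb_fun (weval sact v) x = x"
    proof (cases x)
      case (Sh y c t s)
      obtain l n b b' where y: "y = (l, n, b, b')" by (cases y)
      \<comment> \<open>The integer of the peak has potential 0, so no point of positive height lies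
        over it, on any level.\<close>
      have "n \<noteq> snd peak" using x pot_peak by (auto simp: Sh y)
      then have "app (weval sact v) y = y"
        using 5(1) final_rel_holds rule_rels_hold[of _ v l n b b'] by (auto simp: struct_rels_def y)
      then show ?thesis using Sh by simp
    qed simp
    then show ?thesis using 5 by (simp add: weval_str_word weval_act_str app_emb)
  qed
qed

definition start_pt :: om where "start_pt = Sh (LB q0, 0, False, False) 0 M 0"

lemma height_start: "height start_pt = M"
  by (simp add: start_pt_def pot_small)

lemma infinite_orbit: "infinite (range (\<lambda>n. (app (act (Str GX)) ^^ n) start_pt))"
proof -
  have "(app (act (Str GX)) ^^ n) start_pt = Sh (LB q0, int n, False, False) 0 M 0" for n
    by (induction n) (simp_all add: start_pt_def app_act app_GX del: act.simps)
  moreover have "infinite (range (\<lambda>n. Sh (LB q0, int n, False, False) 0 M 0))"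
    by (rule range_inj_infinite) (simp add: inj_def)
  ultimately show ?thesis by simp
qed

end

section \<open>Compiling recursive functions to counter programs\<close>

text \<open>A loop decrements its register whenever its test succeeds. In the prime encoding a
  successful test and the decrement are then one rule, division by a prime.\<close>

datatype com = CSkip | CInc nat | CSeq com com | CLoop nat com

inductive cexec :: "com \<Rightarrow> (nat \<Rightarrow> nat) \<Rightarrow> (nat \<Rightarrow> nat) \<Rightarrow> bool" where
  skip: "cexec CSkip v v"
| inc: "cexec (CInc r) v (v(r := Suc (v r)))"
| seq: "cexec a u v \<Longrightarrow> cexec b v w \<Longrightarrow> cexec (CSeq a b) u w"
| loop_end: "v r = 0 \<Longrightarrow> cexec (CLoop r c) v v"
| loop: "u r = Suc n \<Longrightarrow> cexec c (u(r := n)) v \<Longrightarrow> cexec (CLoop r c) v w \<Longrightarrow> cexec (CLoop r c) u w"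

lemma cexec_eq: "cexec c u v \<Longrightarrow> v = w \<Longrightarrow> cexec c u w" by simp

definition clear :: "nat \<Rightarrow> com" where "clear r = CLoop r CSkip"
definition move :: "nat \<Rightarrow> nat \<Rightarrow> com" where "move r s = CLoop r (CInc s)"
definition copy :: "nat \<Rightarrow> nat \<Rightarrow> nat \<Rightarrow> com" where
  "copy r s t = CSeq (CLoop r (CSeq (CInc s) (CInc t))) (move t r)"

lemma cexec_clear: "cexec (clear r) v (v(r := 0))"
proof (induction "v r" arbitrary: v)
  case 0
  then have "v(r := 0) = v" by (simp add: fun_eq_iff)
  then show ?case using 0 by (simp add: clear_def loop_end)
next
  case (Suc n)
  have "cexec (clear r) (v(r := n)) ((v(r := n))(r := 0))" by (rule Suc(1)) simp
  then have "cexec (clear r) (v(r := n)) (v(r := 0))" by simp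
  then show ?case unfolding clear_def using loop[of v r n CSkip "v(r := n)"] Suc(2) skip by simp
qed

lemma cexec_move: "r \<noteq> s \<Longrightarrow> cexec (move r s) v (v(s := v s + v r, r := 0))"
proof (induction "v r" arbitrary: v)
  case 0
  then have "v(s := v s + v r, r := 0) = v" by (simp add: fun_eq_iff)
  then show ?case using 0 by (simp add: move_def loop_end)
next
  case (Suc n)
  let ?v = "(v(r := n))(s := Suc (v s))"
  have "cexec (move r s) ?v (?v(s := ?v s + ?v r, r := 0))" using Suc(3) by (intro Suc(1)) simp_all
  moreover have "?v(s := ?v s + ?v r, r := 0) = v(s := v s + v r, r := 0)"
    using Suc(2,3) by (simp add: fun_eq_iff)
  ultimately have "cexec (move r s) ?v (v(s := v s + v r, r := 0))" by simp
  then show ?case unfolding move_def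
    using loop[of v r n "CInc s" ?v] Suc(2,3) inc[of s "v(r := n)"] by simp
qed

lemma cexec_copy:
  assumes "r \<noteq> s" "r \<noteq> t" "s \<noteq> t" "v t = 0" shows "cexec (copy r s t) v (v(s := v s + v r))"
proof -
  have "cexec (CLoop r (CSeq (CInc s) (CInc t))) u (u(s := u s + u r, t := u t + u r, r := 0))" for u
  proof (induction "u r" arbitrary: u)
    case 0
    then have "u(s := u s + u r, t := u t + u r, r := 0) = u" by (simp add: fun_eq_iff)
    then show ?case using 0 by (simp add: loop_end)
  next
    case (Suc n)
    let ?u = "(u(r := n))(s := Suc (u s), t := Suc (u t))"
    have "cexec (CLoop r (CSeq (CInc s) (CInc t))) ?u (?u(s := ?u s + ?u r, t := ?u t + ?u r, r := 0))"
      using assms by (intro Suc(1)) simp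
    moreover have "?u(s := ?u s + ?u r, t := ?u t + ?u r, r := 0) = u(s := u s + u r, t := u t + u r, r := 0)"
      using assms Suc(2) by (simp add: fun_eq_iff)
    ultimately have 1: "cexec (CLoop r (CSeq (CInc s) (CInc t))) ?u (u(s := u s + u r, t := u t + u r, r := 0))"
      by simp
    have "cexec (CSeq (CInc s) (CInc t)) (u(r := n)) ?u"
      using seq[OF inc[of s "u(r := n)"] inc[of t]] assms by simp
    then show ?case using Suc(2) by (intro loop[OF _ _ 1, of _ n]) simp_all
  qed
  from seq[OF this cexec_move[OF assms(2)[symmetric]]] show ?thesis unfolding copy_def
    by (rule cexec_eq) (use assms in \<open>simp add: fun_eq_iff\<close>)
qed

fun clears :: "nat list \<Rightarrow> com" where
  "clears [] = CSkip"
| "clears (r # rs) = CSeq (clear r) (clears rs)"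

lemma cexec_clears: "cexec (clears rs) v (\<lambda>k. if k \<in> set rs then 0 else v k)"
proof (induction rs arbitrary: v)
  case (Cons r rs)
  show ?case unfolding clears.simps
    by (rule cexec_eq[OF seq[OF cexec_clear Cons]]) (auto simp: fun_eq_iff)
qed (simp add: skip)

text \<open>The arguments are in the registers \<open>as\<close>, the result goes to the empty register \<open>t\<close>, and the
  registers from \<open>d\<close> on are empty.\<close>

fun compile :: "recf \<Rightarrow> nat list \<Rightarrow> nat \<Rightarrow> nat \<Rightarrow> com"
  and compiles :: "recf list \<Rightarrow> nat list \<Rightarrow> nat \<Rightarrow> nat \<Rightarrow> com" where
  "compile Zero as t d = CSkip"
| "compile Succ as t d = CSeq (copy (as ! 0) t d) (CInc t)"
| "compile (Proj i) as t d = copy (as ! i) t d"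
| "compile (Comp h gs) as t d = CSeq (compiles gs as d (d + length gs))
     (CSeq (compile h [d..<d + length gs] t (d + length gs)) (clears [d..<d + length gs]))"
| "compile (Prim_Rec g h) as t d = CSeq (copy (hd as) (d + 2) (d + 3)) (CSeq (compile g (tl as) (d + 1) (d + 4))
     (CSeq (CLoop (d + 2) (CSeq (compile h (d # (d + 1) # tl as) (d + 3) (d + 4))
         (CSeq (clear (d + 1)) (CSeq (move (d + 3) (d + 1)) (CInc d)))))
       (CSeq (move (d + 1) t) (clear d))))"
| "compile (Mu g) as t d = CSeq (compile g (d # as) (d + 1) (d + 2))
     (CSeq (CLoop (d + 1) (CSeq (clear (d + 1)) (CSeq (CInc d) (compile g (d # as) (d + 1) (d + 2)))))
       (move d t))"
| "compiles [] as t d = CSkip"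
| "compiles (g # gs) as t d = CSeq (compile g as t d) (compiles gs as (Suc t) d)"

text \<open>All registers except \<open>t\<close> keep their contents, so scratch registers are
  empty again and the code can be used in a loop body.\<close>

definition compiled :: "recf \<Rightarrow> nat list \<Rightarrow> nat \<Rightarrow> bool" where
  "compiled r xs y \<longleftrightarrow> (\<forall>as t d v. set as \<subseteq> {..<d} \<longrightarrow> t < d \<longrightarrow> t \<notin> set as \<longrightarrow> map v as = xs \<longrightarrow> v t = 0 \<longrightarrow>
     (\<forall>k\<ge>d. v k = 0) \<longrightarrow> cexec (compile r as t d) v (v(t := y)))"

lemma compiledD:
  assumes "compiled r xs y" "set as \<subseteq> {..<d}" "t < d" "t \<notin> set as" "map v as = xs" "v t = 0"
    "\<And>k. d \<le> k \<Longrightarrow> v k = 0" "w = v(t := y)"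
  shows "cexec (compile r as t d) v w"
  using assms unfolding compiled_def by blast

lemma compiled_Comp:
  assumes gs: "list_all2 (\<lambda>g y. compiled g xs y) gs ys" and h: "compiled h ys z"
  shows "compiled (Comp h gs) xs z"
  unfolding compiled_def
proof (intro allI impI)
  fix as :: "nat list" and t d :: nat and v :: "nat \<Rightarrow> nat"
  assume as: "set as \<subseteq> {..<d}" "t < d" "t \<notin> set as" "map v as = xs" "v t = 0" "\<forall>k\<ge>d. v k = 0"
  let ?n = "length gs" and ?w = "\<lambda>k. if d \<le> k \<and> k < d + length gs then ys ! (k - d) else v k"
  have len: "length ys = ?n" using gs by (simp add: list_all2_lengthD)
  have many: "cexec (compiles gs as s e) u (\<lambda>k. if s \<le> k \<and> k < s + length gs then ys ! (k - s) else u k)"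
    if "list_all2 (\<lambda>g y. compiled g xs y) gs ys" "d \<le> s" "s + length gs \<le> e" "map u as = xs"
      "\<And>k. s \<le> k \<Longrightarrow> u k = 0" for gs ys s e u
    using that
  proof (induction gs ys arbitrary: s u rule: list_all2_induct)
    case Nil show ?case unfolding compiles.simps by (rule cexec_eq[OF skip]) (auto simp: fun_eq_iff)
  next
    case (Cons g gs y ys)
    have 1: "cexec (compile g as s e) u (u(s := y))"
      using Cons as(1) by (intro compiledD[OF Cons(1)]) force+
    have "map (u(s := y)) as = xs" using Cons.prems as(1) by (auto simp: map_eq_conv[symmetric] intro!: map_cong)
    then have "cexec (compiles gs as (Suc s) e) (u(s := y))
        (\<lambda>k. if Suc s \<le> k \<and> k < Suc s + length gs then ys ! (k - Suc s) else (u(s := y)) k)"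
      using Cons.prems by (intro Cons.IH) auto
    from seq[OF 1 this] show ?case unfolding compiles.simps
      by (rule cexec_eq) (auto simp: fun_eq_iff nth_Cons')
  qed
  have 1: "cexec (compiles gs as d (d + ?n)) v ?w" using as by (intro many[OF gs]) auto
  have "map ?w [d..<d + ?n] = ys" using len by (intro nth_equalityI) auto
  then have 2: "cexec (compile h [d..<d + ?n] t (d + ?n)) ?w (?w(t := z))"
    using as by (intro compiledD[OF h]) auto
  show "cexec (compile (Comp h gs) as t d) v (v(t := z))" unfolding compile.simps
    by (rule cexec_eq[OF seq[OF 1 seq[OF 2 cexec_clears]]]) (use as in \<open>auto simp: fun_eq_iff\<close>)
qed

text \<open>Register \<open>d\<close> counts the rounds done, \<open>d + 1\<close> holds the current
  value, \<open>d + 2\<close> the number of rounds to go and \<open>d + 3\<close> receives the next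
  value; \<open>?s m\<close> is the state after \<open>m\<close> rounds.\<close>

lemma compiled_Prim_Rec:
  assumes g: "compiled g xs (Y 0)" and h: "\<And>m. m < n \<Longrightarrow> compiled h (m # Y m # xs) (Y (Suc m))"
  shows "compiled (Prim_Rec g h) (n # xs) (Y n)"
  unfolding compiled_def
proof (intro allI impI)
  fix as :: "nat list" and t d :: nat and v :: "nat \<Rightarrow> nat"
  assume as: "set as \<subseteq> {..<d}" "t < d" "t \<notin> set as" "map v as = n # xs" "v t = 0" "\<forall>k\<ge>d. v k = 0"
  then obtain a bs where ab: "as = a # bs" "v a = n" "map v bs = xs" by (cases as) auto
  let ?body = "CSeq (compile h (d # (d + 1) # bs) (d + 3) (d + 4))
         (CSeq (clear (d + 1)) (CSeq (move (d + 3) (d + 1)) (CInc d)))"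
  let ?s = "\<lambda>m. v(d := m, d + 1 := Y m, d + 2 := n - m)"
  have upd': "map (v(d := m, d + 1 := y, d + 2 := z)) bs = xs" "map (v(d + 2 := z)) bs = xs" for m y z
    using ab as(1) by (auto simp: map_eq_conv[symmetric] intro!: map_cong)
  have 1: "cexec (copy a (d + 2) (d + 3)) v (v(d + 2 := n))"
    by (rule cexec_eq[OF cexec_copy]) (use as ab in auto)
  have 2: "cexec (compile g bs (d + 1) (d + 4)) (v(d + 2 := n)) (?s 0)"
    using as ab upd' by (intro compiledD[OF g]) (auto simp: fun_eq_iff)
  have body: "cexec ?body ((?s m)(d + 2 := n - Suc m)) (?s (Suc m))" if m: "m < n" for m
  proof -
    let ?u = "(?s m)(d + 2 := n - Suc m)"
    have "cexec (compile h (d # (d + 1) # bs) (d + 3) (d + 4)) ?u (?u(d + 3 := Y (Suc m)))"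
      using as ab upd'(1)[of m "Y m" "n - Suc m"] by (intro compiledD[OF h[OF m]]) auto
    from seq[OF this seq[OF cexec_clear seq[OF cexec_move inc]]] show ?thesis
      by (rule cexec_eq) (use as in \<open>auto simp: fun_eq_iff\<close>)
  qed
  have all: "cexec (CLoop (d + 2) ?body) (?s m) (?s n)" if "m \<le> n" for m
    using that
  proof (induction m rule: inc_induct)
    case base
    show ?case by (rule loop_end) simp
  next
    case (step m)
    show ?case by (rule loop[OF _ body step(3)]) (use step in auto)
  qed
  note 3 = all[OF le0]
  have "t \<noteq> d + 1" using as(2) by simp
  note 4 = seq[OF 1 seq[OF 2 seq[OF 3 seq[OF cexec_move[OF this[symmetric]] cexec_clear]]]]
  show "cexec (compile (Prim_Rec g h) as t d) v (v(t := Y n))" unfolding compile.simps ab list.sel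
    by (rule cexec_eq[OF 4]) (use as in \<open>auto simp: fun_eq_iff\<close>)
qed

lemma compiled_Mu:
  assumes Y: "\<And>m. m \<le> n \<Longrightarrow> compiled g (m # xs) (Y m)" "\<And>m. m < n \<Longrightarrow> 0 < Y m" "Y n = 0"
  shows "compiled (Mu g) xs n"
  unfolding compiled_def
proof (intro allI impI)
  fix as :: "nat list" and t d :: nat and v :: "nat \<Rightarrow> nat"
  assume as: "set as \<subseteq> {..<d}" "t < d" "t \<notin> set as" "map v as = xs" "v t = 0" "\<forall>k\<ge>d. v k = 0"
  let ?ev = "compile g (d # as) (d + 1) (d + 2)"
  let ?body = "CSeq (clear (d + 1)) (CSeq (CInc d) ?ev)"
  let ?s = "\<lambda>m. v(d := m, d + 1 := Y m)"
  have upd: "map (v(d := m)) as = xs" for m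
    using as(1,4) by (auto simp: map_eq_conv[symmetric] intro!: map_cong)
  have ev: "cexec ?ev (v(d := m)) (?s m)" if "m \<le> n" for m
    using as upd[of m] by (intro compiledD[OF Y(1)[OF that]]) (auto simp: fun_eq_iff)
  have v0: "v(d := 0) = v" using as by (simp add: fun_eq_iff)
  have 1: "cexec ?ev v (?s 0)" using ev[of 0] v0 by simp
  \<comment> \<open>\<open>k\<close> is what the decrement at the loop head leaves of
    \<open>Y m\<close>; the body discards it.\<close>
  have body: "cexec ?body ((?s m)(d + 1 := k)) (?s (Suc m))" if m: "m < n" for m k
  proof -
    have "((?s m)(d + 1 := k))(d + 1 := 0, d := Suc m) = v(d := Suc m)" using as by (simp add: fun_eq_iff)
    then have "cexec ?ev (((?s m)(d + 1 := k))(d + 1 := 0, d := Suc m)) (?s (Suc m))"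
      using ev[of "Suc m"] m by simp
    moreover have "cexec (CInc d) (((?s m)(d + 1 := k))(d + 1 := 0)) (((?s m)(d + 1 := k))(d + 1 := 0, d := Suc m))"
      by (rule cexec_eq[OF inc]) simp
    ultimately show ?thesis by (intro seq[OF cexec_clear seq])
  qed
  have all: "cexec (CLoop (d + 1) ?body) (?s m) (?s n)" if "m \<le> n" for m
    using that
  proof (induction m rule: inc_induct)
    case base
    show ?case by (rule loop_end) (simp add: Y)
  next
    case (step m)
    obtain k where "Y m = Suc k" using Y(2)[OF step(2)] by (cases "Y m") auto
    then show ?case by (intro loop[where n = k, OF _ body[OF step(2), of k] step(3)]) simp
  qed
  note 2 = all[OF le0]
  have "d \<noteq> t" using as(2) by simp
  note 3 = seq[OF 1 seq[OF 2 cexec_move[OF this]]]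
  show "cexec (compile (Mu g) as t d) v (v(t := n))" unfolding compile.simps
    by (rule cexec_eq[OF 3]) (use as Y in \<open>auto simp: fun_eq_iff\<close>)
qed

text \<open>Evaluation unfolds a primitive recursion from its last round, whereas the compiled
  program loops from the first one; the induction therefore also collects all intermediate values
  \<open>Y\<close>.\<close>

lemma rec_eval_compiled:
  assumes "rec_eval r xs y"
  shows "compiled r xs y \<and> (\<forall>g h n ys. r = Prim_Rec g h \<longrightarrow> xs = n # ys \<longrightarrow>
    (\<exists>Y. compiled g ys (Y 0) \<and> (\<forall>m<n. compiled h (m # Y m # ys) (Y (Suc m))) \<and> Y n = y))"
  using assms
proof (induction rule: rec_eval.induct)
  case (1 xs)
  have "v(t := 0) = v" if "v t = 0" for v :: "nat \<Rightarrow> nat" and t using that by (simp add: fun_eq_iff)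
  then show ?case by (auto simp: compiled_def intro: skip)
next
  case (2 x)
  have "cexec (compile Succ as t d) v (v(t := Suc x))"
    if a: "set as \<subseteq> {..<d}" "t < d" "t \<notin> set as" "map v as = [x]" "v t = 0" "\<forall>k\<ge>d. v k = 0" for as t d v
  proof -
    obtain b where "as = [b]" "v b = x" using a(4) by auto
    show ?thesis unfolding compile.simps
      by (rule cexec_eq[OF seq[OF cexec_copy inc]]) (use a \<open>as = [b]\<close> \<open>v b = x\<close> in auto)
  qed
  then show ?case by (simp add: compiled_def)
next
  case (3 i xs)
  have "cexec (compile (Proj i) as t d) v (v(t := xs ! i))"
    if "set as \<subseteq> {..<d}" "t < d" "t \<notin> set as" "map v as = xs" "v t = 0" "\<forall>k\<ge>d. v k = 0" for as t d v
  proof -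
    have i: "i < length as" "xs ! i = v (as ! i)" using that(4) 3 by auto
    then have "as ! i \<in> set as" by simp
    then have "as ! i < d" "as ! i \<noteq> t" using that by auto
    then show ?thesis unfolding compile.simps
      by (intro cexec_eq[OF cexec_copy]) (use that i in auto)
  qed
  then show ?case by (simp add: compiled_def)
next
  case (4 xs gs ys h z)
  have "list_all2 (\<lambda>g y. compiled g xs y) gs ys" by (rule list_all2_mono[OF 4(1)]) blast
  then show ?case using compiled_Comp 4 by blast
next
  case (5 g xs y h)
  have "compiled (Prim_Rec g h) (0 # xs) ((\<lambda>_. y) (0 :: nat))" using 5 by (intro compiled_Prim_Rec) auto
  moreover have "\<exists>Y :: nat \<Rightarrow> nat. compiled g xs (Y 0) \<and> Y 0 = y" using 5 by auto
  ultimately show ?case by auto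
next
  case (6 g h n xs y z)
  then obtain Y where Y: "compiled g xs (Y 0)" "\<forall>m<n. compiled h (m # Y m # xs) (Y (Suc m))" "Y n = y" by blast
  define Z where "Z = Y(Suc n := z)"
  have Z: "compiled g xs (Z 0)" "\<forall>m<Suc n. compiled h (m # Z m # xs) (Z (Suc m))" "Z (Suc n) = z"
    using Y 6 by (auto simp: Z_def less_Suc_eq)
  then have "compiled (Prim_Rec g h) (Suc n # xs) (Z (Suc n))" by (intro compiled_Prim_Rec) auto
  then show ?case using Z by auto
next
  case (7 g n xs)
  define Y where "Y m = (if m < n then SOME y. 0 < y \<and> compiled g (m # xs) y else 0)" for m
  have "0 < Y m \<and> compiled g (m # xs) (Y m)" if "m < n" for m
  proof -
    obtain y where "compiled g (m # xs) (Suc y)" using 7(3) \<open>m < n\<close> by metis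
    then have "\<exists>y. 0 < y \<and> compiled g (m # xs) y" by (intro exI[of _ "Suc y"]) simp
    from someI_ex[OF this] show ?thesis using that by (simp add: Y_def)
  qed
  moreover have "compiled g (n # xs) (Y n)" "Y n = 0" using 7(2) by (simp_all add: Y_def)
  ultimately have "compiled (Mu g) xs n" by (intro compiled_Mu[of n g xs Y]) (auto simp: le_less)
  then show ?case by simp
qed

section \<open>Counter programs as residue class rewriting\<close>

definition pr :: "nat \<Rightarrow> nat" where "pr r = enumerate {p. prime p} r"

lemma prime_pr: "prime (pr r)"
  using enumerate_in_set[OF primes_infinite] by (simp add: pr_def)

lemma pr_eq_iff: "pr r = pr s \<longleftrightarrow> r = s"
  using strict_mono_enumerate[OF primes_infinite] by (simp add: pr_def strict_mono_eq)

lemma pr_ge_2: "2 \<le> pr r" using prime_pr prime_ge_2_nat by blast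

lemma pr_0: "pr 0 = 2"
  unfolding pr_def enumerate_0 by (rule Least_equality) (auto dest: prime_ge_2_nat)

definition enc :: "nat \<Rightarrow> (nat \<Rightarrow> nat) \<Rightarrow> nat" where "enc D v = (\<Prod>r<D. pr r ^ v r)"

lemma enc_upd: "r < D \<Longrightarrow> enc D (v(r := k)) = pr r ^ k * (\<Prod>i\<in>{..<D} - {r}. pr i ^ v i)"
  unfolding enc_def by (subst prod.remove[of _ r]) (auto intro!: prod.cong)

lemma enc_Suc: "r < D \<Longrightarrow> enc D (v(r := Suc n)) = pr r * enc D (v(r := n))"
  by (simp add: enc_upd)

lemma enc_not_dvd: "r < D \<Longrightarrow> v r = 0 \<Longrightarrow> \<not> pr r dvd enc D v"
proof
  assume "r < D" "v r = 0" "pr r dvd enc D v"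
  then have "\<exists>i\<in>{..<D}. pr r dvd pr i ^ v i"
    using prime_dvd_prod_iff[of "{..<D}" "pr r" "\<lambda>i. pr i ^ v i"] prime_pr[of r] by (simp add: enc_def)
  then obtain i where i: "i < D" "pr r dvd pr i ^ v i" by auto
  then have "pr r dvd pr i" using prime_dvd_power prime_pr by blast
  then have "r = i" using primes_dvd_imp_eq[OF prime_pr prime_pr] pr_eq_iff by blast
  then show False using i \<open>v r = 0\<close> pr_ge_2[of r] by simp
qed

fun clen :: "com \<Rightarrow> nat" where
  "clen CSkip = 0"
| "clen (CInc r) = 1"
| "clen (CSeq a b) = clen a + clen b"
| "clen (CLoop r c) = clen c + 2"

fun creg :: "com \<Rightarrow> nat" where
  "creg CSkip = 0"
| "creg (CInc r) = Suc r"
| "creg (CSeq a b) = max (creg a) (creg b)"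
| "creg (CLoop r c) = max (Suc r) (creg c)"

text \<open>A loop has its head at \<open>s\<close>, its body from \<open>s + 1\<close> on and a
  jump back at \<open>s + 1 + clen c\<close>. A rule reads a single residue class, so leaving the
  loop takes one rule for each non-zero residue; these rules keep the number.\<close>

fun crules :: "com \<Rightarrow> nat \<Rightarrow> rule list" where
  "crules CSkip s = []"
| "crules (CInc r) s = [Rule s 1 0 (s + 1) (pr r) 0]"
| "crules (CSeq a b) s = crules a s @ crules b (s + clen a)"
| "crules (CLoop r c) s = Rule s (pr r) 0 (s + 1) 1 0 #
     map (\<lambda>j. Rule s (pr r) j (s + clen c + 2) (pr r) j) [1..<pr r] @
     crules c (s + 1) @ [Rule (s + 1 + clen c) 1 0 s 1 0]"

lemma crules_wf: "r \<in> set (crules c s) \<Longrightarrow>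
    res r < md r \<and> off r < mul r \<and> s \<le> src r \<and> src r < s + clen c \<and> tgt r \<le> s + clen c"
proof (induction c arbitrary: s)
  case (CInc x) then show ?case using pr_ge_2[of x] by simp
next
  case (CLoop x c)
  from CLoop.prems consider "r = Rule s (pr x) 0 (s + 1) 1 0"
    | j where "j < pr x" "r = Rule s (pr x) j (s + clen c + 2) (pr x) j"
    | "r \<in> set (crules c (s + 1))" | "r = Rule (s + 1 + clen c) 1 0 s 1 0" by auto
  then show ?case
  proof cases
    case 3 then show ?thesis using CLoop.IH[OF 3] by simp
  qed (use pr_ge_2[of x] in simp_all)
next
  case (CSeq a b)
  then consider "r \<in> set (crules a s)" | "r \<in> set (crules b (s + clen a))" by auto
  then show ?case
  proof cases
    case 1 then show ?thesis using CSeq.IH(1)[OF 1] by simp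
  next
    case 2 then show ?thesis using CSeq.IH(2)[OF 2] by simp
  qed
qed simp

text \<open>Rules of the same state share a modulus, so those with different residues apply to
  disjoint classes. This yields determinism on all integers, not only on those that encode
  registers.\<close>

lemma crules_det:
  "r \<in> set (crules c s) \<Longrightarrow> r' \<in> set (crules c s) \<Longrightarrow> src r = src r' \<Longrightarrow>
    md r = md r' \<and> (res r = res r' \<longrightarrow> r = r')"
proof (induction c arbitrary: s)
  case (CSeq a b)
  have A: "src q < s + clen a" if "q \<in> set (crules a s)" for q using crules_wf[OF that] by blast
  have B: "s + clen a \<le> src q" if "q \<in> set (crules b (s + clen a))" for q using crules_wf[OF that] by blast
  have mem: "q \<in> set (crules a s) \<or> q \<in> set (crules b (s + clen a))" if "q \<in> set (crules (CSeq a b) s)" for q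
    using that by simp
  show ?case
  proof (cases "src r < s + clen a")
    case True
    then have "r \<in> set (crules a s)" "r' \<in> set (crules a s)"
      using mem[OF CSeq.prems(1)] mem[OF CSeq.prems(2)] B[of r] B[of r'] CSeq.prems(3) by linarith+
    then show ?thesis using CSeq.IH(1) CSeq.prems(3) by blast
  next
    case False
    then have "r \<in> set (crules b (s + clen a))" "r' \<in> set (crules b (s + clen a))"
      using mem[OF CSeq.prems(1)] mem[OF CSeq.prems(2)] A[of r] A[of r'] CSeq.prems(3) by linarith+
    then show ?thesis using CSeq.IH(2) CSeq.prems(3) by blast
  qed
next
  case (CLoop x c)
  let ?H = "Rule s (pr x) 0 (s + 1) 1 0 # map (\<lambda>j. Rule s (pr x) j (s + clen c + 2) (pr x) j) [1..<pr x]"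
  have H: "src q = s" if "q \<in> set ?H" for q using that by auto
  have B: "s < src q \<and> src q < s + 1 + clen c" if "q \<in> set (crules c (s + 1))" for q
    using crules_wf[OF that] by simp
  have mem: "q \<in> set ?H \<or> q \<in> set (crules c (s + 1)) \<or> q = Rule (s + 1 + clen c) 1 0 s 1 0"
    if "q \<in> set (crules (CLoop x c) s)" for q using that by auto
  let ?J = "Rule (s + 1 + clen c) 1 0 s 1 0"
  have J: "src ?J = s + 1 + clen c" by simp
  have k1: "q \<in> set ?H" if q: "q \<in> set (crules (CLoop x c) s)" "src q = s" for q
    using mem[OF q(1)]
  proof (elim disjE)
    assume "q \<in> set (crules c (s + 1))" then show ?thesis using B[of q] q(2) by simp
  next
    assume "q = ?J" then show ?thesis using J q(2) by simp
  qed
  have k2: "q \<in> set (crules c (s + 1))" if q: "q \<in> set (crules (CLoop x c) s)" "src q \<noteq> s" "src q \<noteq> s + 1 + clen c" for q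
    using mem[OF q(1)] H[of q] q(2,3) J by metis
  have k3: "q = ?J" if q: "q \<in> set (crules (CLoop x c) s)" "src q = s + 1 + clen c" for q
    using mem[OF q(1)]
  proof (elim disjE)
    assume "q \<in> set (crules c (s + 1))" then show ?thesis using B[of q] q(2) by simp
  next
    assume "q \<in> set ?H" then show ?thesis using H[of q] q(2) by simp
  qed
  consider "src r = s" | "src r \<noteq> s" "src r \<noteq> s + 1 + clen c" | "src r = s + 1 + clen c" by blast
  then show ?case
  proof cases
    case 1
    then have "r \<in> set ?H" "r' \<in> set ?H" using k1 CLoop.prems by auto
    then show ?thesis by auto
  next
    case 2
    then have "r \<in> set (crules c (s + 1))" "r' \<in> set (crules c (s + 1))" using k2 CLoop.prems by metis+
    then show ?thesis using CLoop.IH CLoop.prems(3) by blast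
  next
    case 3
    then have "r = ?J" "r' = ?J" using k3 CLoop.prems by metis+
    then show ?thesis by simp
  qed
qed auto

lemma nstep_rule:
  assumes "Rule q m a q' c d \<in> set rs" shows "nstep rs (q, m * k + a) (q', c * k + d)"
proof -
  obtain i where i: "i < length rs" "Rule q m a q' c d = rs ! i" using assms by (metis in_set_conv_nth)
  show ?thesis using nstep.intros[OF i, of k] by simp
qed

lemma cexec_nstep:
  assumes "cexec c u v"
  shows "set (crules c s) \<subseteq> set rs \<Longrightarrow> creg c \<le> D \<Longrightarrow> (nstep rs)\<^sup>*\<^sup>* (s, enc D u) (s + clen c, enc D v)"
  using assms
proof (induction arbitrary: s rule: cexec.induct)
  case (inc r v)
  have "nstep rs (s, 1 * enc D v + 0) (s + 1, pr r * enc D v + 0)" using inc by (intro nstep_rule) simp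
  moreover have e: "enc D (v(r := Suc (v r))) = pr r * enc D v" using enc_Suc[of r D v "v r"] inc(2) by simp
  ultimately show ?case unfolding e by (simp add: r_into_rtranclp)
next
  case (seq a u v b w)
  have "(nstep rs)\<^sup>*\<^sup>* (s, enc D u) (s + clen a, enc D v)" using seq by simp
  also have "(nstep rs)\<^sup>*\<^sup>* (s + clen a, enc D v) (s + clen a + clen b, enc D w)" using seq by simp
  finally show ?case by (simp add: add.assoc)
next
  case (loop_end v r c)
  let ?j = "enc D v mod pr r" and ?k = "enc D v div pr r"
  have "?j \<noteq> 0" using enc_not_dvd[of r D v] loop_end by (simp add: mod_eq_0_iff_dvd)
  moreover have "?j < pr r" using pr_ge_2[of r] by (intro mod_less_divisor) simp
  ultimately have "Rule s (pr r) ?j (s + clen c + 2) (pr r) ?j \<in> set rs" using loop_end by auto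
  from nstep_rule[OF this, of ?k] show ?case by (simp add: r_into_rtranclp)
next
  case (loop u r n c v w)
  have u: "u = u(r := Suc n)" using loop(1) by (simp add: fun_eq_iff)
  have "nstep rs (s, pr r * enc D (u(r := n)) + 0) (s + 1, 1 * enc D (u(r := n)) + 0)"
    using loop.prems by (intro nstep_rule) simp
  moreover have "enc D u = pr r * enc D (u(r := n))" using enc_Suc[of r D u n] u loop.prems by simp
  ultimately have "(nstep rs)\<^sup>*\<^sup>* (s, enc D u) (s + 1, enc D (u(r := n)))" by (simp add: r_into_rtranclp)
  also have "(nstep rs)\<^sup>*\<^sup>* (s + 1, enc D (u(r := n))) (s + 1 + clen c, enc D v)"
    using loop.prems by (intro loop.IH(1)) auto
  also have "nstep rs (s + 1 + clen c, 1 * enc D v + 0) (s, 1 * enc D v + 0)"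
    using loop.prems by (intro nstep_rule) simp
  then have "(nstep rs)\<^sup>*\<^sup>* (s + 1 + clen c, enc D v) (s, enc D v)" by (simp add: r_into_rtranclp)
  also have "(nstep rs)\<^sup>*\<^sup>* (s, enc D v) (s + clen (CLoop r c), enc D w)"
    using loop.prems by (intro loop.IH(2)) auto
  finally show ?case .
qed simp

lemma crules_zstep_det:
  assumes "zstep (crules c s) x y" "zstep (crules c s) x y'" shows "y = y'"
  using assms(1)
proof cases
  case a: (1 i r k)
  from assms(2) show ?thesis
  proof cases
    case b: (1 i' r' k')
    have m: "r \<in> set (crules c s)" "r' \<in> set (crules c s)" using a b by simp_all
    have "src r = src r'" using a b by simp
    from crules_det[OF m this] have md: "md r = md r'" and eq: "res r = res r' \<Longrightarrow> r = r'" by blast+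
    have lt: "res r < md r" "res r' < md r'" using crules_wf m by blast+
    have *: "int (md r) * k + int (res r) = int (md r) * k' + int (res r')" using a b md by simp
    have "(int (md r) * k + int (res r)) mod int (md r) = int (res r)"
      "(int (md r) * k' + int (res r')) mod int (md r) = int (res r')" using lt md by simp_all
    then have "res r = res r'" using * by simp
    moreover from this have "k = k'" using * lt by simp
    ultimately show ?thesis using eq a b by simp
  qed
qed

lemma zstep_nstep: "nstep rs (q, n) (q', n') \<Longrightarrow> zstep rs (q, int n) (q', int n')"
proof (erule nstep.cases)
  fix i r k assume "i < length rs" "r = rs ! i" "(q, n) = (src r, md r * k + res r)" "(q', n') = (tgt r, mul r * k + off r)"
  then show ?thesis using zstep.intros[of i rs r "int k"] by simp
qed

lemma rtranclp_zstep_nstep: "(nstep rs)\<^sup>*\<^sup>* x y \<Longrightarrow> (zstep rs)\<^sup>*\<^sup>* (fst x, int (snd x)) (fst y, int (snd y))"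
  by (induction rule: rtranclp_induct) (auto dest!: zstep_nstep intro: rtranclp.rtrancl_into_rtrancl)

text \<open>\<open>c1\<close> computes the value, which brings the number to at least
  \<open>2 ^ f j\<close>, and \<open>c2\<close> empties all registers. Hence the run ends in the
  number \<open>1\<close> for every input, which is what the fixed relator \<open>final_rel\<close>
  speaks about; the peak is taken between the two parts.\<close>

theorem recursive_trajectory:
  assumes f: "\<And>j. rec_eval e [j] (f j)"
  obtains rs nq qh qp where
    "\<And>r. r \<in> set rs \<Longrightarrow> res r < md r \<and> off r < mul r \<and> src r < nq \<and> tgt r < nq"
    "\<And>c d d'. zstep rs c d \<Longrightarrow> zstep rs c d' \<Longrightarrow> d = d'" "\<And>n d. \<not> zstep rs (qh, n) d"
    "qh < nq" "0 < nq" "qp \<noteq> qh"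
    "\<And>j. \<exists>np. (nstep rs)\<^sup>*\<^sup>* (0, 2 ^ j) (qp, np) \<and> (nstep rs)\<^sup>*\<^sup>* (qp, np) (qh, 1) \<and> 2 ^ f j \<le> np"
proof -
  define c1 where "c1 = compile e [0] 1 2"
  define D where "D = max 2 (creg c1)"
  define c2 where "c2 = clears [0..<D]"
  define rs where "rs = crules (CSeq c1 c2) 0"
  \<comment> \<open>At least one register is cleared, which separates the state of the peak from the
    final one.\<close>
  have len2: "0 < clen c2"
  proof -
    have "[0..<D] = 0 # [1..<D]" using upt_conv_Cons[of 0 D] by (simp add: D_def)
    then show ?thesis by (simp add: c2_def clear_def)
  qed
  have regs: "creg (clears rl) \<le> D" if "set rl \<subseteq> {..<D}" for rl
    using that by (induction rl) (auto simp: clear_def)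
  have reg2: "creg c2 \<le> D" using regs[of "[0..<D]"] by (simp add: c2_def atLeast0LessThan)
  show ?thesis
  proof (rule that[of rs "Suc (clen c1 + clen c2)" "clen c1 + clen c2" "clen c1"])
    show "res r < md r \<and> off r < mul r \<and> src r < Suc (clen c1 + clen c2) \<and> tgt r < Suc (clen c1 + clen c2)"
      if "r \<in> set rs" for r
      using crules_wf[of r "CSeq c1 c2" 0] that unfolding rs_def by auto
    show "d = d'" if "zstep rs c d" "zstep rs c d'" for c d d'
      using crules_zstep_det that unfolding rs_def by blast
    show "\<not> zstep rs (clen c1 + clen c2, n) d" for n d
    proof
      assume "zstep rs (clen c1 + clen c2, n) d"
      then show False
      proof cases
        case (1 i r k)
        then have "r \<in> set rs" by simp
        then show False using 1 crules_wf[of r "CSeq c1 c2" 0] unfolding rs_def by simp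
      qed
    qed
    show "\<exists>np. (nstep rs)\<^sup>*\<^sup>* (0, 2 ^ j) (clen c1, np) \<and> (nstep rs)\<^sup>*\<^sup>* (clen c1, np) (clen c1 + clen c2, 1) \<and> 2 ^ f j \<le> np" for j
    proof -
      let ?u = "(\<lambda>_. 0 :: nat)(0 := j)" and ?v = "(\<lambda>_. 0 :: nat)(0 := j, 1 := f j)"
      have "enc D ?u = 2 ^ j" by (subst enc_upd) (auto simp: D_def pr_0)
      moreover have "cexec c1 ?u ?v" unfolding c1_def
        using rec_eval_compiled[OF f[of j]] by (intro compiledD) auto
      from cexec_nstep[OF this, of 0 rs D] have "(nstep rs)\<^sup>*\<^sup>* (0, enc D ?u) (clen c1, enc D ?v)"
        by (simp add: rs_def D_def)
      moreover have "cexec c2 ?v (\<lambda>k. if k \<in> set [0..<D] then 0 else ?v k)"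
        unfolding c2_def by (rule cexec_clears)
      from cexec_nstep[OF this, of "clen c1" rs D]
      have "(nstep rs)\<^sup>*\<^sup>* (clen c1, enc D ?v) (clen c1 + clen c2, enc D (\<lambda>k. if k \<in> set [0..<D] then 0 else ?v k))"
        using reg2 by (simp add: rs_def)
      moreover have "enc D (\<lambda>k. if k \<in> set [0..<D] then 0 else ?v k) = 1" unfolding enc_def by (intro prod.neutral) auto
      moreover have "2 ^ f j \<le> enc D ?v"
      proof -
        have "2 ^ f j \<le> pr 1 ^ f j" by (intro power_mono pr_ge_2) simp
        also have "\<dots> \<le> pr 1 ^ f j * (\<Prod>i\<in>{..<D} - {1}. pr i ^ ?u i)"
        proof -
          have "0 < (\<Prod>i\<in>{..<D} - {1}. pr i ^ ?u i)"
            by (intro prod_pos) (use pr_ge_2 in \<open>auto intro!: zero_less_power simp: pr_0\<close>)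
          then show ?thesis using mult_le_mono2[of 1 "\<Prod>i\<in>{..<D} - {1}. pr i ^ ?u i" "pr 1 ^ f j"] by linarith
        qed
        also have "\<dots> = enc D ?v" by (subst enc_upd) (auto simp: D_def)
        finally show ?thesis .
      qed
      ultimately show ?thesis by auto
    qed
  qed (use len2 in auto)
qed

section \<open>The bound to be exceeded\<close>

lemma rec_eval_Comp1: "rec_eval g xs a \<Longrightarrow> rec_eval h [a] z \<Longrightarrow> rec_eval (Comp h [g]) xs z"
  by (rule rec_eval.intros(4)[of _ _ "[a]"]) simp_all

lemma rec_eval_Comp2:
  "rec_eval g xs a \<Longrightarrow> rec_eval g' xs b \<Longrightarrow> rec_eval h [a, b] z \<Longrightarrow> rec_eval (Comp h [g, g']) xs z"
  by (rule rec_eval.intros(4)[of _ _ "[a, b]"]) simp_all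

lemma rec_eval_Proj: "i < length xs \<Longrightarrow> xs ! i = x \<Longrightarrow> rec_eval (Proj i) xs x"
  using rec_eval.intros(3)[of i xs] by simp

definition add_r :: recf where "add_r = Prim_Rec (Proj 0) (Comp Succ [Proj 1])"
definition mul_r :: recf where "mul_r = Prim_Rec Zero (Comp add_r [Proj 1, Proj 2])"
primrec const_r :: "nat \<Rightarrow> recf" where "const_r 0 = Zero" | "const_r (Suc n) = Comp Succ [const_r n]"
definition pow4_r :: recf where "pow4_r = Prim_Rec (const_r 1) (Comp mul_r [const_r 4, Proj 1])"
definition sum_r :: "recf \<Rightarrow> recf" where
  "sum_r e = Prim_Rec Zero (Comp add_r [Proj 1, Comp Succ [Comp e [Proj 0]]])"
text \<open>\<open>4 ^ j\<close> bounds the relator walks as well as the number of vertices. The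
  latter is unknown to the program and \<open>f\<close> need not be monotone, so \<open>f\<close> is
  summed over all candidates. The factor \<open>Suc j\<close> accounts for powers of
  \<open>C\<close>, which is at most \<open>2 ^ j\<close>.\<close>

definition bound_r :: "recf \<Rightarrow> recf" where
  "bound_r e = Comp mul_r [Succ, Comp add_r [Comp mul_r [pow4_r, Comp (sum_r e) [Comp Succ [pow4_r]]], const_r 3]]"

lemma rec_eval_add: "rec_eval add_r [a, b] (a + b)"
proof (induction a)
  case 0 show ?case unfolding add_r_def by (intro rec_eval.intros(5)) (simp add: rec_eval_Proj)
next
  case (Suc a)
  show ?case unfolding add_r_def
    by (rule rec_eval.intros(6)[OF Suc[unfolded add_r_def]], rule rec_eval_Comp1[OF rec_eval_Proj])
      (auto intro: rec_eval.intros)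
qed

lemma rec_eval_mul: "rec_eval mul_r [a, b] (a * b)"
proof (induction a)
  case 0 show ?case unfolding mul_r_def mult_0 by (intro rec_eval.intros(5) rec_eval.intros(1))
next
  case (Suc a)
  have "rec_eval (Comp add_r [Proj 1, Proj 2]) [a, a * b, b] (a * b + b)"
    by (rule rec_eval_Comp2[OF rec_eval_Proj rec_eval_Proj rec_eval_add]) simp_all
  from rec_eval.intros(6)[OF Suc[unfolded mul_r_def] this] show ?case
    unfolding mul_r_def by (simp add: add.commute)
qed

lemma rec_eval_const: "rec_eval (const_r n) xs n"
  by (induction n) (auto intro: rec_eval.intros(1,2) rec_eval_Comp1)

lemma rec_eval_pow4: "rec_eval pow4_r [j] (4 ^ j)"
proof (induction j)
  case 0 show ?case unfolding pow4_r_def power_0 by (intro rec_eval.intros(5) rec_eval_const)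
next
  case (Suc j)
  have "rec_eval (Comp mul_r [const_r 4, Proj 1]) [j, 4 ^ j] (4 * 4 ^ j)"
    by (rule rec_eval_Comp2[OF rec_eval_const rec_eval_Proj rec_eval_mul]) simp_all
  from rec_eval.intros(6)[OF Suc[unfolded pow4_r_def] this] show ?case unfolding pow4_r_def by simp
qed

lemma rec_eval_sum:
  assumes "\<And>n. rec_eval e [n] (f n)" shows "rec_eval (sum_r e) [n] (\<Sum>i<n. Suc (f i))"
proof (induction n)
  case 0 show ?case unfolding sum_r_def lessThan_0 sum.empty by (intro rec_eval.intros(5) rec_eval.intros(1))
next
  case (Suc n)
  let ?s = "\<Sum>i<n. Suc (f i)"
  have "rec_eval (Comp e [Proj 0]) [n, ?s] (f n)" by (rule rec_eval_Comp1[OF rec_eval_Proj assms]) simp_all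
  then have "rec_eval (Comp Succ [Comp e [Proj 0]]) [n, ?s] (Suc (f n))"
    by (rule rec_eval_Comp1[OF _ rec_eval.intros(2)])
  then have "rec_eval (Comp add_r [Proj 1, Comp Succ [Comp e [Proj 0]]]) [n, ?s] (?s + Suc (f n))"
    by (rule rec_eval_Comp2[OF rec_eval_Proj _ rec_eval_add, rotated 2]) simp_all
  from rec_eval.intros(6)[OF Suc[unfolded sum_r_def] this] show ?case unfolding sum_r_def by simp
qed

lemma rec_eval_bound:
  assumes "\<And>n. rec_eval e [n] (f n)"
  shows "rec_eval (bound_r e) [j] (Suc j * (4 ^ j * (\<Sum>i<Suc (4 ^ j). Suc (f i)) + 3))"
  unfolding bound_r_def
  by (intro rec_eval_Comp2[OF rec_eval.intros(2) _ rec_eval_mul] rec_eval_Comp2[OF _ rec_eval_const rec_eval_add]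
      rec_eval_Comp2[OF rec_eval_pow4 _ rec_eval_mul] rec_eval_Comp1[OF _ rec_eval_sum[OF assms]]
      rec_eval_Comp1[OF rec_eval_pow4 rec_eval.intros(2)])

lemma bound_exceeds:
  fixes f :: "nat \<Rightarrow> nat" and C j U V :: nat
  assumes U: "U \<le> 4 ^ j" and C: "C \<le> j" and V: "V \<le> U" and M: "M = Suc (Suc (f V) * U)"
    and np: "2 ^ (Suc j * (4 ^ j * (\<Sum>i<Suc (4 ^ j). Suc (f i)) + 3)) \<le> np"
  shows "C ^ M * (2 ^ j + 1) \<le> np"
proof -
  let ?X = "4 ^ j * (\<Sum>i<Suc (4 ^ j). Suc (f i))"
  have "Suc (f V) \<le> (\<Sum>i<Suc (4 ^ j). Suc (f i))"
    using V U by (intro member_le_sum[of V "{..<Suc (4 ^ j)}" "\<lambda>i. Suc (f i)"]) auto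
  then have "Suc (f V) * U \<le> ?X" using U mult_le_mono by (metis mult.commute)
  then have "j * M + j + 1 \<le> j * Suc ?X + j + 1" unfolding M by simp
  also have "\<dots> \<le> Suc j * (?X + 3)" by (simp add: algebra_simps)
  finally have e: "j * M + j + 1 \<le> Suc j * (?X + 3)" .
  have "C \<le> 2 ^ j" using C less_exp[of j] by linarith
  then have "C ^ M \<le> 2 ^ (j * M)" by (metis power_mono power_mult zero_le)
  then have "C ^ M * (2 ^ j + 1) \<le> 2 ^ (j * M) * 2 ^ (j + 1)" by (intro mult_le_mono) simp_all
  also have "\<dots> = 2 ^ (j * M + j + 1)" by (simp add: power_add)
  also have "\<dots> \<le> 2 ^ (Suc j * (?X + 3))" using e by (intro power_increasing) simp_all
  finally show ?thesis using np by linarith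
qed

theorem theorem1:
  fixes A :: "('q::finite, 's::finite) agent"
    and f :: "nat \<Rightarrow> nat"
  assumes "exploration_algorithm A"
    and "\<And>(G :: nat pair_pre_digraph) \<delta> s. G \<in> SC \<Longrightarrow> port_numbering G \<delta> \<Longrightarrow> s \<in> pverts G \<Longrightarrow>
           visits_all_and_halts A G \<delta> s"
    and "computable f"
  shows "\<exists>(G :: nat pair_pre_digraph) \<delta> s ws.
           G \<in> SC \<and> port_numbering G \<delta> \<and> s \<in> pverts G \<and>
           halting_run A G \<delta> s ws \<and> f (card (pverts G)) < length ws - 1"
proof -
  obtain e where e: "\<And>n. rec_eval e [n] (f n)" using assms(3) unfolding computable_def by blast
  let ?F = "\<lambda>j. Suc j * (4 ^ j * (\<Sum>i<Suc (4 ^ j). Suc (f i)) + 3)"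
  obtain rs nq qh qp where
    rule: "\<And>r. r \<in> set rs \<Longrightarrow> res r < md r \<and> off r < mul r \<and> src r < nq \<and> tgt r < nq"
    and det: "\<And>c d d'. zstep rs c d \<Longrightarrow> zstep rs c d' \<Longrightarrow> d = d'" and stops: "\<And>n d. \<not> zstep rs (qh, n) d"
    and q: "qh < nq" "0 < nq" "qp \<noteq> qh"
    and run: "\<And>j. \<exists>np. (nstep rs)\<^sup>*\<^sup>* (0, 2 ^ j) (qp, np) \<and> (nstep rs)\<^sup>*\<^sup>* (qp, np) (qh, 1) \<and> 2 ^ ?F j \<le> np"
    using recursive_trajectory[of "bound_r e" ?F, OF rec_eval_bound[OF e]] by metis
  obtain \<alpha> where \<alpha>: "\<And>n. (\<Sum>w\<leftarrow>rels rs nq qh 0 n. 4 * length w + 2) = \<alpha> + 16 * n"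
    using rels_size by metis
  define C where "C = 2 + (\<Sum>r\<leftarrow>rs. md r + mul r)"
  define \<beta> where "\<beta> = 3 + card (gens rs nq) + \<alpha>"
  \<comment> \<open>\<open>\<beta>\<close> is the part of the size that does not depend on the
    input. The summand \<open>\<beta> + 16\<close> gives \<open>U \<le> 4 ^ j\<close> and the
    summand \<open>C\<close> gives \<open>C \<le> j\<close>.\<close>
  define j where "j = \<beta> + 16 + C"
  define U where "U = \<beta> + 16 * 2 ^ j"
  have U: "U \<le> 4 ^ j"
  proof -
    have j: "\<beta> + 16 \<le> 2 ^ j" using less_exp[of j] unfolding j_def by linarith
    have "U \<le> (\<beta> + 16) * 2 ^ j" by (simp add: U_def algebra_simps)
    also have "\<dots> \<le> 2 ^ j * 2 ^ j" using j by (intro mult_le_mono) simp_all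
    also have "\<dots> = (4 :: nat) ^ j" by (simp flip: power_mult_distrib)
    finally show ?thesis .
  qed
  let ?R = "rels rs nq qh 0 (2 ^ j)"
  interpret pres: presentation "gens rs nq" ?R
    using rels_wf[of rs nq 0 qh] rule q by unfold_locales (auto simp: finite_gens)
  define V where "V = card (pverts pres.graph)"
  \<comment> \<open>The lower bound on runs asks for \<open>Suc k * U < M\<close> with
    \<open>k = f V\<close>.\<close>
  define M where "M = Suc (Suc (f V) * U)"
  have V: "V \<le> U" using pres.card_graph \<alpha>[of "2 ^ j"] by (simp add: V_def U_def \<beta>_def)
  obtain np where np: "(nstep rs)\<^sup>*\<^sup>* (0, 2 ^ j) (qp, np)" "(nstep rs)\<^sup>*\<^sup>* (qp, np) (qh, 1)" "2 ^ ?F j \<le> np"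
    using run by blast
  have "C ^ M * (2 ^ j + 1) \<le> np" by (rule bound_exceeds[OF U _ V M_def np(3)]) (simp add: j_def)
  then have "int (C ^ M * (2 ^ j + 1)) < int np + 1" by linarith
  then have far: "int C ^ M * (int (2 ^ j) + 1) < \<bar>snd (qp, int np)\<bar> + 1"
    by (simp add: algebra_simps)
  interpret residue_machine rs nq qh 0 "2 ^ j" C M "(qp, int np)"
  proof
    show "res r < md r \<and> off r < mul r \<and> md r \<le> C \<and> mul r \<le> C" if "r \<in> set rs" for r
    proof -
      have "md r + mul r \<le> (\<Sum>r\<leftarrow>rs. md r + mul r)" using that by (intro member_le_sum_list) auto
      then show ?thesis using rule[OF that] by (simp add: C_def)
    qed
    show "(zstep rs)\<^sup>*\<^sup>* (0, int (2 ^ j)) (qp, int np)" using rtranclp_zstep_nstep[OF np(1)] by simp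
  qed (use det stops q far in \<open>auto simp: C_def\<close>)
  have full: "(nstep rs)\<^sup>*\<^sup>* (0, 2 ^ j) (qh, 1)" using np(1,2) by (rule rtranclp_trans)
  \<comment> \<open>Any port numbering would do; here the port is the code of the neighbour.\<close>
  let ?G = "relabel to_nat pres.graph" and ?\<delta> = "\<lambda>u v :: gen vert. to_nat v"
  let ?\<delta>' = "\<lambda>x y. ?\<delta> (inv to_nat x) (inv to_nat y)"
  have "simply_connected_complex (clique_complex pres.graph)"
  proof (rule pres.simply_connected_graph)
    show "pres.loop_act g = 0" if "g \<in> gens rs nq" for g
      using rels_trivial[OF pres.weval_relator full that] by simp
  qed
  then have SC: "?G \<in> SC"
    using simply_connected_relabel[OF inj_to_nat pres.pair_graph_graph]
      relabel_finite_graph[OF inj_to_nat pres.finite_graph_graph] by (simp add: SC_def)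
  have \<delta>: "port_numbering pres.graph ?\<delta>" by (simp add: port_numbering_def inj_on_def)
  then have \<delta>': "port_numbering ?G ?\<delta>'" by (rule relabel_port_numbering[OF inj_to_nat])
  have s: "to_nat (VP :: gen vert) \<in> pverts ?G" by (simp add: relabel_def pres.graph_verts pres.core_def)
  obtain ws where ws: "halting_run A ?G ?\<delta>' (to_nat (VP :: gen vert)) ws"
    using assms(2)[OF SC \<delta>' s] unfolding visits_all_and_halts_def by blast
  have volt: "voltage pres.graph ?\<delta> (\<lambda>u v. app (pres.volt act u v)) height U VP"
  proof (rule pres.voltage_graph[OF \<delta> lipschitz_act])
    show "1 \<le> U" by (simp add: U_def \<beta>_def)
    show "4 * length (?R ! i) \<le> U" if "i < length ?R" for i
    proof -
      have "4 * length (?R ! i) + 2 \<le> (\<Sum>w\<leftarrow>?R. 4 * length w + 2)"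
        using that by (intro member_le_sum_list) (auto simp: image_iff intro!: bexI[of _ "?R ! i"])
      then show ?thesis using \<alpha>[of "2 ^ j"] by (simp add: U_def \<beta>_def)
    qed
  qed (rule rels_hold)
  \<comment> \<open>This means more than \<open>f V\<close> moves, as \<open>ws\<close> also lists
    the starting vertex.\<close>
  have "Suc (f V) < length ws"
  proof (rule exploration_algorithm_long_run[OF assms(1) volt _ _ ws])
    show "Suc (f V) * U < height start_pt" unfolding height_start by (simp add: M_def)
    show "infinite (\<Union>i. derived_ball pres.graph (\<lambda>u v. app (pres.volt act u v)) (VP, start_pt) i)"
      by (rule pres.infinite_derived_ball[where \<phi> = act and x = "Str GX", OF _ infinite_orbit]) (simp add: gens_def sgens_def)
  qed
  moreover have "card (pverts ?G) = V" by (simp add: relabel_def V_def card_image inj_on_def)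
  ultimately show ?thesis using SC \<delta>' s ws by (intro exI[of _ ?G] exI[of _ ?\<delta>'] exI[of _ "to_nat (VP :: gen vert)"] exI[of _ ws]) auto
qed

end
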